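(* Let $k\in\mathbb{N}$ and let $p$ be an odd prime such that either $(k,p-1)\leq 2$, or $p\equiv 5\pmod 8$ and $(k,p-1)=4$. Then the values $L(1,\chi)^k$, as $\chi$ runs through the odd Dirichlet characters modulo $p$, are linearly independent over $\mathbb{Q}$. Moreover, assuming Schanuel's conjecture, the values $L(1,\chi)^k$, as $\chi$ runs through all non-principal Dirichlet characters modulo $p$, are linearly independent over $\mathbb{Q}$.
   Context: $L(s,\chi)$ denotes the Dirichlet $L$-function of $\chi$. Schanuel's conjecture: for any $z_1,\dots,z_n\in\mathbb{C}$ linearly independent over $\mathbb{Q}$, the transcendence degree of $\mathbb{Q}(z_1,\dots,z_n,e^{z_1},\dots,e^{z_n})$ over $\mathbb{Q}$ is at least $n$. *)

theory Defs
  imports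
    "HOL-Analysis.Analysis"
    "HOL-Library.Poly_Mapping"
    "HOL-Library.Extended_Nat"
    "HOL-Number_Theory.Cong"
begin

section \<open>Linear independence over the rationals\<close>

global_interpretation rat_complex: vector_space "\<lambda>(q::rat) (z::complex). of_rat q * z"
  by unfold_locales (simp_all add: algebra_simps of_rat_add of_rat_mult)

text \<open>
  The library speaks of independent \<^emph>\<open>sets\<close>. For an indexed family a repeated value
  is a dependence, whence the injectivity requirement.
\<close>

definition lin_indep_over_rat :: "('i \<Rightarrow> complex) \<Rightarrow> 'i set \<Rightarrow> bool" where
  "lin_indep_over_rat f I \<longleftrightarrow> inj_on f I \<and> rat_complex.independent (f ` I)"

lemma lin_indep_over_rat_finite:
  assumes "finite I"
  shows "lin_indep_over_rat f I \<longleftrightarrow>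
    (\<forall>c::'i \<Rightarrow> rat. (\<Sum>i\<in>I. of_rat (c i) * f i) = 0 \<longrightarrow> (\<forall>i\<in>I. c i = 0))"
    (is "_ \<longleftrightarrow> ?R")
proof
  assume L: "lin_indep_over_rat f I"
  show ?R
  proof (intro allI impI ballI)
    fix c :: "'i \<Rightarrow> rat" and i
    assume c: "(\<Sum>i\<in>I. of_rat (c i) * f i) = 0" and i: "i \<in> I"
    have inj: "inj_on f I" and ind: "rat_complex.independent (f ` I)"
      using L by (auto simp: lin_indep_over_rat_def)
    let ?u = "\<lambda>v. c (the_inv_into I f v)"
    have "(\<Sum>v\<in>f ` I. of_rat (?u v) * v) = 0"
      using c by (simp add: sum.reindex[OF inj] the_inv_into_f_f[OF inj])
    then have "?u (f i) = 0"
      using rat_complex.independentD[OF ind, of "f ` I" ?u "f i"] assms i by auto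
    then show "c i = 0"
      using i by (simp add: the_inv_into_f_f[OF inj])
  qed
next
  assume R: ?R
  have inj: "inj_on f I"
  proof (rule inj_onI, rule ccontr)
    fix i j assume ij: "i \<in> I" "j \<in> I" "f i = f j" "i \<noteq> j"
    define c :: "'i \<Rightarrow> rat" where "c = (\<lambda>l. if l = i then 1 else if l = j then -1 else 0)"
    have "(\<Sum>l\<in>I. of_rat (c l) * f l) = (\<Sum>l\<in>{i,j}. of_rat (c l) * f l)"
      using assms ij by (intro sum.mono_neutral_right) (auto simp: c_def)
    also have "\<dots> = 0" using ij by (simp add: c_def)
    finally have "c i = 0" using R ij by blast
    then show False by (simp add: c_def)
  qed
  moreover have "rat_complex.independent (f ` I)"
  proof -
    have "u v = 0" if u: "(\<Sum>v\<in>f ` I. of_rat (u v) * v) = 0" and v: "v \<in> f ` I"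
      for u :: "complex \<Rightarrow> rat" and v
    proof -
      have "(\<Sum>i\<in>I. of_rat (u (f i)) * f i) = 0"
        using u by (simp add: sum.reindex[OF inj])
      then have "\<forall>i\<in>I. u (f i) = 0" using R[rule_format, of "\<lambda>i. u (f i)"] by blast
      then show "u v = 0" using v by auto
    qed
    then show ?thesis
      using assms by (subst rat_complex.dependent_finite) auto
  qed
  ultimately show "lin_indep_over_rat f I" by (simp add: lin_indep_over_rat_def)
qed


section \<open>Transcendence degree and Schanuel's conjecture\<close>

text \<open>
  A polynomial over the rationals is a finitely supported map from monomials to coefficients.
  The variables are named by complex numbers, and each is evaluated at the number naming it.
\<close>

definition eval_at_names :: "((complex \<Rightarrow>\<^sub>0 nat) \<Rightarrow>\<^sub>0 rat) \<Rightarrow> complex" where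
  "eval_at_names P = (\<Sum>m\<in>Poly_Mapping.keys P.
     of_rat (Poly_Mapping.lookup P m) * (\<Prod>x\<in>Poly_Mapping.keys m. x ^ Poly_Mapping.lookup m x))"

definition alg_indep_over_rat :: "complex set \<Rightarrow> bool" where
  "alg_indep_over_rat S \<longleftrightarrow>
     (\<forall>P. (\<forall>m\<in>Poly_Mapping.keys P. Poly_Mapping.keys m \<subseteq> S) \<and> eval_at_names P = 0 \<longrightarrow> P = 0)"

definition trdeg_over_rat :: "complex set \<Rightarrow> enat" where
  "trdeg_over_rat K = (SUP S\<in>{S. finite S \<and> S \<subseteq> K \<and> alg_indep_over_rat S}. enat (card S))"

definition complex_subfield :: "complex set \<Rightarrow> bool" where
  "complex_subfield K \<longleftrightarrow> 0 \<in> K \<and> 1 \<in> K \<and>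
     (\<forall>x\<in>K. \<forall>y\<in>K. x + y \<in> K \<and> x * y \<in> K) \<and> (\<forall>x\<in>K. - x \<in> K \<and> inverse x \<in> K)"

text \<open>Every subfield of the complex numbers contains the rationals.\<close>

definition rat_adjoin :: "complex set \<Rightarrow> complex set" where
  "rat_adjoin A = complex_subfield hull A"

definition schanuel_conjecture :: bool where
  "schanuel_conjecture \<longleftrightarrow>
     (\<forall>(n::nat) (z::nat \<Rightarrow> complex). lin_indep_over_rat z {1..n} \<longrightarrow>
        trdeg_over_rat (rat_adjoin (z ` {1..n} \<union> (\<lambda>i. exp (z i)) ` {1..n})) \<ge> enat n)"


section \<open>Dirichlet characters and L-functions\<close>

definition dirichlet_characters :: "nat \<Rightarrow> (int \<Rightarrow> complex) set" where
  "dirichlet_characters m =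
     {\<psi>. (\<forall>a. \<psi> (a + int m) = \<psi> a) \<and> (\<forall>a b. \<psi> (a * b) = \<psi> a * \<psi> b) \<and>
         (\<forall>a. \<psi> a \<noteq> 0 \<longleftrightarrow> coprime a (int m))}"

definition principal_character :: "nat \<Rightarrow> int \<Rightarrow> complex" where
  "principal_character m = (\<lambda>a. if coprime a (int m) then 1 else 0)"

definition odd_character :: "(int \<Rightarrow> complex) \<Rightarrow> bool" where
  "odd_character \<psi> \<longleftrightarrow> \<psi> (-1) = -1"

text \<open>
  The (conditionally convergent) Dirichlet series represents the L-function of a non-principal
  character on the half-plane \<open>Re s > 0\<close>. Outside the region of convergence the definition
  is meaningless; for \<open>s = 1\<close> convergence is proved below.
\<close>

definition dirichlet_L :: "complex \<Rightarrow> (int \<Rightarrow> complex) \<Rightarrow> complex" where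
  "dirichlet_L s \<psi> = suminf (\<lambda>n. \<psi> (int (Suc n)) / of_nat (Suc n) powr s)"

lemma dirichlet_character_mod:
  assumes "\<psi> \<in> dirichlet_characters m"
  shows "\<psi> (a mod int m) = \<psi> a"
proof -
  have per: "\<psi> (b + int m) = \<psi> b" for b
    using assms by (auto simp: dirichlet_characters_def)
  have nat_mult: "\<psi> (b + int m * int j) = \<psi> b" for b j
  proof (induction j)
    case (Suc j)
    have "\<psi> (b + int m * int (Suc j)) = \<psi> (b + int m * int j + int m)"
      by (simp add: algebra_simps)
    then show ?case using Suc per by simp
  qed simp
  have "\<psi> (b + int m * j) = \<psi> b" for b j
  proof (cases "j \<ge> 0")
    case True
    then show ?thesis using nat_mult[of b "nat j"] by simp
  next
    case False
    then show ?thesis using nat_mult[of "b + int m * j" "nat (- j)"] by simp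
  qed
  from this[of "a mod int m" "a div int m"] show ?thesis by simp
qed

lemma sum_nonprincipal_character:
  assumes \<psi>: "\<psi> \<in> dirichlet_characters m" and np: "\<psi> \<noteq> principal_character m" and m: "m > 0"
  shows "(\<Sum>a\<in>{0..<int m}. \<psi> a) = 0"
proof -
  have mult: "\<psi> (a * b) = \<psi> a * \<psi> b" and nz: "\<psi> a \<noteq> 0 \<longleftrightarrow> coprime a (int m)" for a b
    using \<psi> by (auto simp: dirichlet_characters_def)
  obtain c where "\<psi> c \<noteq> principal_character m c" using np by blast
  with nz[of c] have c: "coprime c (int m)" "\<psi> c \<noteq> 1"
    by (auto simp: principal_character_def split: if_splits)
  have inj: "inj_on (\<lambda>a. (c * a) mod int m) {0..<int m}"
  proof (rule inj_onI)
    fix a b assume ab: "a \<in> {0..<int m}" "b \<in> {0..<int m}" "c * a mod int m = c * b mod int m"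
    then have "[c * a = c * b] (mod int m)" by (simp add: cong_def)
    then have "[a = b] (mod int m)" using c by (simp add: cong_mult_lcancel)
    then show "a = b" using ab by (simp add: cong_def)
  qed
  have sub: "(\<lambda>a. (c * a) mod int m) ` {0..<int m} \<subseteq> {0..<int m}" using m by auto
  have im: "(\<lambda>a. (c * a) mod int m) ` {0..<int m} = {0..<int m}"
    by (rule endo_inj_surj[OF _ sub inj]) simp
  have "(\<Sum>a\<in>{0..<int m}. \<psi> a) = (\<Sum>a\<in>{0..<int m}. \<psi> ((c * a) mod int m))"
    using sum.reindex[OF inj, of \<psi>] by (simp add: im)
  also have "\<dots> = \<psi> c * (\<Sum>a\<in>{0..<int m}. \<psi> a)"
    by (simp add: dirichlet_character_mod[OF \<psi>] mult sum_distrib_left)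
  finally show ?thesis using c(2) by (simp add: mult_cancel_right1)
qed

lemma bounded_sum_nonprincipal_character:
  assumes \<psi>: "\<psi> \<in> dirichlet_characters m" and np: "\<psi> \<noteq> principal_character m" and m: "m > 0"
  shows "\<exists>C. \<forall>N. norm (\<Sum>n<N. \<psi> (int n)) \<le> C"
proof -
  define B where "B = (\<lambda>N. \<Sum>n<N. \<psi> (int n))"
  have "B m = (\<Sum>a\<in>{0..<int m}. \<psi> a)"
    unfolding B_def
    by (rule sum.reindex_bij_witness[of _ nat int]) auto
  then have Bm: "B m = 0" using sum_nonprincipal_character[OF assms] by simp
  have per: "B (m + N) = B N" for N
  proof (induction N)
    case (Suc N)
    have "\<psi> (int (m + N)) = \<psi> (int N)"
      using \<psi> by (simp add: dirichlet_characters_def add.commute)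
    then show ?case using Suc by (simp add: B_def)
  qed (simp add: Bm, simp add: B_def)
  have "B N \<in> B ` {..<m}" for N
  proof (induction N rule: less_induct)
    case (less N)
    show ?case
    proof (cases "N < m")
      case False
      then have "B N = B (N - m)" using per[of "N - m"] by simp
      then show ?thesis using less[of "N - m"] False m by simp
    qed auto
  qed
  then have "\<forall>N. norm (B N) \<le> Max (norm ` B ` {..<m})"
    by (intro allI Max_ge) auto
  then show ?thesis unfolding B_def by blast
qed

lemma dirichlet_L_1_sums:
  assumes \<psi>: "\<psi> \<in> dirichlet_characters m" and np: "\<psi> \<noteq> principal_character m" and m: "m > 0"
  shows "(\<lambda>n. \<psi> (int (Suc n)) / of_nat (Suc n)) sums dirichlet_L 1 \<psi>"
proof -
  obtain C where C: "\<And>N. norm (\<Sum>n<N. \<psi> (int n)) \<le> C"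
    using bounded_sum_nonprincipal_character[OF assms] by blast
  define B where "B = (\<lambda>N. \<Sum>n<N. \<psi> (int (Suc n)))"
  define a where "a = (\<lambda>n. inverse (real (Suc n)))"
  have "norm (B N) \<le> C + norm (\<psi> 0)" for N
  proof -
    have "B N = (\<Sum>n<Suc N. \<psi> (int n)) - \<psi> 0"
      unfolding B_def by (subst sum.lessThan_Suc_shift) simp
    then show ?thesis
      using C[of "Suc N"] norm_triangle_ineq4[of "\<Sum>n<Suc N. \<psi> (int n)" "\<psi> 0"] by simp
  qed
  then obtain D where D: "\<And>N. norm (B N) \<le> D" by blast
  have a0: "a \<longlonglongrightarrow> 0" unfolding a_def by (rule LIMSEQ_inverse_real_of_nat)
  have adec: "a (Suc n) \<le> a n" for n by (simp add: a_def field_simps)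
  have parts: "(\<Sum>n<N. of_real (a n) * \<psi> (int (Suc n))) =
      of_real (a N) * B N + (\<Sum>n<N. of_real (a n - a (Suc n)) * B (Suc n))" for N
    by (induction N) (simp_all add: B_def algebra_simps)
  have "summable (\<lambda>n. a n - a (Suc n))"
    using telescope_summable'[OF a0] by simp
  then have "summable (\<lambda>n. D * (a n - a (Suc n)))" by (rule summable_mult)
  then have "summable (\<lambda>n. of_real (a n - a (Suc n)) * B (Suc n))"
  proof (rule summable_comparison_test'[where N = 0])
    fix n
    have "norm (B (Suc n)) * (a n - a (Suc n)) \<le> D * (a n - a (Suc n))"
      using D adec by (intro mult_right_mono) auto
    then show "norm (of_real (a n - a (Suc n)) * B (Suc n)) \<le> D * (a n - a (Suc n))"
      using adec[of n] by (simp add: norm_mult mult.commute del: of_real_diff)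
  qed
  then obtain l where l: "(\<lambda>N. \<Sum>n<N. of_real (a n - a (Suc n)) * B (Suc n)) \<longlonglongrightarrow> l"
    unfolding summable_def sums_def by blast
  have "(\<lambda>N. of_real (a N) * B N) \<longlonglongrightarrow> 0"
  proof (rule Lim_null_comparison)
    show "\<forall>\<^sub>F N in sequentially. norm (of_real (a N) * B N) \<le> a N * D"
    proof (intro always_eventually allI)
      fix N
      have "a N \<ge> 0" by (simp add: a_def)
      then show "norm (of_real (a N) * B N) \<le> a N * D"
        using D[of N] by (simp add: norm_mult mult_left_mono)
    qed
    show "(\<lambda>N. a N * D) \<longlonglongrightarrow> 0" using tendsto_mult_left_zero[OF a0] by simp
  qed
  from tendsto_add[OF this l]
  have "(\<lambda>n. of_real (a n) * \<psi> (int (Suc n))) sums l"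
    unfolding sums_def parts by simp
  then have "(\<lambda>n. \<psi> (int (Suc n)) / of_nat (Suc n)) sums l"
    by (simp add: a_def divide_inverse mult.commute)
  moreover have "dirichlet_L 1 \<psi> = suminf (\<lambda>n. \<psi> (int (Suc n)) / of_nat (Suc n))"
    unfolding dirichlet_L_def by (metis powr_to_1)
  ultimately show ?thesis by (simp add: sums_iff)
qed

end

theory Submission
  imports Defs "HOL-Number_Theory.Number_Theory" "Jordan_Normal_Form.Char_Poly"
begin

text \<open>
  For odd \<open>\<chi>\<close> the value \<open>L(1, \<chi>)\<close> is \<open>\<pi>\<i>\<close> times an element \<open>G\<^sub>\<chi>\<close> of the cyclotomic field of order
  \<open>p (p - 1)\<close>. The conjugations fixing the roots of unity of order \<open>p - 1\<close> multiply \<open>G\<^sub>\<chi>\<^sup>k\<close> by values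
  of \<open>\<chi>\<^sup>-\<^sup>k\<close>, so a linear relation splits into relations between characters with the same \<open>k\<close>-th
  power. The condition on \<open>k\<close> leaves at most the pair \<open>\<chi>\<close>, \<open>\<chi>\<epsilon>\<close> with \<open>\<epsilon>\<close> quadratic. These two are
  conjugate, so a relation gives \<open>G\<^sub>\<chi>\<^sup>2\<^sup>k = G\<^sub>\<chi>\<^sub>\<epsilon>\<^sup>2\<^sup>k\<close>, which is impossible because \<open>G\<^sub>\<chi> / G\<^sub>\<chi>\<^sub>\<epsilon>\<close> is
  \<open>\<surd>p\<close> times an element of the cyclotomic field of order \<open>p - 1\<close>.

  For even \<open>\<chi>\<close> the value \<open>L(1, \<chi>)\<close> is a linear form in the logarithms \<open>log |1 - \<zeta>\<^sup>a|\<close>. Nonvanishing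
  of all \<open>L(1, \<chi>)\<close> makes these logarithms and \<open>\<pi>\<i>\<close> independent over the rationals, and Schanuel's
  conjecture gives the field they generate the largest possible transcendence degree. A relation
  between the \<open>L(1, \<chi>)\<^sup>k\<close> involving an even character would lower it.
\<close>

section \<open>Roots of unity and Galois conjugation\<close>

text \<open>No field automorphism is ever built. An identity is written as the vanishing of a
  function of \<open>s\<close> at 1; its values at the units \<open>s\<close> are the conjugate
  identities, and the Chinese remainder theorem lets \<open>s\<close> act separately on the roots of
  unity of order \<open>p\<close> and of order \<open>p - 1\<close>.

  For an odd character chi, the product of chi with the quadratic character is odd only if
  \<open>h = (p - 1) / 2\<close> is even. Exactly then \<open>1 + h\<close> is a unit modulo
  \<open>2 * h\<close>, and its conjugation exchanges the two.

  Nonvanishing at 1 needs two arguments. For nonreal chi the classical 3-4-1 inequality works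
  because the square of chi is nonprincipal. For the quadratic character it fails and arithmetic
  takes over: the parity of an integer if \<open>h\<close> is odd, the irrationality of the square
  root of \<open>p\<close> if \<open>h\<close> is even.

  The principal character has no value at 1, but its place among the Fourier coefficients of the
  logarithms is taken by \<open>ln p / 2\<close>. With this number and pi times i, the
  \<open>h - 1\<close> even values make \<open>h + 1\<close> generators, exactly as many as
  Schanuel's conjecture requires, so a single relation is already too much.\<close>

definition rt :: "nat \<Rightarrow> nat \<Rightarrow> complex" where
  "rt N a = cis (2 * pi * real a / real N)"

lemma rt_0 [simp]: "rt N 0 = 1"
  by (simp add: rt_def)

lemma rt_add: "rt N (a + b) = rt N a * rt N b"
  by (simp add: rt_def cis_mult add_divide_distrib distrib_left)

lemma rt_power: "rt N a ^ k = rt N (a * k)"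
  by (simp add: rt_def Complex.DeMoivre mult_ac)

lemma rt_nonzero [simp]: "rt N a \<noteq> 0"
  by (simp add: rt_def)

lemma norm_rt [simp]: "norm (rt N a) = 1"
  by (simp add: rt_def)

lemma rt_scale: "M > 0 \<Longrightarrow> rt (M * N) (M * a) = rt N a"
  by (simp add: rt_def mult.assoc)

lemma rt_eq_1_iff:
  assumes "N > 0"
  shows "rt N a = 1 \<longleftrightarrow> N dvd a"
proof
  assume "rt N a = 1"
  then have "cos (2 * pi * real a / real N) = 1"
    by (simp add: rt_def complex_eq_iff)
  then obtain n :: int where "2 * pi * real a / real N = real_of_int n * 2 * pi"
    unfolding cos_one_2pi_int by blast
  then have "pi * real a = pi * (real_of_int n * real N)"
    using assms by (simp add: field_simps)
  then have "real_of_int (int a) = real_of_int (n * int N)" by simp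
  then have "int a = n * int N" using of_int_eq_iff by blast
  then show "N dvd a" by (metis dvd_triv_right int_dvd_int_iff)
next
  assume "N dvd a"
  then obtain c where "a = N * c" by blast
  then have "2 * pi * real a / real N = 2 * pi * real c" using assms by simp
  then show "rt N a = 1" by (simp add: rt_def cis_multiple_2pi)
qed

lemma rt_mod:
  assumes "N > 0"
  shows "rt N (a mod N) = rt N a"
proof -
  have "rt N a = rt N (a mod N + N * (a div N))" by simp
  also have "\<dots> = rt N (a mod N) * rt N (N * (a div N))" by (rule rt_add)
  also have "rt N (N * (a div N)) = 1" using assms by (simp add: rt_eq_1_iff)
  finally show ?thesis by simp
qed

lemma rt_cong: "N > 0 \<Longrightarrow> [a = b] (mod N) \<Longrightarrow> rt N a = rt N b"
  using rt_mod[of N a] rt_mod[of N b] by (simp add: cong_def)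

lemma sum_rt:
  assumes "N > 0"
  shows "(\<Sum>i<N. rt N (i * a)) = (if N dvd a then of_nat N else 0)"
proof (cases "N dvd a")
  case True
  then have "rt N (i * a) = 1" for i using assms by (simp add: rt_eq_1_iff)
  then show ?thesis using True by simp
next
  case False
  then have ne: "rt N a \<noteq> 1" using assms by (simp add: rt_eq_1_iff)
  have "(\<Sum>i<N. rt N (i * a)) = (\<Sum>i<N. rt N a ^ i)"
    by (simp add: rt_power mult.commute)
  also have "\<dots> = (rt N a ^ N - 1) / (rt N a - 1)" using ne by (rule geometric_sum)
  also have "rt N a ^ N = 1" using assms by (simp add: rt_power rt_eq_1_iff)
  finally show ?thesis using False by simp
qed

text \<open>
  An integer polynomial expression \<open>F 1\<close> in \<open>\<zeta> = rt N 1\<close> is represented together with the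
  expressions \<open>F s\<close> obtained by the substitution of \<open>\<zeta>\<^sup>s\<close> for \<open>\<zeta>\<close>; Galois conjugation
  becomes a change of argument.
\<close>

inductive_set cyclo :: "nat \<Rightarrow> (nat \<Rightarrow> complex) set" for N where
  cyclo_int: "(\<lambda>s. of_int c) \<in> cyclo N"
| cyclo_rt: "(\<lambda>s. rt N (m * s)) \<in> cyclo N"
| cyclo_add: "F \<in> cyclo N \<Longrightarrow> G \<in> cyclo N \<Longrightarrow> (\<lambda>s. F s + G s) \<in> cyclo N"
| cyclo_mult: "F \<in> cyclo N \<Longrightarrow> G \<in> cyclo N \<Longrightarrow> (\<lambda>s. F s * G s) \<in> cyclo N"

lemma cyclo_0: "(\<lambda>s. 0) \<in> cyclo N" using cyclo_int[of 0] by simp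
lemma cyclo_1: "(\<lambda>s. 1) \<in> cyclo N" using cyclo_int[of 1] by simp
lemma cyclo_of_nat: "(\<lambda>s. of_nat n) \<in> cyclo N" using cyclo_int[of "int n"] by simp

lemma cyclo_diff:
  assumes "F \<in> cyclo N" "G \<in> cyclo N"
  shows "(\<lambda>s. F s - G s) \<in> cyclo N"
proof -
  have "(\<lambda>s. F s + of_int (-1) * G s) \<in> cyclo N"
    by (rule cyclo_add[OF assms(1) cyclo_mult[OF cyclo_int assms(2)]])
  then show ?thesis by simp
qed

lemma cyclo_power:
  assumes "F \<in> cyclo N"
  shows "(\<lambda>s. F s ^ n) \<in> cyclo N"
proof (induction n)
  case (Suc n)
  show ?case unfolding power_Suc by (rule cyclo_mult[OF assms Suc])
qed (simp add: cyclo_1)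

lemma cyclo_sum:
  assumes "\<And>i. i \<in> I \<Longrightarrow> F i \<in> cyclo N"
  shows "(\<lambda>s. \<Sum>i\<in>I. F i s) \<in> cyclo N"
  using assms
proof (induction I rule: infinite_finite_induct)
  case (insert i I)
  have "(\<lambda>s. (+) (F i s) (\<Sum>i\<in>I. F i s)) \<in> cyclo N"
    by (rule cyclo_add) (use insert in simp_all)
  then show ?case using insert.hyps by simp
qed (simp_all add: cyclo_0)

lemma cyclo_prod:
  assumes "\<And>i. i \<in> I \<Longrightarrow> F i \<in> cyclo N"
  shows "(\<lambda>s. \<Prod>i\<in>I. F i s) \<in> cyclo N"
  using assms
proof (induction I rule: infinite_finite_induct)
  case (insert i I)
  have "(\<lambda>s. (*) (F i s) (\<Prod>i\<in>I. F i s)) \<in> cyclo N"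
    by (rule cyclo_mult) (use insert in simp_all)
  then show ?case using insert.hyps by simp
qed (simp_all add: cyclo_1)

lemma cyclo_rt_dvd:
  assumes "M dvd N" "N > 0"
  shows "(\<lambda>s. rt M (m * s)) \<in> cyclo N"
proof -
  obtain c where c: "N = c * M" using assms(1) by (auto simp: dvd_def mult.commute)
  have "rt M (m * s) = rt N ((c * m) * s)" for s
    using assms(2) rt_scale[of c M "m * s"] by (simp add: c mult.assoc)
  then show ?thesis by (simp only: cyclo_rt)
qed

lemmas cyclo_intros = cyclo_int cyclo_0 cyclo_1 cyclo_of_nat cyclo_add cyclo_diff cyclo_mult
  cyclo_power cyclo_sum cyclo_prod

lemma cyclo_cong:
  assumes "F \<in> cyclo N" "N > 0" "[s = t] (mod N)"
  shows "F s = F t"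
  using assms(1)
proof induction
  case (cyclo_rt m)
  show ?case by (rule rt_cong[OF assms(2) cong_scalar_left[OF assms(3)]])
next
  case (cyclo_int c) show ?case by (rule refl)
next
  case (cyclo_add F G) from cyclo_add.IH show ?case by (simp only:)
next
  case (cyclo_mult F G) from cyclo_mult.IH show ?case by (simp only:)
qed

lemma cyclo_shift:
  assumes "F \<in> cyclo N"
  shows "(\<lambda>s. F (j * s)) \<in> cyclo N"
  using assms
proof induction
  case (cyclo_rt m)
  show ?case using cyclo.cyclo_rt[of N "m * j"] by (simp only: mult.assoc)
next
  case (cyclo_int c) show ?case by (rule cyclo.cyclo_int)
next
  case (cyclo_add F G) from cyclo_add.IH show ?case by (rule cyclo.cyclo_add)
next
  case (cyclo_mult F G) from cyclo_mult.IH show ?case by (rule cyclo.cyclo_mult)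
qed

text \<open>The divided binomial coefficients are written out as integers so that the remainder, as
  a function of \<open>s\<close>, stays in \<open>cyclo N\<close>.\<close>

lemma prime_dvd_binomial_power:
  fixes x y :: complex
  assumes q: "prime q"
  shows "(x + y) ^ q = x ^ q + y ^ q +
    of_nat q * (\<Sum>i\<in>{1..<q}. of_int (int ((q choose i) div q)) * (x ^ i * y ^ (q - i)))"
proof -
  have q0: "q > 0" using q prime_gt_0_nat by blast
  have "(x + y) ^ q = (\<Sum>i\<le>q. of_nat (q choose i) * x ^ i * y ^ (q - i))"
    by (rule binomial_ring)
  also have "{..q} = insert 0 (insert q {1..<q})" using q0 by auto
  also have "(\<Sum>i\<in>insert 0 (insert q {1..<q}). of_nat (q choose i) * x ^ i * y ^ (q - i))
     = y ^ q + (x ^ q + (\<Sum>i\<in>{1..<q}. of_nat (q choose i) * x ^ i * y ^ (q - i)))"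
    using q0 by (subst sum.insert; simp)+
  also have "(\<Sum>i\<in>{1..<q}. of_nat (q choose i) * x ^ i * y ^ (q - i)) =
     (\<Sum>i\<in>{1..<q}. of_nat q * (of_int (int ((q choose i) div q)) * (x ^ i * y ^ (q - i))))"
  proof (rule sum.cong[OF refl])
    fix i assume "i \<in> {1..<q}"
    then have "q dvd (q choose i)" using q by (intro dvd_choose_prime) auto
    then obtain c where "q choose i = q * c" by blast
    then show "of_nat (q choose i) * x ^ i * y ^ (q - i) =
       of_nat q * (of_int (int ((q choose i) div q)) * (x ^ i * y ^ (q - i)))"
      using q0 by simp
  qed
  finally show ?thesis by (simp add: sum_distrib_left algebra_simps)
qed

text \<open>Modulo \<open>q\<close> the \<open>q\<close>-th power is additive and fixes the
  integers, so it agrees with the substitution of \<open>rt N q\<close> for \<open>rt N 1\<close>.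
  One \<open>H\<close> serves all \<open>s\<close>, because it is built by the same induction as
  \<open>F\<close>.\<close>

lemma cyclo_frobenius:
  assumes "F \<in> cyclo N" "prime q"
  shows "\<exists>H\<in>cyclo N. \<forall>s. F (q * s) = F s ^ q + of_nat q * H s"
  using assms(1)
proof induction
  case (cyclo_int c)
  have "[c ^ q = c] (mod int q)"
  proof (cases "int q dvd c")
    case True
    then have "int q dvd c ^ q"
      using prime_gt_0_nat[OF assms(2)] by (meson dvd_power dvd_trans)
    with True show ?thesis by (simp add: cong_def mod_eq_0_iff_dvd)
  next
    case False
    have "[c ^ (q - 1) = 1] (mod int q)"
    proof -
      define a where "a = nat (c mod int q)"
      have qp: "q > 0" using assms(2) prime_gt_0_nat by blast
      have a: "int a = c mod int q" using qp by (simp add: a_def)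
      have "\<not> q dvd a"
        using False a by (metis int_dvd_int_iff mod_eq_0_iff_dvd mod_mod_trivial)
      then have "[a ^ (q - 1) = 1] (mod q)" using assms(2) by (intro fermat_theorem)
      then have "[int a ^ (q - 1) = 1] (mod int q)"
        by (metis cong_int_iff of_nat_1 of_nat_power)
      then show ?thesis by (simp add: a cong_def power_mod)
    qed
    then have "[c ^ (q - 1) * c = 1 * c] (mod int q)" by (rule cong_scalar_right)
    then show ?thesis using prime_gt_0_nat[OF assms(2)]
      by (metis Suc_diff_1 mult_1 power_Suc2)
  qed
  then obtain d where "c = c ^ q + int q * d"
    using cong_iff_lin by blast
  then have "(of_int c :: complex) = of_int c ^ q + of_nat q * of_int d"
    by (metis of_int_add of_int_mult of_int_of_nat_eq of_int_power)
  then show ?case by (intro bexI[OF _ cyclo.cyclo_int[of d]]) auto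
next
  case (cyclo_rt m)
  show ?case by (intro bexI[OF _ cyclo_0]) (simp add: rt_power mult_ac)
next
  case (cyclo_add F G)
  then obtain H K where HK: "H \<in> cyclo N" "K \<in> cyclo N"
    "\<And>s. F (q * s) = F s ^ q + of_nat q * H s" "\<And>s. G (q * s) = G s ^ q + of_nat q * K s"
    by blast
  let ?L = "\<lambda>s. H s + K s -
     (\<Sum>i\<in>{1..<q}. of_int (int ((q choose i) div q)) * (F s ^ i * G s ^ (q - i)))"
  have "?L \<in> cyclo N" by (intro cyclo_intros HK cyclo_add)
  moreover have "F (q * s) + G (q * s) = (F s + G s) ^ q + of_nat q * ?L s" for s
    by (simp add: HK prime_dvd_binomial_power[OF assms(2)] algebra_simps)
  ultimately show ?case by (intro bexI[of _ ?L]) auto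
next
  case (cyclo_mult F G)
  then obtain H K where HK: "H \<in> cyclo N" "K \<in> cyclo N"
    "\<And>s. F (q * s) = F s ^ q + of_nat q * H s" "\<And>s. G (q * s) = G s ^ q + of_nat q * K s"
    by blast
  let ?L = "\<lambda>s. F s ^ q * K s + H s * G s ^ q + of_int (int q) * (H s * K s)"
  have "?L \<in> cyclo N" by (intro cyclo_intros HK cyclo_mult)
  moreover have "F (q * s) * G (q * s) = (F s * G s) ^ q + of_nat q * ?L s" for s
    by (simp add: HK power_mult_distrib algebra_simps)
  ultimately show ?case by (intro bexI[of _ ?L]) auto
qed

section \<open>The ring generated by a root of unity, and its integrality\<close>

definition cyclo_ring :: "nat \<Rightarrow> complex set" where
  "cyclo_ring N = (\<lambda>F. F 1) ` cyclo N"

lemma cyclo_value_in_ring: "F \<in> cyclo N \<Longrightarrow> F s \<in> cyclo_ring N"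
  unfolding cyclo_ring_def
  by (rule image_eqI[OF _ cyclo_shift[of F N s]]) auto

lemma cyclo_ring_closed:
  "of_int c \<in> cyclo_ring N"
  "x \<in> cyclo_ring N \<Longrightarrow> y \<in> cyclo_ring N \<Longrightarrow> x + y \<in> cyclo_ring N"
  "x \<in> cyclo_ring N \<Longrightarrow> y \<in> cyclo_ring N \<Longrightarrow> x * y \<in> cyclo_ring N"
  unfolding cyclo_ring_def by (auto intro: cyclo.intros image_eqI[rotated])

text \<open>The powers of the root of unity need not be a basis, so the coefficients are not unique;
  what matters is that the same ones serve every \<open>s\<close>. In a product the exponents are
  folded modulo \<open>N\<close>.\<close>

lemma cyclo_coords:
  assumes "F \<in> cyclo N" "N > 0"
  shows "\<exists>c :: nat \<Rightarrow> int. \<forall>s. F s = (\<Sum>i<N. of_int (c i) * rt N (i * s))"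
  using assms(1)
proof induction
  case (cyclo_int d)
  have "of_int d = (\<Sum>i<N. of_int (if i = 0 then d else 0) * rt N (i * s))" for s
    using assms(2) by (simp add: if_distrib[of of_int] if_distrib[of "\<lambda>x. x * _"] sum.delta cong: if_cong)
  then show ?case by (intro exI[of _ "\<lambda>i. if i = 0 then d else 0"] allI)
next
  case (cyclo_rt m)
  have "rt N (m * s) = (\<Sum>i<N. of_int (if i = m mod N then 1 else 0) * rt N (i * s))" for s
  proof -
    have "rt N (m mod N * s) = rt N (m * s)"
      using assms(2) by (intro rt_cong cong_scalar_right) auto
    then show ?thesis
      using assms(2) by (simp add: if_distrib[of of_int] if_distrib[of "\<lambda>x. x * _"] sum.delta cong: if_cong)
  qed
  then show ?case by (intro exI[of _ "\<lambda>i. if i = m mod N then 1 else 0"] allI)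
next
  case (cyclo_add F G)
  then obtain c d :: "nat \<Rightarrow> int" where "\<And>s. F s = (\<Sum>i<N. of_int (c i) * rt N (i * s))"
    "\<And>s. G s = (\<Sum>i<N. of_int (d i) * rt N (i * s))"
    by blast
  then show ?case
    by (intro exI[of _ "\<lambda>i. c i + d i"]) (simp add: sum.distrib distrib_right)
next
  case (cyclo_mult F G)
  then obtain c d :: "nat \<Rightarrow> int" where cd: "\<And>s. F s = (\<Sum>i<N. of_int (c i) * rt N (i * s))"
    "\<And>s. G s = (\<Sum>i<N. of_int (d i) * rt N (i * s))"
    by blast
  let ?S = "{..<N} \<times> {..<N}" and ?f = "\<lambda>(i,j). (i + j) mod N"
  have "F s * G s = (\<Sum>l<N. of_int (\<Sum>x\<in>{x\<in>?S. ?f x = l}. c (fst x) * d (snd x)) * rt N (l * s))" for s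
  proof -
    let ?g = "\<lambda>(i,j). of_int (c i * d j) * rt N ((i + j) * s)"
    have "F s * G s = (\<Sum>x\<in>?S. ?g x)"
      unfolding cd sum_product sum.cartesian_product
      by (intro sum.cong) (auto simp: rt_add distrib_right)
    also have "\<dots> = (\<Sum>l<N. \<Sum>x\<in>{x\<in>?S. ?f x = l}. ?g x)"
      using assms(2) by (intro sum.group[symmetric]) auto
    also have "\<dots> = (\<Sum>l<N. of_int (\<Sum>x\<in>{x\<in>?S. ?f x = l}. c (fst x) * d (snd x)) * rt N (l * s))"
      unfolding of_int_sum sum_distrib_right
    proof (intro sum.cong refl)
      fix l x assume "x \<in> {x\<in>?S. ?f x = l}"
      then have l: "l = (fst x + snd x) mod N" by (auto simp: case_prod_beta)
      have "rt N (l * s) = rt N ((fst x + snd x) * s)"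
        unfolding l using assms(2) by (intro rt_cong cong_scalar_right) auto
      then show "?g x = of_int (c (fst x) * d (snd x)) * rt N (l * s)"
        by (simp add: case_prod_beta)
    qed
    finally show ?thesis .
  qed
  then show ?case by (intro exI[of _ "\<lambda>l. \<Sum>x\<in>{x\<in>?S. ?f x = l}. c (fst x) * d (snd x)"] allI)
qed

lemma cyclo_ring_coords:
  assumes "x \<in> cyclo_ring N" "N > 0"
  shows "\<exists>c :: nat \<Rightarrow> int. x = (\<Sum>i<N. of_int (c i) * rt N i)"
proof -
  obtain F where "F \<in> cyclo N" "x = F 1" using assms(1) by (auto simp: cyclo_ring_def)
  moreover obtain c :: "nat \<Rightarrow> int" where "\<And>s. F s = (\<Sum>i<N. of_int (c i) * rt N (i * s))"
    using cyclo_coords[OF \<open>F \<in> cyclo N\<close> assms(2)] by blast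
  ultimately show ?thesis by (intro exI[of _ c]) simp
qed

text \<open>Orthogonality over all residues, units or not, leaves \<open>N\<close> times the
  coefficient of index 0. This plays the role of a trace in \<open>Y_h_nonzero\<close>.\<close>

lemma cyclo_sum_residues:
  assumes "F \<in> cyclo N" "N > 0"
  shows "(\<Sum>s<N. F s) \<in> \<int>"
proof -
  obtain c :: "nat \<Rightarrow> int" where c: "\<And>s. F s = (\<Sum>i<N. of_int (c i) * rt N (i * s))"
    using cyclo_coords[OF assms] by blast
  have "(\<Sum>s<N. F s) = (\<Sum>i<N. of_int (c i) * (\<Sum>s<N. rt N (s * i)))"
    unfolding c sum_distrib_left by (subst sum.swap) (simp only: mult.commute)
  also have "\<dots> \<in> \<int>" unfolding sum_rt[OF assms(2)] by (intro Ints_sum Ints_mult) auto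
  finally show ?thesis .
qed

text \<open>
  Multiplication by \<open>x\<close> acts on \<open>1, \<zeta>, \<dots>, \<zeta>\<^sup>N\<^sup>-\<^sup>1\<close> through an integer matrix, and \<open>x\<close> is
  a root of its characteristic polynomial.
\<close>

lemma cyclo_ring_monic:
  assumes "x \<in> cyclo_ring N" "N > 0"
  shows "\<exists>P :: int poly. monic P \<and> poly (map_poly of_int P) x = 0"
proof -
  have "\<exists>c :: nat \<Rightarrow> int. x * rt N j = (\<Sum>i<N. of_int (c i) * rt N i)" for j
  proof -
    have "rt N j \<in> cyclo_ring N" using cyclo_value_in_ring[OF cyclo_rt[of N j], of 1] by simp
    then show ?thesis using assms by (intro cyclo_ring_coords cyclo_ring_closed)
  qed
  then obtain c :: "nat \<Rightarrow> nat \<Rightarrow> int" where c: "x * rt N j = (\<Sum>i<N. of_int (c j i) * rt N i)" for j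
    by metis
  define A where "A = mat N N (\<lambda>(j, i). c j i)"
  have A: "A \<in> carrier_mat N N" by (simp add: A_def)
  let ?B = "map_mat of_int A :: complex mat"
  define v where "v = vec N (rt N)"
  have "v $ 0 = 1" using assms(2) by (simp add: v_def)
  then have "v \<noteq> 0\<^sub>v N" using assms(2) by auto
  moreover have "?B *\<^sub>v v = x \<cdot>\<^sub>v v"
    by (rule eq_vecI)
       (auto simp: A_def v_def c scalar_prod_def atLeast0LessThan)
  ultimately have "eigenvalue ?B x"
    unfolding eigenvalue_def eigenvector_def using A by (intro exI[of _ v]) (auto simp: v_def)
  then have "poly (char_poly ?B) x = 0"
    using eigenvalue_root_char_poly[of ?B N x] A by auto
  then have "poly (map_poly of_int (char_poly A)) x = 0"
    by (simp add: of_int_hom.char_poly_hom[OF A])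
  then show ?thesis using degree_monic_char_poly[OF A] by blast
qed

lemma cyclo_ring_rational:
  assumes "x \<in> cyclo_ring N" "N > 0" "x \<in> \<rat>"
  shows "x \<in> \<int>"
proof -
  have "algebraic_int x"
    using cyclo_ring_monic[OF assms(1,2)] unfolding algebraic_int_altdef_ipoly by auto
  then show ?thesis using assms(3) rational_algebraic_int_is_int by blast
qed

text \<open>An integer polynomial of least degree with root \<open>x\<close> has nonzero constant
  term \<open>c\<close>, and \<open>c = - x * w\<close> with \<open>w\<close> in the ring. A factor
  \<open>q\<close> of \<open>x\<close> then divides \<open>c\<close> in the ring, hence among the
  integers, because rational elements of the ring are integers.\<close>

lemma cyclo_ring_finite_prime_divisors:
  assumes "x \<in> cyclo_ring N" "N > 0" "x \<noteq> 0"
  shows "\<exists>M. \<forall>q>M. \<forall>y\<in>cyclo_ring N. x \<noteq> of_nat q * y"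
proof -
  define S where "S = {P :: int poly. P \<noteq> 0 \<and> poly (map_poly of_int P) x = 0}"
  have "\<exists>P. P \<in> S"
  proof -
    obtain P :: "int poly" where "monic P" "poly (map_poly of_int P) x = 0"
      using cyclo_ring_monic[OF assms(1,2)] by blast
    moreover from this have "P \<noteq> 0" by auto
    ultimately show ?thesis by (auto simp: S_def)
  qed
  then obtain P where P: "P \<in> S" and min: "\<And>Q. Q \<in> S \<Longrightarrow> degree P \<le> degree Q"
    using ex_has_least_nat[of "\<lambda>P. P \<in> S" _ degree] by blast
  obtain c Q where cQ: "P = pCons c Q" by (cases P)
  have ev: "of_int c + x * poly (map_poly of_int Q) x = 0"
    using P unfolding S_def cQ by (auto simp: of_int_hom.map_poly_pCons_hom)
  have "c \<noteq> 0"
  proof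
    assume "c = 0"
    with P cQ ev assms(3) have "Q \<in> S" by (auto simp: S_def)
    from min[OF this] show False using cQ P by (auto simp: S_def split: if_splits)
  qed
  define w where "w = poly (map_poly of_int Q) x"
  have "w \<in> cyclo_ring N"
    unfolding w_def
  proof (induction Q)
    case 0
    then show ?case using cyclo_ring_closed(1)[of 0] by simp
  next
    case (pCons a Q)
    show ?case unfolding of_int_hom.map_poly_pCons_hom poly_pCons
      by (rule cyclo_ring_closed(2)[OF cyclo_ring_closed(1) cyclo_ring_closed(3)[OF assms(1) pCons(2)]])
  qed
  have ev': "of_int c + x * w = 0" using ev by (simp add: w_def)
  have "x \<noteq> of_nat q * y" if "q > nat \<bar>c\<bar>" "y \<in> cyclo_ring N" for q y
  proof
    assume eq: "x = of_nat q * y"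
    let ?u = "of_int (-1) * (y * w)"
    have u: "?u \<in> cyclo_ring N" using that(2) \<open>w \<in> _\<close> by (intro cyclo_ring_closed)
    have "of_int c = of_nat q * ?u" using ev' unfolding eq
      by (simp add: eq_neg_iff_add_eq_0 mult.assoc)
    moreover have "(of_nat q :: complex) \<noteq> 0" using that by simp
    ultimately have u': "?u = of_int c / of_nat q" by (metis nonzero_mult_div_cancel_left)
    then have "?u \<in> \<rat>" by (simp add: Rats_divide)
    then have "?u \<in> \<int>" using cyclo_ring_rational[OF u assms(2)] by blast
    then obtain d where "?u = of_int d" by (rule Ints_cases)
    with \<open>of_int c = of_nat q * ?u\<close> have "of_int c = (of_int (int q * d) :: complex)"
      by (simp only: of_int_mult of_int_of_nat_eq)
    then have "c = int q * d" by (simp only: of_int_eq_iff)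
    then have "int q \<le> \<bar>c\<bar>" using \<open>c \<noteq> 0\<close> dvd_imp_le_int[of c "int q"] by auto
    then show False using that by linarith
  qed
  then show ?thesis by blast
qed

text \<open>Each prime up to \<open>M\<close> divides exactly one summand of
  \<open>t = s + N * R\<close>: \<open>R\<close> collects the primes not dividing \<open>s\<close>,
  and those dividing \<open>s\<close> divide neither \<open>N\<close> nor \<open>R\<close>. A
  product of large primes thus replaces a single prime in the residue class, and Dirichlet's theorem
  is avoided.\<close>

lemma coprime_large_prime_factors:
  fixes s N M :: nat
  assumes "coprime s N" "N > 0"
  shows "\<exists>t. [t = s] (mod N) \<and> t > 0 \<and> (\<forall>q. prime q \<and> q dvd t \<longrightarrow> q > M)"
proof -
  define Q where "Q = {q. prime q \<and> q \<le> M \<and> \<not> q dvd s}"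
  have fin: "finite Q" by (rule finite_subset[of _ "{..M}"]) (auto simp: Q_def)
  define R where "R = \<Prod>Q"
  have Rpos: "R > 0" unfolding R_def by (intro prod_pos) (auto simp: Q_def prime_gt_0_nat)
  define t where "t = s + N * R"
  have "q > M" if q: "prime q" "q dvd t" for q
  proof (rule ccontr)
    assume "\<not> q > M"
    show False
    proof (cases "q dvd s")
      case True
      then have "q dvd N * R" using that by (simp add: t_def dvd_add_right_iff)
      moreover have "\<not> q dvd N" using coprime_common_divisor_nat[OF assms(1) True] that(1) by auto
      ultimately have "q dvd R" using that(1) prime_dvd_mult_iff by blast
      then obtain r where "r \<in> Q" "q dvd r"
        unfolding R_def using prime_dvd_prod_iff[OF fin q(1), of "\<lambda>x. x"] by auto
      then have "q = r" using q(1) primes_dvd_imp_eq[of q r] by (auto simp: Q_def)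
      with True \<open>r \<in> Q\<close> show False by (auto simp: Q_def)
    next
      case False
      then have "q \<in> Q" using that \<open>\<not> q > M\<close> by (auto simp: Q_def)
      then have "q dvd R" unfolding R_def using fin by (intro dvd_prodI) auto
      then show False using that False by (simp add: t_def dvd_add_left_iff)
    qed
  qed
  moreover have "t > 0" using Rpos assms(2) by (simp add: t_def)
  moreover have "[t = s] (mod N)" by (simp add: t_def cong_def)
  ultimately show ?thesis by blast
qed

text \<open>
  The irreducibility of the cyclotomic polynomial in Landau's manner: \<open>F j = 0\<close> forces
  \<open>q dvd F (j * q)\<close> by Frobenius, and a nonzero value has only finitely many prime divisors.
\<close>

theorem cyclo_conjugate_zero:
  assumes F: "F \<in> cyclo N" and N: "N > 0" and F1: "F 1 = 0" and s: "coprime s N"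
  shows "F s = 0"
proof -
  have "\<exists>M. \<forall>q>M. \<forall>y\<in>cyclo_ring N. F r \<noteq> 0 \<longrightarrow> F r \<noteq> of_nat q * y" for r
    using cyclo_ring_finite_prime_divisors[OF cyclo_value_in_ring[OF F] N, of r] by (cases "F r = 0") auto
  then have "\<exists>M. \<forall>r. \<forall>q>M r. \<forall>y\<in>cyclo_ring N. F r \<noteq> 0 \<longrightarrow> F r \<noteq> of_nat q * y"
    by (intro choice) blast
  then obtain M where M: "\<And>r q y. q > M r \<Longrightarrow> y \<in> cyclo_ring N \<Longrightarrow> F r \<noteq> 0 \<Longrightarrow> F r \<noteq> of_nat q * y"
    by blast
  \<comment> \<open>\<open>F\<close> depends only on the residue of its argument, so one bound
    serves all arguments.\<close>
  define M0 where "M0 = Max (M ` {..<N})"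
  have step: "F (j * q) = 0" if q: "prime q" "q > M0" "F j = 0" for j q
  proof (rule ccontr)
    assume nz: "F (j * q) \<noteq> 0"
    let ?r = "(j * q) mod N"
    have eq: "F ?r = F (j * q)" by (rule cyclo_cong[OF F N]) (simp add: cong_def)
    obtain H where H: "H \<in> cyclo N" "F (q * j) = F j ^ q + of_nat q * H j"
      using cyclo_frobenius[OF F q(1)] by blast
    have "M ?r \<le> M0" unfolding M0_def using N by (intro Max_ge) auto
    then have "F ?r \<noteq> of_nat q * H j" using q nz eq by (intro M cyclo_value_in_ring H) auto
    moreover have "F ?r = of_nat q * H j"
      using H(2) q prime_gt_0_nat[OF q(1)] eq by (simp add: mult.commute)
    ultimately show False by blast
  qed
  obtain t where t: "[t = s] (mod N)" "t > 0" "\<And>q. prime q \<Longrightarrow> q dvd t \<Longrightarrow> q > M0"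
    using coprime_large_prime_factors[OF s N, of M0] by blast
  \<comment> \<open>\<open>t\<close> is reached from 1 through its prime factors, one at a time,
    each above \<open>M0\<close>.\<close>
  have "F j = 0 \<Longrightarrow> F (j * t) = 0" for j
    using t(2,3)
  proof (induction t arbitrary: j rule: prime_divisors_induct)
    case (factor q t)
    have "F (j * q) = 0" using factor by (intro step) auto
    then have "F (j * q * t) = 0" using factor by (intro factor.IH) auto
    then show ?case by (simp add: mult.assoc)
  qed auto
  from this[of 1] F1 have "F t = 0" by simp
  then show ?thesis using cyclo_cong[OF F N t(1)] by simp
qed

section \<open>The value at 1 as a finite sum\<close>

text \<open>On the radius towards \<open>z\<close> the partial sum plus
  \<open>Ln (1 - z * t)\<close> has derivative of norm at most \<open>t ^ N / c\<close>, since
  \<open>1 - z * t\<close> stays away from 0. Integration up to 1 bounds the error by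
  \<open>1 / (c * (N + 1))\<close>: convergence on the boundary, with a rate and without Abel's
  theorem.\<close>

lemma log_series_boundary:
  fixes z :: complex
  assumes "norm z = 1" "z \<noteq> 1"
  shows "(\<lambda>n. z ^ Suc n / of_nat (Suc n)) sums (- Ln (1 - z))"
proof -
  have Re1: "Re z < 1"
  proof -
    have "Re z \<le> 1" using complex_Re_le_cmod[of z] assms(1) by simp
    moreover have "Re z \<noteq> 1"
    proof
      assume "Re z = 1"
      with assms(1) have "Im z = 0" by (simp add: cmod_def)
      with \<open>Re z = 1\<close> assms(2) show False by (simp add: complex_eq_iff)
    qed
    ultimately show ?thesis by simp
  qed
  \<comment> \<open>\<open>Re (1 - z * t)\<close> is affine in \<open>t\<close>, hence at least the
    smaller of its end values 1 and \<open>1 - Re z\<close>.\<close>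
  define c where "c = min 1 (1 - Re z)"
  have c0: "c > 0" using Re1 by (simp add: c_def)
  have Re_ge: "Re (1 - z * of_real t) \<ge> c" if "0 \<le> t" "t \<le> 1" for t
  proof (cases "Re z \<ge> 0")
    case True
    then have "Re z * t \<le> Re z" using that mult_left_le[of t "Re z"] by simp
    then show ?thesis by (simp add: c_def)
  next
    case False
    then have "Re z * t \<le> 0" using that by (simp add: mult_nonpos_nonneg)
    then show ?thesis by (simp add: c_def)
  qed
  define f where "f = (\<lambda>N (t::real). (\<Sum>n<N. (z * of_real t) ^ Suc n / of_nat (Suc n)) + Ln (1 - z * of_real t))"
  have deriv: "(f N has_vector_derivative (- z * (z * of_real t) ^ N / (1 - z * of_real t))) (at t within S)"
    if "0 \<le> t" "t \<le> 1" for N t S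
  proof -
    define w where "w = z * of_real t"
    have w: "Re (1 - w) > 0" using Re_ge[OF that] c0 by (simp add: w_def)
    then have w1: "w \<noteq> 1" by auto
    have nr: "1 - w \<notin> \<real>\<^sub>\<le>\<^sub>0" using w by (auto simp: complex_nonpos_Reals_iff)
    have "((\<lambda>u. (\<Sum>n<N. (z * u) ^ Suc n / of_nat (Suc n)) + Ln (1 - z * u)) has_field_derivative
       (\<Sum>n<N. z * w ^ n) + - z / (1 - w)) (at (of_real t))"
    proof (intro derivative_intros DERIV_sum DERIV_add)
      fix n
      show "((\<lambda>u. (z * u) ^ Suc n / of_nat (Suc n)) has_field_derivative z * w ^ n) (at (of_real t))"
      proof -
        have "((\<lambda>u. (z * u) ^ Suc n) has_field_derivative of_nat (Suc n) * (z * w ^ n)) (at (of_real t))"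
          by (auto intro!: derivative_eq_intros simp: w_def simp del: of_nat_Suc power_Suc)
        then have "((\<lambda>u. (z * u) ^ Suc n / of_nat (Suc n)) has_field_derivative
            of_nat (Suc n) * (z * w ^ n) / of_nat (Suc n)) (at (of_real t))"
          by (rule DERIV_cdivide)
        then show ?thesis by (simp del: of_nat_Suc power_Suc)
      qed
      show "((\<lambda>u. Ln (1 - z * u)) has_field_derivative - z / (1 - w)) (at (of_real t))"
        using nr by (auto intro!: derivative_eq_intros simp: w_def divide_inverse mult.commute)
    qed
    moreover have "(\<Sum>n<N. z * w ^ n) + - z / (1 - w) = - z * w ^ N / (1 - w)"
    proof -
      have "(\<Sum>n<N. w ^ n) = (w ^ N - 1) / (w - 1)" using w1 by (rule geometric_sum)
      also have "\<dots> = (1 - w ^ N) / (1 - w)" by (metis minus_diff_eq minus_divide_divide)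
      finally have "(\<Sum>n<N. w ^ n) = (1 - w ^ N) / (1 - w)" .
      then have "(\<Sum>n<N. z * w ^ n) = z * ((1 - w ^ N) / (1 - w))"
        by (simp add: sum_distrib_left[symmetric])
      then show ?thesis using w1 by (simp add: divide_simps) (simp add: algebra_simps)
    qed
    ultimately have "((\<lambda>u. (\<Sum>n<N. (z * u) ^ Suc n / of_nat (Suc n)) + Ln (1 - z * u)) has_field_derivative
       (- z * w ^ N / (1 - w))) (at (of_real t))" by simp
    from has_vector_derivative_real_field[OF this]
    show ?thesis unfolding f_def w_def by (rule has_vector_derivative_at_within)
  qed
  have bound: "norm ((\<Sum>n<N. z ^ Suc n / of_nat (Suc n)) - (- Ln (1 - z))) \<le> inverse c * inverse (real (Suc N))" for N
  proof -
    define \<phi> where "\<phi> = (\<lambda>t::real. t ^ Suc N / (c * real (Suc N)))"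
    have "norm (f N 1 - f N 0) \<le> \<phi> 1 - \<phi> 0"
    proof (rule differentiable_bound_general)
      show "continuous_on {0..1} (f N)"
        using deriv by (intro continuous_on_vector_derivative) auto
      show "continuous_on {0..1} \<phi>" unfolding \<phi>_def using c0 by (intro continuous_intros) auto
      fix t :: real assume t: "0 < t" "t < 1"
      show "(f N has_vector_derivative (- z * (z * of_real t) ^ N / (1 - z * of_real t))) (at t)"
        using t by (intro deriv) auto
      have "(\<phi> has_field_derivative t ^ N / c) (at t)"
        unfolding \<phi>_def
        using DERIV_cdivide[OF DERIV_pow[of "Suc N" t UNIV], of "c * real (Suc N)"] c0
        by (simp del: of_nat_Suc power_Suc)
      then show "(\<phi> has_vector_derivative t ^ N / c) (at t)"
        by (simp add: has_real_derivative_iff_has_vector_derivative)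
      have "c \<le> norm (1 - z * of_real t)"
        using Re_ge[of t] t complex_Re_le_cmod[of "1 - z * of_real t"] by linarith
      then show "norm (- z * (z * of_real t) ^ N / (1 - z * of_real t)) \<le> t ^ N / c"
        using t c0 by (auto simp: norm_mult norm_power norm_divide assms(1) intro!: divide_left_mono mult_pos_pos)
    qed simp
    then show ?thesis by (simp add: f_def \<phi>_def divide_inverse)
  qed
  have "(\<lambda>N. inverse c * inverse (real (Suc N))) \<longlonglongrightarrow> 0"
    using tendsto_mult_left[OF LIMSEQ_inverse_real_of_nat, of "inverse c"] by simp
  then have "(\<lambda>N. (\<Sum>n<N. z ^ Suc n / of_nat (Suc n)) - (- Ln (1 - z))) \<longlonglongrightarrow> 0"
    by (rule Lim_null_comparison[rotated]) (use bound in auto)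
  then show ?thesis unfolding sums_def by (simp only: LIM_zero_iff)
qed

text \<open>\<open>1 - cis \<theta>\<close> is the positive number
  \<open>2 * sin (\<theta> / 2)\<close> times \<open>cis ((\<theta> - pi) / 2)\<close>, and this
  angle lies in the range of the principal branch.\<close>

lemma Ln_one_minus_cis:
  assumes "0 < \<theta>" "\<theta> < 2 * pi"
  shows "Ln (1 - cis \<theta>) = of_real (ln (norm (1 - cis \<theta>))) + \<i> * of_real ((\<theta> - pi) / 2)"
proof -
  have sn: "sin (\<theta> / 2) > 0" using assms by (intro sin_gt_zero) auto
  have cos1: "cos \<theta> = 1 - 2 * (sin (\<theta> / 2))\<^sup>2" and sin1: "sin \<theta> = 2 * sin (\<theta> / 2) * cos (\<theta> / 2)"
    using cos_double_sin[of "\<theta> / 2"] sin_double[of "\<theta> / 2"] by simp_all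
  have eq: "1 - cis \<theta> = of_real (2 * sin (\<theta> / 2)) * cis ((\<theta> - pi) / 2)"
  proof -
    have a: "(\<theta> - pi) / 2 = \<theta> / 2 - pi / 2" by (simp add: diff_divide_distrib)
    have "cos ((\<theta> - pi) / 2) = sin (\<theta> / 2)" "sin ((\<theta> - pi) / 2) = - cos (\<theta> / 2)"
      unfolding a by (simp_all add: cos_diff sin_diff)
    then show ?thesis by (simp add: complex_eq_iff cos1 sin1 power2_eq_square)
  qed
  have nrm: "norm (1 - cis \<theta>) = 2 * sin (\<theta> / 2)"
    unfolding eq using sn by (simp add: norm_mult)
  show ?thesis unfolding nrm
  proof (rule Ln_unique)
    show "exp (of_real (ln (2 * sin (\<theta> / 2))) + \<i> * of_real ((\<theta> - pi) / 2)) = 1 - cis \<theta>"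
      unfolding eq using sn by (simp add: exp_add exp_of_real cis_conv_exp)
  qed (use assms in auto)
qed

text \<open>Exponents of \<open>rt\<close> are natural numbers, so the factor \<open>m - 1\<close>
  stands for -1: the inner sum is the discrete Fourier transform of the character.\<close>

lemma character_fourier_inversion:
  assumes \<psi>: "\<psi> \<in> dirichlet_characters m" and m: "m > 1"
  shows "\<psi> (int n) = (\<Sum>a<m. (\<Sum>b<m. \<psi> (int b) * rt m ((m - 1) * b * a)) * rt m (n * a)) / of_nat m"
proof -
  have "(\<Sum>a<m. (\<Sum>b<m. \<psi> (int b) * rt m ((m - 1) * b * a)) * rt m (n * a)) = (\<Sum>a<m. \<Sum>b<m. \<psi> (int b) * rt m (a * ((m - 1) * b + n)))"
    unfolding sum_distrib_right
    by (intro sum.cong refl) (simp only: distrib_left rt_add mult_ac)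
  also have "\<dots> = (\<Sum>b<m. \<psi> (int b) * (\<Sum>a<m. rt m (a * ((m - 1) * b + n))))"
    unfolding sum_distrib_left by (rule sum.swap)
  also have "\<dots> = (\<Sum>b<m. \<psi> (int b) * (if b = n mod m then of_nat m else 0))"
  proof (rule sum.cong[OF refl])
    fix b assume b: "b \<in> {..<m}"
    have "m dvd ((m - 1) * b + n) \<longleftrightarrow> [(m - 1) * b + n + b = 0 + b] (mod m)"
      by (simp only: cong_add_rcancel_nat cong_0_iff)
    also have "(m - 1) * b + n + b = m * b + n"
      using m by (cases m) auto
    also have "[m * b + n = 0 + b] (mod m) \<longleftrightarrow> b = n mod m"
      using b by (auto simp: cong_def)
    finally show "\<psi> (int b) * (\<Sum>a<m. rt m (a * ((m - 1) * b + n))) =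
        \<psi> (int b) * (if b = n mod m then of_nat m else 0)"
      using m by (simp add: sum_rt)
  qed
  also have "\<dots> = \<psi> (int (n mod m)) * of_nat m"
    using m by (simp add: if_distrib[of "\<lambda>x. _ * x"] sum.delta cong: if_cong)
  also have "\<psi> (int (n mod m)) = \<psi> (int n)"
    using dirichlet_character_mod[OF \<psi>, of "int n"] by (simp add: zmod_int)
  finally show ?thesis using m by simp
qed

text \<open>Fourier inversion turns the series into a combination of logarithmic series at the
  \<open>rt m a\<close>. The divergent one, at \<open>a = 0\<close>, drops out because the character
  sums to 0.\<close>

lemma dirichlet_L_1_finite:
  assumes \<psi>: "\<psi> \<in> dirichlet_characters m" and np: "\<psi> \<noteq> principal_character m" and m: "m > 1"
  shows "dirichlet_L 1 \<psi> =
    - (\<Sum>a\<in>{1..<m}. (\<Sum>b<m. \<psi> (int b) * rt m ((m - 1) * b * a)) * Ln (1 - rt m a)) / of_nat m"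
proof -
  define T where "T = (\<lambda>a. \<Sum>b<m. \<psi> (int b) * rt m ((m - 1) * b * a))"
  have T0: "T 0 = 0"
  proof -
    have "(\<Sum>b<m. \<psi> (int b)) = (\<Sum>a\<in>{0..<int m}. \<psi> a)"
      by (rule sum.reindex_bij_witness[of _ nat int]) auto
    then show ?thesis using sum_nonprincipal_character[OF \<psi> np] m by (simp add: T_def)
  qed
  have inv: "\<psi> (int n) = (\<Sum>a<m. T a * rt m (n * a)) / of_nat m" for n
    unfolding T_def by (rule character_fourier_inversion[OF \<psi> m])
  have "(\<lambda>n. \<Sum>a\<in>{1..<m}. T a / of_nat m * (rt m a ^ Suc n / of_nat (Suc n))) sums
      (\<Sum>a\<in>{1..<m}. T a / of_nat m * - Ln (1 - rt m a))"
  proof (intro sums_sum sums_mult log_series_boundary)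
    fix a assume "a \<in> {1..<m}"
    then have "\<not> m dvd a" by (auto dest: dvd_imp_le)
    then show "rt m a \<noteq> 1" using m by (simp add: rt_eq_1_iff)
  qed simp
  moreover have "(\<Sum>a\<in>{1..<m}. T a / of_nat m * (rt m a ^ Suc n / of_nat (Suc n))) =
      \<psi> (int (Suc n)) / of_nat (Suc n)" for n
  proof -
    have "{..<m} = insert 0 {1..<m}" using m by auto
    then have "\<psi> (int (Suc n)) = (\<Sum>a\<in>{1..<m}. T a * rt m (Suc n * a)) / of_nat m"
      unfolding inv[of "Suc n"] by (simp add: T0)
    then show ?thesis
      by (simp add: rt_power sum_divide_distrib mult.commute[of _ "Suc n"] del: power_Suc mult_Suc mult_Suc_right of_nat_Suc)
  qed
  ultimately have "(\<lambda>n. \<psi> (int (Suc n)) / of_nat (Suc n)) sums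
      (\<Sum>a\<in>{1..<m}. T a / of_nat m * - Ln (1 - rt m a))" by simp
  then have "dirichlet_L 1 \<psi> = (\<Sum>a\<in>{1..<m}. T a / of_nat m * - Ln (1 - rt m a))"
    using dirichlet_L_1_sums[OF \<psi> np] m sums_unique2 by force
  also have "\<dots> = - (\<Sum>a\<in>{1..<m}. T a * Ln (1 - rt m a)) / of_nat m"
    by (simp add: sum_divide_distrib sum_negf)
  finally show ?thesis by (simp add: T_def)
qed

section \<open>Characters modulo an odd prime\<close>

locale odd_prime_primroot =
  fixes p g :: nat
  assumes prime_p: "prime p" and odd_p: "odd p" and primroot: "residue_primroot p g"
begin

definition h :: nat where "h = (p - 1) div 2"

lemma p_gt_2: "p > 2"
  using prime_p odd_p prime_gt_1_nat[of p] by (cases "p = 2") auto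

lemma p_minus_1: "p - 1 = 2 * h"
  using odd_p p_gt_2 by (auto simp: h_def)

lemma h_pos: "h > 0"
  using p_minus_1 p_gt_2 by (cases h) auto

lemma p_eq: "p = 2 * h + 1"
  using p_minus_1 p_gt_2 by simp

lemma totient_p: "totient p = 2 * h"
  using totient_prime[OF prime_p] by (simp only: p_minus_1)

lemma ord_g: "ord p g = 2 * h" and coprime_g: "coprime p g"
  using primroot by (simp_all add: residue_primroot_def totient_p)

lemma g_power_cong_iff: "[g ^ i = g ^ j] (mod p) \<longleftrightarrow> [i = j] (mod 2 * h)"
  using order_divides_expdiff[OF coprime_g, of i j] by (simp add: ord_g)

lemma g_power_not_dvd: "\<not> p dvd g ^ i"
proof
  assume "p dvd g ^ i"
  then have "p dvd g" using prime_p prime_dvd_power by blast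
  then have "is_unit p" using coprime_common_divisor_nat[OF coprime_g, of p] by simp
  then show False using p_gt_2 by simp
qed

definition gp :: "nat \<Rightarrow> nat" where "gp i = g ^ i mod p"

lemma gp_less: "gp i < p"
  using p_gt_2 by (simp add: gp_def)

lemma gp_pos: "gp i > 0"
  using g_power_not_dvd[of i] by (auto simp: gp_def dvd_eq_mod_eq_0)

lemma gp_bij: "bij_betw gp {..<2 * h} {1..<p}"
proof -
  have "totatives p = {1..<p}"
    using p_gt_2 prime_p by (auto simp: totatives_prime)
  then show ?thesis
    using residue_primroot_is_generator[OF _ primroot] p_gt_2
    by (simp add: totient_p gp_def[abs_def])
qed

lemma rt_gp: "rt p (gp i * a) = rt p (g ^ i * a)"
  using p_gt_2 by (intro rt_cong cong_scalar_right) (auto simp: gp_def)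

lemma g_power_h: "[g ^ h = p - 1] (mod p)"
proof -
  have int1: "int (p - 1) = int p - 1" using p_gt_2 by simp
  have "[g ^ (h + h) = g ^ 0] (mod p)"
    unfolding g_power_cong_iff by (simp add: cong_0_iff flip: mult_2)
  then have "[int (g ^ h) * int (g ^ h) = 1] (mod int p)"
    by (simp add: power_add flip: cong_int_iff)
  then have "int p dvd (int (g ^ h) - 1) * (int (g ^ h) + 1)"
    by (simp add: cong_iff_dvd_diff algebra_simps)
  then have "int p dvd int (g ^ h) - 1 \<or> int p dvd int (g ^ h) + 1"
    using prime_p by (simp add: prime_dvd_mult_iff)
  moreover have "\<not> int p dvd int (g ^ h) - 1"
  proof
    assume "int p dvd int (g ^ h) - 1"
    then have "[int (g ^ h) = int (g ^ 0)] (mod int p)" by (simp add: cong_iff_dvd_diff)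
    then have "[h = 0] (mod 2 * h)" by (simp only: cong_int_iff g_power_cong_iff)
    then have "2 * h dvd h" by (simp add: cong_0_iff)
    then show False using h_pos by (auto dest: dvd_imp_le)
  qed
  ultimately have "int p dvd int (g ^ h) + 1" by simp
  then have "int p dvd (int (g ^ h) + 1) - int p" by simp
  then have "[int (g ^ h) = int (p - 1)] (mod int p)"
    unfolding cong_iff_dvd_diff int1 by (simp only: diff_diff_eq2)
  then show ?thesis by (simp only: cong_int_iff)
qed

text \<open>\<open>g ^ h\<close> is -1 modulo \<open>p\<close>, and two residues strictly between 0
  and \<open>p\<close> whose sum is a multiple of \<open>p\<close> add up to \<open>p\<close>. The
  shift by \<open>h\<close> is what tells even from odd characters below.\<close>

lemma gp_add_h: "gp (i + h) = p - gp i"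
proof -
  have "[g ^ (i + h) + g ^ i = g ^ i * (p - 1) + g ^ i] (mod p)"
    unfolding power_add by (intro cong_add cong_scalar_left g_power_h) simp
  also have "g ^ i * (p - 1) + g ^ i = g ^ i * p" using p_gt_2
    by (simp add: diff_mult_distrib2)
  finally have "p dvd g ^ (i + h) + g ^ i" by (simp add: cong_dvd_iff)
  then have "p dvd gp (i + h) + gp i"
    by (simp add: gp_def dvd_eq_mod_eq_0 mod_add_eq)
  then obtain c where c: "gp (i + h) + gp i = p * c" by blast
  moreover have "p * c < p * 2" "p * c > 0"
    using gp_less[of i] gp_less[of "i + h"] gp_pos[of i] unfolding c[symmetric] by linarith+
  ultimately have "gp (i + h) + gp i = p" by simp
  then show ?thesis by simp
qed

lemma gp_periodic: "gp (i + 2 * h) = gp i"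
  using gp_add_h[of i] gp_add_h[of "i + h"] gp_less[of i] by (simp add: mult_2 add.assoc)

lemma exists_dlog:
  fixes a :: int
  assumes "\<not> int p dvd a"
  shows "\<exists>i. [a = int g ^ i] (mod int p)"
proof -
  have "a mod int p > 0" "a mod int p < int p"
    using assms p_gt_2 pos_mod_sign[of "int p" a] pos_mod_bound[of "int p" a]
    by (simp_all add: dvd_eq_mod_eq_0 less_le)
  then have "nat (a mod int p) \<in> {1..<p}" by auto
  then have "nat (a mod int p) \<in> gp ` {..<2 * h}"
    by (simp only: bij_betw_imp_surj_on[OF gp_bij])
  then obtain i where "nat (a mod int p) = gp i"
    by blast
  then have "a mod int p = int (gp i)" using \<open>a mod int p > 0\<close> by linarith
  then have "a mod int p = int g ^ i mod int p" by (simp only: gp_def zmod_int of_nat_power)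
  then show ?thesis unfolding cong_def by blast
qed

text \<open>The character of exponent \<open>j\<close>: it takes the primitive root to \<open>exp (2\<pi>\<i>j / (p - 1))\<close>.\<close>

definition chi :: "nat \<Rightarrow> int \<Rightarrow> complex" where
  "chi j a = (if int p dvd a then 0 else rt (2 * h) (j * (SOME i. [a = int g ^ i] (mod int p))))"

lemma chi_dvd: "int p dvd a \<Longrightarrow> chi j a = 0"
  by (simp add: chi_def)

lemma chi_eq:
  assumes "[a = int g ^ i] (mod int p)"
  shows "chi j a = rt (2 * h) (j * i)"
proof -
  have nd: "\<not> int p dvd a"
    using g_power_not_dvd[of i] unfolding cong_dvd_iff[OF assms] of_nat_power[symmetric] int_dvd_int_iff .
  define i' where "i' = (SOME i. [a = int g ^ i] (mod int p))"
  have "[a = int g ^ i'] (mod int p)"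
    unfolding i'_def using assms by (rule someI)
  from cong_trans[OF cong_sym[OF this] assms]
  have "[int (g ^ i') = int (g ^ i)] (mod int p)"
    by (simp only: of_nat_power)
  then have "[i' = i] (mod 2 * h)" by (simp only: cong_int_iff g_power_cong_iff)
  then have "rt (2 * h) (j * i') = rt (2 * h) (j * i)"
    using h_pos by (intro rt_cong cong_scalar_left) auto
  then show ?thesis using nd by (simp add: chi_def i'_def)
qed

lemma chi_g_power: "chi j (int g ^ i) = rt (2 * h) (j * i)"
  by (rule chi_eq) simp

lemma chi_gp: "chi j (int (gp i)) = rt (2 * h) (j * i)"
  by (rule chi_eq) (simp only: gp_def zmod_int cong_def of_nat_power mod_mod_trivial)

lemma coprime_p_iff: "coprime a (int p) \<longleftrightarrow> \<not> int p dvd a"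
proof
  assume "coprime a (int p)"
  show "\<not> int p dvd a"
  proof
    assume "int p dvd a"
    then have "is_unit (int p)"
      using coprime_common_divisor[OF \<open>coprime a (int p)\<close>, of "int p"] by simp
    then show False using p_gt_2 by simp
  qed
next
  assume "\<not> int p dvd a"
  then have "coprime (int p) a" using prime_p by (intro prime_imp_coprime) auto
  then show "coprime a (int p)" by (rule coprime_commute[THEN iffD1])
qed

lemma chi_character: "chi j \<in> dirichlet_characters p"
proof -
  have "chi j (a + int p) = chi j a" for a
  proof (cases "int p dvd a")
    case True
    then show ?thesis by (simp add: chi_dvd)
  next
    case False
    then obtain i where i: "[a = int g ^ i] (mod int p)" using exists_dlog by blast
    then have "[a + int p = int g ^ i + 0] (mod int p)"
      by (rule cong_add) (simp add: cong_0_iff)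
    then have "[a + int p = int g ^ i] (mod int p)" by (simp only: add_0_right)
    then show ?thesis using chi_eq[OF i, of j] chi_eq[of "a + int p" i j] by simp
  qed
  moreover have "chi j (a * b) = chi j a * chi j b" for a b
  proof (cases "int p dvd a \<or> int p dvd b")
    case True
    then have "int p dvd a * b" by auto
    then show ?thesis using True by (auto simp: chi_dvd)
  next
    case False
    then obtain i i' where i: "[a = int g ^ i] (mod int p)" "[b = int g ^ i'] (mod int p)"
      using exists_dlog[of a] exists_dlog[of b] by blast
    then have "[a * b = int g ^ (i + i')] (mod int p)" unfolding power_add by (rule cong_mult)
    then show ?thesis
      using chi_eq[OF i(1), of j] chi_eq[OF i(2), of j] chi_eq[of "a * b" "i + i'" j]
      by (simp add: distrib_left rt_add)
  qed
  moreover have "chi j a \<noteq> 0 \<longleftrightarrow> coprime a (int p)" for a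
    unfolding coprime_p_iff by (auto simp: chi_def)
  ultimately show ?thesis by (simp add: dirichlet_characters_def)
qed

lemma chi_eq_iff: "chi i = chi j \<longleftrightarrow> [i = j] (mod 2 * h)"
proof
  assume "chi i = chi j"
  then have eq: "rt (2 * h) i = rt (2 * h) j" using chi_g_power[of i 1] chi_g_power[of j 1] by simp
  have "rt (2 * h) (i + (2 * h - 1) * j) = rt (2 * h) (j + (2 * h - 1) * j)"
    by (simp only: rt_add eq)
  also have "j + (2 * h - 1) * j = 2 * h * j" using h_pos by (cases h) auto
  also have "rt (2 * h) (2 * h * j) = 1" using h_pos by (simp add: rt_eq_1_iff)
  finally have "2 * h dvd i + (2 * h - 1) * j" using h_pos by (simp add: rt_eq_1_iff)
  then have "[i + (2 * h - 1) * j + j = 0 + j] (mod 2 * h)"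
    by (intro cong_add) (auto simp: cong_0_iff)
  also have "i + (2 * h - 1) * j + j = 2 * h * j + i" using h_pos by (cases h) auto
  finally show "[i = j] (mod 2 * h)" by (simp add: cong_def)
next
  assume "[i = j] (mod 2 * h)"
  then have "rt (2 * h) (i * a) = rt (2 * h) (j * a)" for a
    using h_pos by (intro rt_cong cong_scalar_right) auto
  then show "chi i = chi j" by (simp add: chi_def fun_eq_iff)
qed

lemma chi_0: "chi 0 = principal_character p"
  by (auto simp: fun_eq_iff chi_def principal_character_def coprime_p_iff)

text \<open>A character is determined by its value at the primitive root, and this value is a root
  of unity of order dividing \<open>2 * h\<close>.\<close>

lemma dirichlet_characters_eq: "dirichlet_characters p = chi ` {..<2 * h}"
proof (intro equalityI subsetI)
  fix \<psi> assume \<psi>: "\<psi> \<in> dirichlet_characters p"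
  have mult: "\<psi> (a * b) = \<psi> a * \<psi> b" and nz: "\<psi> a \<noteq> 0 \<longleftrightarrow> coprime a (int p)" for a b
    using \<psi> by (auto simp: dirichlet_characters_def)
  have one: "\<psi> 1 = 1" using mult[of 1 1] nz[of 1] by simp
  have pow: "\<psi> (int g ^ i) = \<psi> (int g) ^ i" for i
    by (induction i) (simp_all add: one mult)
  have "[g ^ (2 * h) = g ^ 0] (mod p)" unfolding g_power_cong_iff by (simp add: cong_0_iff)
  then have "[int g ^ (2 * h) = 1] (mod int p)" by (simp flip: cong_int_iff)
  then have "\<psi> (int g ^ (2 * h)) = \<psi> 1"
    unfolding cong_def by (metis dirichlet_character_mod[OF \<psi>])
  then have "\<psi> (int g) ^ (2 * h) = 1" by (simp add: pow one)
  then have "\<psi> (int g) \<in> (\<lambda>k. cis (2 * pi * real k / real (2 * h))) ` {..<2 * h}"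
    using bij_betw_imp_surj_on[OF Complex.bij_betw_roots_unity[of "2 * h"]] h_pos by (simp only:) simp
  then obtain j where j: "j < 2 * h" "\<psi> (int g) = rt (2 * h) j" by (auto simp: rt_def)
  have "\<psi> a = chi j a" for a
  proof (cases "int p dvd a")
    case True
    then have "\<psi> a = 0" using nz[of a] coprime_p_iff by blast
    with True show ?thesis by (simp add: chi_dvd)
  next
    case False
    then obtain i where i: "[a = int g ^ i] (mod int p)" using exists_dlog by blast
    then have "\<psi> a = \<psi> (int g ^ i)"
      unfolding cong_def by (metis dirichlet_character_mod[OF \<psi>])
    then show ?thesis by (simp add: pow j(2) rt_power chi_eq[OF i])
  qed
  then show "\<psi> \<in> chi ` {..<2 * h}" using j(1) by blast
qed (use chi_character in blast)

lemma chi_inj: "inj_on chi {..<2 * h}"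
  by (rule inj_onI) (simp add: chi_eq_iff cong_def)

lemma rt_h: "rt (2 * h) (h * j) = (-1) ^ j"
proof -
  have "rt (2 * h) h = -1" using h_pos by (simp add: rt_def)
  then show ?thesis by (simp flip: rt_power)
qed

lemma odd_chi: "odd_character (chi j) \<longleftrightarrow> odd j"
proof -
  have "[int (p - 1) = int (g ^ h)] (mod int p)"
    using g_power_h by (simp only: cong_int_iff cong_sym)
  moreover have "[-1 = int (p - 1)] (mod int p)"
    using p_gt_2 by (simp add: cong_iff_dvd_diff)
  ultimately have "[-1 = int (g ^ h)] (mod int p)" by (rule cong_trans[rotated])
  then have "[-1 = int g ^ h] (mod int p)" by (simp only: of_nat_power)
  then have "chi j (-1) = (-1) ^ j" using rt_h by (simp add: chi_eq mult.commute)
  then show ?thesis by (cases "even j") (simp_all add: odd_character_def)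
qed

lemma chi_nonprincipal: "0 < j \<Longrightarrow> j < 2 * h \<Longrightarrow> chi j \<noteq> principal_character p"
  unfolding chi_0[symmetric] chi_eq_iff by (simp add: cong_def)

section \<open>Gauss sums and the two shapes of the L-values at 1\<close>

text \<open>\<open>tau j\<close> is the Gauss sum of \<open>chi j\<close> up to the factor \<open>chi j (-1)\<close>.\<close>

definition tau :: "nat \<Rightarrow> complex" where
  "tau j = (\<Sum>i<2 * h. rt (2 * h) (j * i) * rt p ((p - 1) * g ^ i))"

definition lam :: "nat \<Rightarrow> real" where
  "lam i = ln (norm (1 - rt p (g ^ i)))"

text \<open>The inverse of the value of \<open>chi j\<close> at \<open>g ^ i\<close>, with
  \<open>2 * h - 1\<close> in place of -1.\<close>

definition winv :: "nat \<Rightarrow> nat \<Rightarrow> complex" where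
  "winv j i = rt (2 * h) ((2 * h - 1) * j * i)"

lemma winv_mult: "winv j i * rt (2 * h) (j * i) = 1"
proof -
  have "(2 * h - 1) * j * i + j * i = 2 * h * (j * i)"
    using h_pos by (cases h) (auto simp: algebra_simps)
  then show ?thesis using h_pos unfolding winv_def rt_add[symmetric] by (simp add: rt_eq_1_iff)
qed

lemma sum_two_halves:
  fixes f :: "nat \<Rightarrow> 'a :: comm_monoid_add"
  shows "(\<Sum>i<2 * h. f i) = (\<Sum>i<h. f i + f (i + h))"
proof -
  have "{..<2 * h} = {..<h} \<union> {h..<h + h}" by auto
  then have "(\<Sum>i<2 * h. f i) = (\<Sum>i<h. f i) + (\<Sum>i\<in>{h..<h + h}. f i)"
    by (simp add: sum.union_disjoint ivl_disj_int_one)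
  also have "(\<Sum>i\<in>{h..<h + h}. f i) = (\<Sum>i<h. f (i + h))"
    by (rule sum.reindex_bij_witness[of _ "\<lambda>i. i + h" "\<lambda>i. i - h"]) auto
  finally show ?thesis by (simp add: sum.distrib)
qed

lemma sum_shift_periodic:
  fixes f :: "nat \<Rightarrow> 'a :: comm_ring_1"
  assumes "\<And>i. f (i + n) = f i"
  shows "(\<Sum>i<n. f (i + m)) = (\<Sum>i<n. f i)"
proof (induction m)
  case (Suc m)
  have "(\<Sum>i<n. f (i + Suc m)) + f m = (\<Sum>i<Suc n. f (i + m))"
    by (subst sum.lessThan_Suc_shift) simp
  also have "\<dots> = (\<Sum>i<n. f (i + m)) + f m"
    using assms[of m] by (simp add: add.commute)
  finally show ?case using Suc by simp
qed simp

lemma rt_gp_conv: "rt p (g ^ i) = rt p (gp i)"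
  using rt_gp[of i 1] by simp

lemma one_minus_rt_nonzero: "1 - rt p (g ^ i) \<noteq> 0"
  using g_power_not_dvd[of i] p_gt_2 by (simp add: rt_eq_1_iff)

lemma rt_add_h_cnj: "rt p (g ^ (i + h)) = cnj (rt p (g ^ i))"
proof -
  have "rt p (g ^ (i + h)) * rt p (g ^ i) = rt p (gp (i + h) + gp i)"
    by (simp add: rt_add rt_gp_conv)
  also have "gp (i + h) + gp i = p" using gp_add_h[of i] gp_less[of i] by simp
  finally have "rt p (g ^ (i + h)) * rt p (g ^ i) = 1" using p_gt_2 by (simp add: rt_eq_1_iff)
  moreover have "rt p (g ^ i) * cnj (rt p (g ^ i)) = 1"
    using complex_norm_square[of "rt p (g ^ i)"] by simp
  ultimately have "rt p (g ^ i) * (rt p (g ^ (i + h)) - cnj (rt p (g ^ i))) = 0"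
    by (simp only: right_diff_distrib mult.commute) simp
  then show ?thesis by simp
qed

lemma lam_add_h: "lam (i + h) = lam i"
proof -
  have "1 - rt p (g ^ (i + h)) = cnj (1 - rt p (g ^ i))" by (simp add: rt_add_h_cnj)
  then show ?thesis unfolding lam_def by (simp only: complex_mod_cnj)
qed

lemma Ln_lam:
  "Ln (1 - rt p (g ^ i)) = of_real (lam i) + \<i> * of_real pi * (of_nat (gp i) / of_nat p - 1 / 2)"
proof -
  define \<theta> where "\<theta> = 2 * pi * real (gp i) / real p"
  have "0 < \<theta>" "\<theta> < 2 * pi"
    using gp_pos[of i] gp_less[of i] by (auto simp: \<theta>_def field_simps)
  then have "Ln (1 - cis \<theta>) = of_real (ln (norm (1 - cis \<theta>))) + \<i> * of_real ((\<theta> - pi) / 2)"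
    by (rule Ln_one_minus_cis)
  moreover have "cis \<theta> = rt p (g ^ i)" unfolding rt_gp_conv by (simp add: \<theta>_def rt_def)
  moreover have "(\<theta> - pi) / 2 = pi * (real (gp i) / real p - 1 / 2)"
    by (simp add: \<theta>_def algebra_simps diff_divide_distrib)
  ultimately show ?thesis by (simp add: lam_def)
qed

lemma tau_shift:
  "(\<Sum>l<2 * h. rt (2 * h) (j * (l + i)) * rt p ((p - 1) * g ^ (l + i))) = tau j"
    unfolding tau_def
proof (rule sum_shift_periodic)
  fix l
  have "rt (2 * h) (j * (l + 2 * h)) = rt (2 * h) (j * l)"
    using h_pos by (intro rt_cong) (auto simp: cong_def distrib_left mult.left_commute)
  moreover have "rt p ((p - 1) * g ^ (l + 2 * h)) = rt p ((p - 1) * g ^ l)"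
    using p_gt_2 gp_periodic[of l]
    by (intro rt_cong cong_scalar_left) (auto simp: gp_def cong_def)
  ultimately show "rt (2 * h) (j * (l + 2 * h)) * rt p ((p - 1) * g ^ (l + 2 * h)) =
    rt (2 * h) (j * l) * rt p ((p - 1) * g ^ l)" by (simp only:)
qed

text \<open>With \<open>b = g ^ l\<close>, the shift from \<open>l\<close> to \<open>l + i\<close>
  absorbs \<open>gp i\<close> at the cost of an inverse character value: the Fourier transform of a
  character is its Gauss sum times the inverse character.\<close>

lemma fourier_chi:
  "(\<Sum>b<p. chi j (int b) * rt p ((p - 1) * b * gp i)) = tau j * winv j i"
proof -
  have "{..<p} = insert 0 {1..<p}" using p_gt_2 by auto
  then have "(\<Sum>b<p. chi j (int b) * rt p ((p - 1) * b * gp i)) =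
      (\<Sum>b\<in>{1..<p}. chi j (int b) * rt p ((p - 1) * b * gp i))"
    by (simp add: chi_dvd)
  also have "\<dots> = (\<Sum>l<2 * h. chi j (int (gp l)) * rt p ((p - 1) * gp l * gp i))"
    by (rule sum.reindex_bij_betw[OF gp_bij, symmetric])
  also have "\<dots> = (\<Sum>l<2 * h. winv j i * (rt (2 * h) (j * (l + i)) * rt p ((p - 1) * g ^ (l + i))))"
  proof (rule sum.cong[OF refl])
    fix l
    have "rt p ((p - 1) * gp l * gp i) = rt p (gp l * (gp i * (p - 1)))" by (simp only: mult_ac)
    also have "\<dots> = rt p (g ^ l * (gp i * (p - 1)))" by (rule rt_gp)
    also have "\<dots> = rt p (gp i * (g ^ l * (p - 1)))" by (simp only: mult.left_commute)
    also have "\<dots> = rt p ((p - 1) * g ^ (l + i))" unfolding rt_gp by (simp only: power_add mult_ac)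
    finally have "rt p ((p - 1) * gp l * gp i) = rt p ((p - 1) * g ^ (l + i))" .
    moreover have "rt (2 * h) (j * l) = winv j i * rt (2 * h) (j * (l + i))"
      unfolding distrib_left[of j] rt_add using winv_mult[of j i] by (simp add: mult.left_commute)
    ultimately show "chi j (int (gp l)) * rt p ((p - 1) * gp l * gp i) =
       winv j i * (rt (2 * h) (j * (l + i)) * rt p ((p - 1) * g ^ (l + i)))"
      by (simp only: chi_gp mult.assoc)
  qed
  also have "\<dots> = winv j i * (\<Sum>l<2 * h. rt (2 * h) (j * (l + i)) * rt p ((p - 1) * g ^ (l + i)))"
    by (simp add: sum_distrib_left)
  also have "(\<Sum>l<2 * h. rt (2 * h) (j * (l + i)) * rt p ((p - 1) * g ^ (l + i))) = tau j"
    by (rule tau_shift)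
  finally show ?thesis by (simp only: mult.commute)
qed

lemma dirichlet_L_chi:
  assumes "0 < j" "j < 2 * h"
  shows "dirichlet_L 1 (chi j) = - tau j * (\<Sum>i<2 * h. winv j i * Ln (1 - rt p (g ^ i))) / of_nat p"
proof -
  have "dirichlet_L 1 (chi j) =
    - (\<Sum>a\<in>{1..<p}. (\<Sum>b<p. chi j (int b) * rt p ((p - 1) * b * a)) * Ln (1 - rt p a)) / of_nat p"
    using assms p_gt_2 by (intro dirichlet_L_1_finite chi_character chi_nonprincipal) auto
  also have "(\<Sum>a\<in>{1..<p}. (\<Sum>b<p. chi j (int b) * rt p ((p - 1) * b * a)) * Ln (1 - rt p a)) =
    (\<Sum>i<2 * h. (\<Sum>b<p. chi j (int b) * rt p ((p - 1) * b * gp i)) * Ln (1 - rt p (gp i)))"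
    by (rule sum.reindex_bij_betw[OF gp_bij, symmetric])
  also have "\<dots> = tau j * (\<Sum>i<2 * h. winv j i * Ln (1 - rt p (g ^ i)))"
    unfolding fourier_chi rt_gp_conv sum_distrib_left by (simp only: mult.assoc)
  finally show ?thesis by simp
qed

lemma winv_add_h: "winv j (i + h) = (-1) ^ j * winv j i"
proof -
  have "winv j (i + h) = winv j i * rt (2 * h) (h * ((2 * h - 1) * j))"
    unfolding winv_def rt_add[symmetric] by (simp only: distrib_left mult.commute[of h])
  moreover have "even ((2 * h - 1) * j) = even j" using h_pos by simp
  ultimately show ?thesis unfolding rt_h by (simp add: minus_one_power_iff)
qed

lemma sum_winv:
  assumes "0 < j" "j < 2 * h"
  shows "(\<Sum>i<2 * h. winv j i) = 0"
proof -
  have "\<not> 2 * h dvd (2 * h - 1) * j"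
  proof
    assume "2 * h dvd (2 * h - 1) * j"
    moreover have "coprime (2 * h) (2 * h - 1)"
      using h_pos by (intro coprime_diff_one_right_nat) auto
    ultimately have "2 * h dvd j" by (simp add: coprime_dvd_mult_right_iff)
    then show False using assms by (auto dest: dvd_imp_le)
  qed
  then have "(\<Sum>i<2 * h. rt (2 * h) (i * ((2 * h - 1) * j))) = 0" using h_pos by (simp add: sum_rt)
  then show ?thesis unfolding winv_def by (simp only: mult.commute)
qed

text \<open>For \<open>0 < j < 2 * h\<close> this is \<open>p\<close> times the first generalized
  Bernoulli number of the inverse of \<open>chi j\<close>.\<close>

definition B :: "nat \<Rightarrow> complex" where
  "B j = (\<Sum>i<2 * h. winv j i * of_nat (gp i))"

text \<open>For even \<open>j\<close> the summand has period \<open>h\<close>, so half of the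
  exponents carry all the information.\<close>

definition Y :: "nat \<Rightarrow> complex" where
  "Y j = (\<Sum>i<h. winv j i * of_real (lam i))"

text \<open>The shift by \<open>h\<close> changes the sign of the character but not the real
  logarithms, which therefore cancel. In the imaginary parts the constant disappears by
  orthogonality and the residues leave \<open>B j\<close>.\<close>

lemma dirichlet_L_odd:
  assumes "odd j" "j < 2 * h"
  shows "dirichlet_L 1 (chi j) = - (\<i> * of_real pi) * (tau j * B j) / (of_nat p)\<^sup>2"
proof -
  have j0: "j > 0" using assms(1) by (cases j) auto
  have "(\<Sum>i<2 * h. winv j i * Ln (1 - rt p (g ^ i))) =
    (\<Sum>i<2 * h. winv j i * of_real (lam i)) + \<i> * of_real pi / of_nat p * (\<Sum>i<2 * h. winv j i * of_nat (gp i))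
     - \<i> * of_real pi / 2 * (\<Sum>i<2 * h. winv j i)"
    unfolding Ln_lam sum_distrib_left sum.distrib[symmetric] sum_subtractf[symmetric]
    by (intro sum.cong) (simp_all add: algebra_simps)
  also have "(\<Sum>i<2 * h. winv j i * of_real (lam i)) = 0"
    unfolding sum_two_halves winv_add_h lam_add_h using assms(1) by simp
  finally show ?thesis
    unfolding dirichlet_L_chi[OF j0 assms(2)]
    by (simp add: sum_winv[OF j0 assms(2)] B_def power2_eq_square)
qed

text \<open>Opposite residues have conjugate logarithms, and an even character gives them equal
  weight, so the imaginary parts cancel in pairs.\<close>

lemma dirichlet_L_even:
  assumes "even j" "0 < j" "j < 2 * h"
  shows "dirichlet_L 1 (chi j) = - 2 * tau j * Y j / of_nat p"
proof -
  have "winv j i * Ln (1 - rt p (g ^ i)) + winv j (i + h) * Ln (1 - rt p (g ^ (i + h))) =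
      2 * (winv j i * of_real (lam i))" for i
  proof -
    have "gp (i + h) + gp i = p" using gp_add_h[of i] gp_less[of i] by simp
    then have "of_nat (gp (i + h)) = (of_nat p - of_nat (gp i) :: complex)"
      by (simp add: algebra_simps flip: of_nat_add)
    moreover have "of_nat p / of_nat p = (1 :: complex)" using p_gt_2 by simp
    ultimately have "of_nat (gp (i + h)) / of_nat p = (1 - of_nat (gp i) / of_nat p :: complex)"
      by (simp only: diff_divide_distrib)
    moreover have "winv j (i + h) = winv j i" using assms(1) by (simp add: winv_add_h)
    ultimately show ?thesis
      unfolding Ln_lam lam_add_h by (simp only:) (simp add: algebra_simps)
  qed
  then have "(\<Sum>i<2 * h. winv j i * Ln (1 - rt p (g ^ i))) = 2 * Y j"
    by (simp add: sum_two_halves Y_def sum_distrib_left)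
  then show ?thesis unfolding dirichlet_L_chi[OF assms(2,3)] by simp
qed

end

section \<open>Nonvanishing at 1\<close>

text \<open>Raising \<open>y\<close> by one strikes out the Euler factor at \<open>y\<close>, if
  there is one. Sums over rough numbers thus stand for tails of the Euler product, and infinite
  products are avoided.\<close>

definition rough :: "nat \<Rightarrow> nat set" where
  "rough y = {n. n > 0 \<and> (\<forall>q. prime q \<and> q dvd n \<longrightarrow> y \<le> q)}"

lemma rough_0: "rough 0 = {0<..}"
  by (auto simp: rough_def)

lemma rough_Suc_not_prime:
  assumes "\<not> prime y"
  shows "rough (Suc y) = rough y"
proof -
  have "Suc y \<le> q \<longleftrightarrow> y \<le> q" if "prime q" for q
    using that assms by (cases "q = y") auto
  then show ?thesis by (auto simp: rough_def)
qed

lemma rough_Suc_prime: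
  assumes "prime y"
  shows "rough y = rough (Suc y) \<union> (\<lambda>n. y * n) ` rough y" "rough (Suc y) \<inter> (\<lambda>n. y * n) ` rough y = {}"
proof -
  have y0: "y > 0" using assms prime_gt_0_nat by blast
  show "rough (Suc y) \<inter> (\<lambda>n. y * n) ` rough y = {}"
  proof -
    have "y * k \<notin> rough (Suc y)" for k
    proof
      assume "y * k \<in> rough (Suc y)"
      then have "prime y \<and> y dvd y * k \<longrightarrow> Suc y \<le> y" unfolding rough_def by blast
      then show False using assms by simp
    qed
    then show ?thesis by blast
  qed
  show "rough y = rough (Suc y) \<union> (\<lambda>n. y * n) ` rough y"
  proof (intro equalityI subsetI)
    fix n assume n: "n \<in> rough y"
    show "n \<in> rough (Suc y) \<union> (\<lambda>n. y * n) ` rough y"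
    proof (cases "y dvd n")
      case True
      then obtain k where k: "n = y * k" by blast
      then have "k \<in> rough y" using n by (auto simp: rough_def)
      then show ?thesis using k by blast
    next
      case False
      have "Suc y \<le> q" if "prime q" "q dvd n" for q
      proof -
        have "y \<le> q" using n that unfolding rough_def by blast
        moreover have "q \<noteq> y" using that False by blast
        ultimately show ?thesis by simp
      qed
      then have "n \<in> rough (Suc y)" using n unfolding rough_def by blast
      then show ?thesis by blast
    qed
  next
    fix n assume "n \<in> rough (Suc y) \<union> (\<lambda>n. y * n) ` rough y"
    then show "n \<in> rough y"
    proof
      assume "n \<in> rough (Suc y)"
      then show ?thesis unfolding rough_def by (blast intro: Suc_leD)
    next
      assume "n \<in> (\<lambda>n. y * n) ` rough y"
      then obtain k where k: "n = y * k" "k \<in> rough y" by blast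
      have "y \<le> q" if "prime q" "q dvd n" for q
      proof (cases "q dvd k")
        case True
        then show ?thesis using k that unfolding rough_def by blast
      next
        case False
        then have "q dvd y" using that k(1) prime_dvd_mult_iff[OF that(1), of y k] by blast
        then have "q = y" using that assms primes_dvd_imp_eq by blast
        then show ?thesis by simp
      qed
      then show ?thesis using k y0 by (auto simp: rough_def)
    qed
  qed
qed

text \<open>The numbers struck out are the \<open>y * n\<close> with \<open>n\<close> in
  \<open>rough y\<close>; by complete multiplicativity their sum is \<open>f y\<close> times the
  whole.\<close>

lemma infsum_rough_Suc:
  fixes f :: "nat \<Rightarrow> complex"
  assumes summ: "f summable_on UNIV" and mult: "\<And>a b. f (a * b) = f a * f b"
  shows "infsum f (rough (Suc y)) = (if prime y then 1 - f y else 1) * infsum f (rough y)"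
proof (cases "prime y")
  case False
  then show ?thesis by (simp add: rough_Suc_not_prime)
next
  case True
  have y0: "y > 0" using True prime_gt_0_nat by blast
  have s: "f summable_on A" for A using summable_on_subset_banach[OF summ] by blast
  have "infsum f (rough y) = infsum f (rough (Suc y)) + infsum f ((\<lambda>n. y * n) ` rough y)"
    using infsum_Un_disjoint[OF s s rough_Suc_prime(2)[OF True]] rough_Suc_prime(1)[OF True] by simp
  also have "infsum f ((\<lambda>n. y * n) ` rough y) = infsum (f \<circ> (\<lambda>n. y * n)) (rough y)"
    using y0 by (intro infsum_reindex) (auto simp: inj_on_def)
  also have "\<dots> = infsum (\<lambda>n. f y * f n) (rough y)" by (simp add: mult o_def)
  also have "\<dots> = f y * infsum f (rough y)" by (intro infsum_cmult_right s)
  finally have "infsum f (rough (Suc y)) + f y * infsum f (rough y) = infsum f (rough y)" by (rule sym)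
  then have "infsum f (rough (Suc y)) = infsum f (rough y) - f y * infsum f (rough y)"
    by (simp only: eq_diff_eq)
  then show ?thesis using True by (simp add: left_diff_distrib)
qed

text \<open>Apart from 1, every element of \<open>rough y\<close> is at least \<open>y\<close>, so
  the rest is bounded by a tail of an absolutely convergent series.\<close>

lemma infsum_rough_tendsto:
  fixes f :: "nat \<Rightarrow> complex"
  assumes summ: "(\<lambda>n. norm (f n)) summable_on UNIV" and f1: "f 1 = 1"
  shows "(\<lambda>y. infsum f (rough y)) \<longlonglongrightarrow> 1"
proof -
  have sn: "(\<lambda>n. norm (f n)) summable_on A" for A using summable_on_subset_banach[OF summ] by blast
  then have s: "f summable_on A" for A by (rule abs_summable_summable)
  define T where "T = infsum (\<lambda>n. norm (f n)) UNIV"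
  have sums: "(\<lambda>n. norm (f n)) sums T"
    unfolding T_def using has_sum_imp_sums[OF has_sum_infsum[OF summ]] by simp
  have bound: "norm (infsum f (rough y) - 1) \<le> T - (\<Sum>n<y. norm (f n))" for y
  proof -
    have mem: "1 \<in> rough y" by (auto simp: rough_def)
    have sub: "rough y - {1} \<subseteq> {y..}"
    proof
      fix n assume n: "n \<in> rough y - {1}"
      then obtain q where q: "prime q" "q dvd n" using prime_factor_nat by blast
      then have "y \<le> q" "q \<le> n" using n by (auto simp: rough_def dvd_imp_le)
      then show "n \<in> {y..}" by simp
    qed
    have "infsum f (rough y) = infsum f ({1} \<union> (rough y - {1}))" using mem by (simp add: insert_absorb)
    also have "\<dots> = 1 + infsum f (rough y - {1})"
      by (subst infsum_Un_disjoint) (auto simp: s f1[unfolded One_nat_def])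
    finally have "norm (infsum f (rough y) - 1) = norm (infsum f (rough y - {1}))" by simp
    also have "\<dots> \<le> infsum (\<lambda>n. norm (f n)) (rough y - {1})"
      by (rule norm_infsum_bound[OF sn])
    also have "\<dots> \<le> infsum (\<lambda>n. norm (f n)) {y..}"
      using sub by (intro infsum_mono_neutral sn) auto
    also have "\<dots> = T - (\<Sum>n<y. norm (f n))"
    proof -
      have "(UNIV :: nat set) = {..<y} \<union> {y..}" by auto
      then have "T = infsum (\<lambda>n. norm (f n)) ({..<y} \<union> {y..})" unfolding T_def by simp
      also have "\<dots> = (\<Sum>n<y. norm (f n)) + infsum (\<lambda>n. norm (f n)) {y..}"
        by (subst infsum_Un_disjoint) (auto simp: sn)
      finally show ?thesis by simp
    qed
    finally show ?thesis .
  qed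
  have "(\<lambda>y. T - (\<Sum>n<y. norm (f n))) \<longlonglongrightarrow> T - T"
    using sums unfolding sums_def by (intro tendsto_diff tendsto_const)
  then have "(\<lambda>y. T - (\<Sum>n<y. norm (f n))) \<longlonglongrightarrow> 0" by simp
  then have "(\<lambda>y. infsum f (rough y) - 1) \<longlonglongrightarrow> 0"
    by (rule Lim_null_comparison[rotated]) (use bound in auto)
  then show ?thesis by (simp only: LIM_zero_iff)
qed

section \<open>The 3-4-1 inequality for one Euler factor\<close>

lemma norm_one_minus_eq_exp:
  assumes "norm w < 1"
  shows "\<exists>l. (\<lambda>n. Re (w ^ n) / real n) sums l \<and> norm (1 - w) = exp (- l)"
proof -
  \<comment> \<open>The term at \<open>n = 0\<close> is a division by 0, hence 0, so the series is
    the usual one from 1 on.\<close>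
  have "(\<lambda>n. - ((- (- w)) ^ n) / of_nat n) sums ln (1 + - w)"
    using assms by (intro Ln_series') simp
  then have "(\<lambda>n. - (w ^ n / of_nat n)) sums Ln (1 - w)" by simp
  then have "(\<lambda>n. - (- (w ^ n / of_nat n))) sums (- Ln (1 - w))" by (rule sums_minus)
  then have "(\<lambda>n. w ^ n / of_nat n) sums (- Ln (1 - w))" by simp
  from sums_Re[OF this] have "(\<lambda>n. Re (w ^ n) / real n) sums (- Re (Ln (1 - w)))" by simp
  moreover have "1 - w \<noteq> 0" using assms by auto
  then have "norm (1 - w) = exp (- (- Re (Ln (1 - w))))" by simp
  ultimately show ?thesis by blast
qed

text \<open>For \<open>v\<close> on the unit circle,
  \<open>3 + 4 * Re v + Re (v ^ 2) = 2 * (1 + Re v) ^ 2\<close> is nonnegative; this is applied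
  termwise, with \<open>v = u ^ n\<close>, to the logarithmic series.\<close>

lemma three_four_one:
  fixes u :: complex and x :: real
  assumes u: "norm u = 1" and x: "0 \<le> x" "x < 1"
  shows "norm (1 - of_real x :: complex) ^ 3 * norm (1 - u * of_real x) ^ 4 * norm (1 - u\<^sup>2 * of_real x) \<le> 1"
proof -
  obtain a where a: "(\<lambda>n. Re ((of_real x :: complex) ^ n) / real n) sums a" "norm (1 - of_real x :: complex) = exp (- a)"
    using norm_one_minus_eq_exp[of "of_real x"] x by auto
  obtain b where b: "(\<lambda>n. Re ((u * of_real x) ^ n) / real n) sums b" "norm (1 - u * of_real x) = exp (- b)"
    using norm_one_minus_eq_exp[of "u * of_real x"] x u by (auto simp: norm_mult)
  obtain c where c: "(\<lambda>n. Re ((u\<^sup>2 * of_real x) ^ n) / real n) sums c" "norm (1 - u\<^sup>2 * of_real x) = exp (- c)"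
    using norm_one_minus_eq_exp[of "u\<^sup>2 * of_real x"] x u by (auto simp: norm_mult norm_power)
  have "(\<lambda>n. 3 * (Re ((of_real x :: complex) ^ n) / real n) + 4 * (Re ((u * of_real x) ^ n) / real n)
      + Re ((u\<^sup>2 * of_real x) ^ n) / real n) sums (3 * a + 4 * b + c)"
    by (intro sums_add sums_mult a b c)
  moreover have "0 \<le> 3 * (Re ((of_real x :: complex) ^ n) / real n) + 4 * (Re ((u * of_real x) ^ n) / real n)
      + Re ((u\<^sup>2 * of_real x) ^ n) / real n" for n
  proof -
    define v where "v = u ^ n"
    have "norm v = 1" using u by (simp add: v_def norm_power)
    then have v: "(Re v)\<^sup>2 + (Im v)\<^sup>2 = 1" by (simp add: cmod_def)
    have e: "(u\<^sup>2) ^ n = v\<^sup>2" by (simp add: v_def mult.commute flip: power_mult)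
    have rx: "Re (w * of_real x ^ n) = Re w * x ^ n" for w
      by (simp flip: of_real_power)
    have "3 * (Re ((of_real x :: complex) ^ n) / real n) + 4 * (Re ((u * of_real x) ^ n) / real n)
      + Re ((u\<^sup>2 * of_real x) ^ n) / real n = x ^ n / real n * (3 + 4 * Re v + Re (v\<^sup>2))"
      using rx[of 1] unfolding power_mult_distrib e v_def[symmetric] rx
      by (simp add: algebra_simps add_divide_distrib)
    also have "3 + 4 * Re v + Re (v\<^sup>2) = 2 * (1 + Re v)\<^sup>2"
      using v by (simp add: power2_eq_square algebra_simps)
    finally show ?thesis using x by simp
  qed
  ultimately have nn: "3 * a + 4 * b + c \<ge> 0" by (rule sums_le[OF _ sums_zero, rotated]) 
  have "norm (1 - of_real x :: complex) ^ 3 * norm (1 - u * of_real x) ^ 4 * norm (1 - u\<^sup>2 * of_real x) = exp (- (3 * a + 4 * b + c))"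
    unfolding a b c by (simp add: exp_of_nat_mult[symmetric] exp_add[symmetric])
  then show ?thesis using nn by simp
qed

section \<open>Estimates uniform in the distance \<open>d\<close> from the point 1\<close>

lemma powr_neg_diff_ge:
  assumes "d > 0" and "(n::nat) > 0"
  shows "d * real (Suc n) powr (- (1 + d)) \<le> real n powr (- d) - real (Suc n) powr (- d)"
proof -
  have "\<exists>z>real n. z < real (Suc n) \<and> real (Suc n) powr (- d) - real n powr (- d) =
      (real (Suc n) - real n) * (- d * z powr (- d - 1))"
    using assms by (intro MVT2) (auto intro!: derivative_eq_intros)
  then obtain z where z': "real n < z" "z < real (Suc n)"
    "real (Suc n) powr (- d) - real n powr (- d) = (real (Suc n) - real n) * (- d * z powr (- d - 1))"
    by blast
  have "- d - 1 = - (1 + d)" by simp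
  with z' have z: "real n < z" "z < real (Suc n)"
    "real n powr (- d) - real (Suc n) powr (- d) = d * z powr (- (1 + d))"
    by simp_all
  have "real (Suc n) powr (- (1 + d)) \<le> z powr (- (1 + d))"
    using z assms by (intro powr_mono2') auto
  then show ?thesis unfolding z(3) using assms by (intro mult_left_mono) auto
qed

text \<open>The terms after the first are dominated by a telescoping sum. The bound
  \<open>1 / d\<close> reflects the simple pole at 1.\<close>

lemma sum_powr_bound:
  assumes "d > 0"
  shows "(\<Sum>n<N. real (Suc n) powr (- (1 + d))) \<le> 1 + 1 / d"
proof -
  have "(\<Sum>n<Suc M. real (Suc n) powr (- (1 + d))) \<le> 1 + (1 - real (Suc M) powr (- d)) / d" for M
  proof (induction M)
    case (Suc M)
    have "real (Suc (Suc M)) powr (- (1 + d)) \<le> (real (Suc M) powr (- d) - real (Suc (Suc M)) powr (- d)) / d"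
      using powr_neg_diff_ge[OF assms, of "Suc M"] assms by (simp add: field_simps)
    then show ?case using Suc
      by (subst sum.lessThan_Suc) (simp add: diff_divide_distrib del: sum.lessThan_Suc)
  qed simp
  moreover have "1 + (1 - real (Suc M) powr (- d)) / d \<le> 1 + 1 / d" for M
    using assms by (simp add: divide_right_mono)
  ultimately have "(\<Sum>n<Suc M. real (Suc n) powr (- (1 + d))) \<le> 1 + 1 / d" for M
    by (rule order_trans)
  then show ?thesis using assms by (cases N) (simp_all only: sum.lessThan_Suc, simp_all)
qed

text \<open>The mean value theorem gives \<open>z powr (- 2)\<close> times
  \<open>(1 + d) * z powr (- d) - 1\<close>, which is of order \<open>d\<close> up to a logarithm.
  The logarithm is bounded by \<open>2 * z powr (1/2)\<close>, whence the exponent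
  \<open>- 3 / 2\<close>; the factor 3 is 1 + 2.\<close>

lemma powr_kernel_diff:
  assumes d: "0 < d" "d \<le> 1"
  defines "a \<equiv> \<lambda>n. real (Suc n) powr (-1) - real (Suc n) powr (- (1 + d))"
  shows "\<bar>a n - a (Suc n)\<bar> \<le> d * (3 * real (Suc n) powr (- 3 / 2))"
proof -
  define \<phi> where "\<phi> = (\<lambda>x::real. x powr (-1) - x powr (- (1 + d)))"
  have "\<exists>z>real (Suc n). z < real (Suc (Suc n)) \<and> \<phi> (real (Suc (Suc n))) - \<phi> (real (Suc n)) =
      (real (Suc (Suc n)) - real (Suc n)) * ((- 1) * z powr (- 1 - 1) - (- (1 + d)) * z powr (- (1 + d) - 1))"
    unfolding \<phi>_def
    by (intro MVT2 DERIV_diff has_real_derivative_powr) auto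
  then obtain z where z': "real (Suc n) < z" "z < real (Suc (Suc n))"
    "\<phi> (real (Suc (Suc n))) - \<phi> (real (Suc n)) =
      (real (Suc (Suc n)) - real (Suc n)) * ((- 1) * z powr (- 1 - 1) - (- (1 + d)) * z powr (- (1 + d) - 1))"
    by blast
  have "- (1 + d) - 1 = - (2 + d)" "- 1 - 1 = (- 2 :: real)" by simp_all
  with z' have z: "real (Suc n) < z" "z < real (Suc (Suc n))"
    "\<phi> (real (Suc (Suc n))) - \<phi> (real (Suc n)) = - (z powr (- 2)) + (1 + d) * z powr (- (2 + d))"
    by (simp_all add: algebra_simps)
  have z1: "z > 1" using z(1) by simp
  have "z powr (- (2 + d)) = z powr (- 2) * z powr (- d)"
    by (simp add: powr_add[symmetric])
  then have eq: "a (Suc n) - a n = z powr (- 2) * ((1 + d) * z powr (- d) - 1)"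
    using z(3) by (simp add: a_def \<phi>_def algebra_simps)
  have w1: "z powr (- d) \<le> 1" using z1 d by (simp add: powr_le_one_le powr_minus_divide ge_one_powr_ge_zero)
  have w2: "1 - z powr (- d) \<le> d * ln z"
  proof -
    have "1 + (- d * ln z) \<le> exp (- d * ln z)" by (rule exp_ge_add_one_self)
    then show ?thesis using z1 by (simp add: powr_def)
  qed
  have "ln z \<le> 2 * (z powr (1/2))"
  proof -
    have "ln (z powr (1/2)) \<le> z powr (1/2) - 1" using z1 by (intro ln_le_minus_one) auto
    then show ?thesis using z1 by (simp add: ln_powr)
  qed
  then have w3: "1 - z powr (- d) \<le> d * (2 * (z powr (1/2)))"
    using order_trans[OF w2 mult_left_mono[OF _ less_imp_le[OF d(1)]]] by blast
  have w4: "1 \<le> z powr (1/2)" using z1 by (simp add: ge_one_powr_ge_zero)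
  have "\<bar>(1 + d) * z powr (- d) - 1\<bar> \<le> d * (3 * (z powr (1/2)))"
  proof -
    have "(1 + d) * z powr (- d) - 1 = d * z powr (- d) - (1 - z powr (- d))" by (simp add: algebra_simps)
    moreover have "0 \<le> d * z powr (- d)" "d * z powr (- d) \<le> d * z powr (1/2)"
      using d w1 w4 by auto
    ultimately show ?thesis using w1 w3 by (simp add: abs_le_iff)
  qed
  then have "\<bar>a (Suc n) - a n\<bar> \<le> z powr (- 2) * (d * (3 * (z powr (1/2))))"
    unfolding eq abs_mult by (intro mult_mono) auto
  also have "\<dots> = d * (3 * z powr (- 3 / 2))"
    using z1 by (simp add: powr_add[symmetric])
  also have "\<dots> \<le> d * (3 * real (Suc n) powr (- 3 / 2))"
    using z(1) d by (intro mult_left_mono powr_mono2') auto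
  finally show ?thesis by (simp add: abs_minus_commute)
qed

section \<open>Nonvanishing for nonreal characters\<close>

context odd_prime_primroot
begin

text \<open>The terms of the Dirichlet series at \<open>1 + d\<close>. The term at 0 vanishes, so
  sums over all \<open>n\<close> and over \<open>rough 0\<close> agree.\<close>

definition twist :: "nat \<Rightarrow> real \<Rightarrow> nat \<Rightarrow> complex" where
  "twist j d n = chi j (int n) * of_real (real n powr (- (1 + d)))"

lemma norm_chi: "norm (chi j a) \<le> 1"
  by (simp add: chi_def)

lemma chi_mult: "chi j (a * b) = chi j a * chi j b"
  using chi_character[of j] by (auto simp: dirichlet_characters_def)

lemma twist_mult: "twist j d (a * b) = twist j d a * twist j d b"
  by (simp add: twist_def chi_mult powr_mult)

lemma chi_1: "chi j 1 = 1"
  using chi_g_power[of j 0] by simp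

lemma twist_summable:
  assumes "d > 0"
  shows "(\<lambda>n. norm (twist j d n)) summable_on UNIV"
proof (rule summable_on_comparison_test)
  have "summable (\<lambda>n. norm (real n powr (- (1 + d))))"
    using assms by (simp add: summable_real_powr_iff)
  then show "(\<lambda>n. real n powr (- (1 + d))) summable_on UNIV"
    by (rule norm_summable_imp_summable_on)
  show "norm (twist j d n) \<le> real n powr (- (1 + d))" for n
    using norm_chi[of j "int n"] mult_right_mono[of "norm (chi j (int n))" 1 "real n powr (- (1 + d))"]
    by (simp add: twist_def norm_mult)
qed simp

lemma twist_sums:
  assumes "d > 0"
  shows "(\<lambda>n. twist j d (Suc n)) sums infsum (twist j d) (rough 0)"
proof -
  have s: "twist j d summable_on A" for A
    by (rule summable_on_subset_banach[OF abs_summable_summable[OF twist_summable[OF assms]]]) simp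
  have "infsum (twist j d) (rough 0) = infsum (twist j d) UNIV"
    unfolding rough_0 by (intro infsum_cong_neutral) (auto simp: twist_def chi_dvd)
  moreover have "twist j d sums infsum (twist j d) UNIV"
    using has_sum_imp_sums[OF has_sum_infsum[OF s]] by simp
  moreover have "twist j d 0 = 0" by (simp add: twist_def)
  ultimately show ?thesis by (simp add: sums_Suc_iff)
qed

text \<open>As \<open>y\<close> grows, the product of the sums over \<open>rough y\<close> is
  multiplied by factors at most 1 (\<open>three_four_one\<close>) and tends to 1. So it is at least
  1 at the start, where the sums are the full series.\<close>

lemma twist_euler_ge_1:
  assumes d: "d > 0"
  shows "1 \<le> norm (infsum (twist 0 d) (rough 0)) ^ 3 * norm (infsum (twist j d) (rough 0)) ^ 4 *
             norm (infsum (twist (2 * j) d) (rough 0))"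
proof -
  define F where "F = (\<lambda>y. norm (infsum (twist 0 d) (rough y)) ^ 3 * norm (infsum (twist j d) (rough y)) ^ 4 *
             norm (infsum (twist (2 * j) d) (rough y)))"
  have s: "twist i d summable_on UNIV" for i
    using twist_summable[OF d] by (rule abs_summable_summable)
  have "F (Suc y) \<le> F y" for y
  proof (cases "prime y")
    case False
    then show ?thesis by (simp add: F_def rough_Suc_not_prime)
  next
    case True
    define G where "G = norm (1 - twist 0 d y) ^ 3 * norm (1 - twist j d y) ^ 4 * norm (1 - twist (2 * j) d y)"
    have y1: "y > 1" using True prime_gt_1_nat by blast
    have "F (Suc y) = G * F y"
      using True by (simp add: F_def G_def infsum_rough_Suc[OF s twist_mult] norm_mult power_mult_distrib)
    moreover have "G \<le> 1"
    proof (cases "int p dvd int y")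
      case True
      then show ?thesis by (simp add: G_def twist_def chi_dvd)
    next
      case False
      define x where "x = real y powr (- (1 + d))"
      have x: "0 \<le> x" "x < 1" using y1 d by (auto simp: x_def powr_less_one)
      obtain i where i: "[int y = int g ^ i] (mod int p)" using exists_dlog[OF False] by blast
      have "norm (chi j (int y)) = 1" by (simp add: chi_eq[OF i])
      moreover have "chi 0 (int y) = 1" by (simp add: chi_eq[OF i])
      moreover have "chi (2 * j) (int y) = (chi j (int y))\<^sup>2"
        by (simp add: chi_eq[OF i] rt_power mult_ac)
      moreover have "twist l d y = chi l (int y) * of_real x" for l by (simp add: twist_def x_def)
      ultimately show ?thesis
        using three_four_one[OF _ x, of "chi j (int y)"] by (simp add: G_def)
    qed
    moreover have "F y \<ge> 0" by (simp add: F_def)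
    ultimately show ?thesis by (simp add: mult_left_le_one_le G_def)
  qed
  then have "decseq F" by (simp add: decseq_Suc_iff)
  moreover have "F \<longlonglongrightarrow> norm (1::complex) ^ 3 * norm (1::complex) ^ 4 * norm (1::complex)"
    unfolding F_def using d
    by (intro tendsto_mult tendsto_power tendsto_norm infsum_rough_tendsto twist_summable)
       (auto simp: twist_def chi_1)
  ultimately have "F 0 \<ge> norm (1::complex) ^ 3 * norm (1::complex) ^ 4 * norm (1::complex)"
    by (rule decseq_ge)
  then show ?thesis by (simp add: F_def)
qed

lemma twist_principal_bound:
  assumes d: "0 < d" "d \<le> 1"
  shows "norm (infsum (twist 0 d) (rough 0)) \<le> 2 / d"
proof -
  have "norm (\<Sum>n<N. twist 0 d (Suc n)) \<le> 2 / d" for N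
  proof -
    have "norm (\<Sum>n<N. twist 0 d (Suc n)) \<le> (\<Sum>n<N. real (Suc n) powr (- (1 + d)))"
    proof (rule sum_norm_le)
      fix n
      show "norm (twist 0 d (Suc n)) \<le> real (Suc n) powr (- (1 + d))"
        using norm_chi[of 0 "int (Suc n)"]
          mult_right_mono[of "norm (chi 0 (int (Suc n)))" 1 "real (Suc n) powr (- (1 + d))"]
        by (simp add: twist_def norm_mult)
    qed
    also have "\<dots> \<le> 1 + 1 / d" using d by (intro sum_powr_bound)
    also have "\<dots> \<le> 2 / d" using d by (simp add: field_simps)
    finally show ?thesis .
  qed
  moreover have "(\<lambda>N. norm (\<Sum>n<N. twist 0 d (Suc n))) \<longlonglongrightarrow> norm (infsum (twist 0 d) (rough 0))"
    using twist_sums[OF d(1), of 0] unfolding sums_def by (rule tendsto_norm)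
  ultimately show ?thesis by (meson LIMSEQ_le_const2)
qed

text \<open>Summation by parts against the bounded character sums. A zero at 1 then forces the
  series at \<open>1 + d\<close> to be of order \<open>d\<close>, and no derivative of the
  L-function is needed.\<close>

lemma twist_lipschitz:
  assumes j: "0 < j" "j < 2 * h"
  shows "\<exists>K\<ge>0. \<forall>d. 0 < d \<and> d \<le> 1 \<longrightarrow>
    norm (infsum (twist j d) (rough 0) - dirichlet_L 1 (chi j)) \<le> K * d"
proof -
  have np: "chi j \<noteq> principal_character p" using j by (rule chi_nonprincipal)
  obtain C where C: "\<And>N. norm (\<Sum>n<N. chi j (int n)) \<le> C"
    using bounded_sum_nonprincipal_character[OF chi_character np] p_gt_2 by auto
  have C0: "C \<ge> 0" using C[of 0] by simp
  define S where "S = (\<lambda>N. \<Sum>n<N. chi j (int (Suc n)))"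
  have S: "norm (S N) \<le> C" for N
  proof -
    have "(\<Sum>n<Suc N. chi j (int n)) = S N"
      unfolding S_def by (subst sum.lessThan_Suc_shift) (simp add: chi_dvd)
    then show ?thesis using C[of "Suc N"] by simp
  qed
  define k where "k = (\<lambda>n. 3 * real (Suc n) powr (- 3 / 2))"
  have "summable (\<lambda>n. real (Suc n) powr (- 3 / 2))"
    using summable_Suc_iff[of "\<lambda>n. real n powr (- 3 / 2)"] by (simp only: summable_real_powr_iff)
  then have k: "summable k" unfolding k_def by (rule summable_mult)
  have bound: "norm (infsum (twist j d) (rough 0) - dirichlet_L 1 (chi j)) \<le> C * suminf k * d"
    if d: "0 < d" "d \<le> 1" for d
  proof -
    define a where "a = (\<lambda>n. real (Suc n) powr (-1) - real (Suc n) powr (- (1 + d)))"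
    have parts: "(\<Sum>n<N. of_real (a n) * chi j (int (Suc n))) =
        of_real (a N) * S N + (\<Sum>n<N. of_real (a n - a (Suc n)) * S (Suc n))" for N
      by (induction N) (simp_all add: S_def algebra_simps)
    have "norm (\<Sum>n<N. of_real (a n) * chi j (int (Suc n))) \<le> \<bar>a N\<bar> * C + C * suminf k * d" for N
    proof -
      have "norm (\<Sum>n<N. of_real (a n - a (Suc n)) * S (Suc n)) \<le> (\<Sum>n<N. d * k n * C)"
      proof (rule sum_norm_le)
        fix n
        have "\<bar>a n - a (Suc n)\<bar> \<le> d * k n"
          unfolding a_def k_def by (rule powr_kernel_diff[OF d])
        then show "norm (of_real (a n - a (Suc n)) * S (Suc n)) \<le> d * k n * C"
          unfolding norm_mult norm_of_real using S[of "Suc n"] by (intro mult_mono) auto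
      qed
      also have "\<dots> = C * d * (\<Sum>n<N. k n)" by (simp add: sum_distrib_left mult_ac)
      also have "\<dots> \<le> C * d * suminf k"
        using C0 d by (intro mult_left_mono sum_le_suminf[OF k]) (auto simp: k_def)
      finally have "norm (\<Sum>n<N. of_real (a n - a (Suc n)) * S (Suc n)) \<le> C * suminf k * d" by (simp add: mult_ac)
      moreover have "norm (of_real (a N) * S N) \<le> \<bar>a N\<bar> * C"
        unfolding norm_mult norm_of_real using S[of N] by (intro mult_left_mono) auto
      ultimately show ?thesis unfolding parts by (intro norm_triangle_mono)
    qed
    moreover have "(\<lambda>N. norm (\<Sum>n<N. of_real (a n) * chi j (int (Suc n)))) \<longlonglongrightarrow>
        norm (dirichlet_L 1 (chi j) - infsum (twist j d) (rough 0))"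
    proof -
      have "(\<lambda>n. chi j (int (Suc n)) / of_nat (Suc n) - twist j d (Suc n)) sums
          (dirichlet_L 1 (chi j) - infsum (twist j d) (rough 0))"
        using p_gt_2 by (intro sums_diff dirichlet_L_1_sums[OF chi_character np] twist_sums d) auto
      moreover have "chi j (int (Suc n)) / of_nat (Suc n) - twist j d (Suc n) = of_real (a n) * chi j (int (Suc n))" for n
      proof -
        have "real (Suc n) powr (-1) = 1 / real (Suc n)" by (simp add: powr_minus_divide)
        then show ?thesis unfolding a_def twist_def by (simp add: algebra_simps del: of_nat_Suc)
      qed
      ultimately show ?thesis unfolding sums_def by (intro tendsto_norm) simp
    qed
    moreover have "(\<lambda>N. \<bar>a N\<bar> * C + C * suminf k * d) \<longlonglongrightarrow> \<bar>0 - 0\<bar> * C + C * suminf k * d"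
    proof -
      have f: "filterlim (\<lambda>n. real (Suc n)) at_top sequentially"
        using filterlim_compose[OF filterlim_real_sequentially filterlim_Suc] .
      show ?thesis unfolding a_def
        by (intro tendsto_intros tendsto_neg_powr f) (use d in auto)
    qed
    ultimately have "norm (dirichlet_L 1 (chi j) - infsum (twist j d) (rough 0)) \<le> \<bar>0 - 0\<bar> * C + C * suminf k * d"
      by (intro LIMSEQ_le[of _ _ "\<lambda>N. \<bar>a N\<bar> * C + C * suminf k * d"]) auto
    then show ?thesis by (simp add: norm_minus_commute)
  qed
  have "C * suminf k \<ge> 0" using C0 by (intro mult_nonneg_nonneg suminf_nonneg k) (auto simp: k_def)
  then show ?thesis using bound by blast
qed

text \<open>For \<open>j \<noteq> h\<close> the square of the character is nonprincipal, so its
  series stays bounded near 1. A zero would make the product in \<open>twist_euler_ge_1\<close> of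
  order at most \<open>d\<close>: a third power of \<open>1 / d\<close> against a fourth power of
  \<open>d\<close>.\<close>

lemma dirichlet_L_nonreal_nonzero:
  assumes j: "0 < j" "j < 2 * h" "j \<noteq> h"
  shows "dirichlet_L 1 (chi j) \<noteq> 0"
proof
  assume L0: "dirichlet_L 1 (chi j) = 0"
  define j2 where "j2 = (2 * j) mod (2 * h)"
  have j2: "0 < j2" "j2 < 2 * h"
  proof -
    show "j2 < 2 * h" using h_pos by (simp add: j2_def)
    have "\<not> h dvd j"
    proof
      assume "h dvd j"
      then obtain c where "j = h * c" by blast
      with j h_pos show False by (cases c; cases "c - 1") auto
    qed
    then have "\<not> 2 * h dvd 2 * j" by simp
    then show "0 < j2" unfolding j2_def by (simp add: dvd_eq_mod_eq_0)
  qed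
  have chi2: "chi (2 * j) = chi j2" unfolding chi_eq_iff j2_def by (simp add: cong_def)
  obtain K where K: "K \<ge> 0" "\<And>d. 0 < d \<Longrightarrow> d \<le> 1 \<Longrightarrow> norm (infsum (twist j d) (rough 0)) \<le> K * d"
    using twist_lipschitz[OF j(1,2)] L0 by auto
  obtain K' where K': "K' \<ge> 0" "\<And>d. 0 < d \<Longrightarrow> d \<le> 1 \<Longrightarrow>
     norm (infsum (twist j2 d) (rough 0) - dirichlet_L 1 (chi j2)) \<le> K' * d"
    using twist_lipschitz[OF j2] by auto
  define M where "M = norm (dirichlet_L 1 (chi j2)) + K'"
  have M: "norm (infsum (twist (2 * j) d) (rough 0)) \<le> M" if "0 < d" "d \<le> 1" for d
  proof -
    have "twist (2 * j) d = twist j2 d" by (simp add: twist_def fun_eq_iff chi2)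
    moreover have "norm (infsum (twist j2 d) (rough 0)) \<le>
       norm (infsum (twist j2 d) (rough 0) - dirichlet_L 1 (chi j2)) + norm (dirichlet_L 1 (chi j2))"
      using norm_triangle_sub[of "infsum (twist j2 d) (rough 0)" "dirichlet_L 1 (chi j2)"] by linarith
    moreover have "K' * d \<le> K'" using K'(1) that by (simp add: mult_left_le)
    ultimately show ?thesis using K'(2)[OF that] by (simp add: M_def)
  qed
  \<comment> \<open>The product will be at most \<open>A * d\<close>, with 8 from the cube of
    \<open>2 / d\<close>; the choice of \<open>d\<close> makes this less than 1.\<close>
  define A where "A = 8 * K ^ 4 * M"
  have M0: "M \<ge> 0" using K' by (simp add: M_def)
  have A0: "A \<ge> 0" using K M0 by (simp add: A_def)
  define d where "d = 1 / (A + 1)"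
  have d: "0 < d" "d \<le> 1" using A0 by (auto simp: d_def)
  have "1 \<le> norm (infsum (twist 0 d) (rough 0)) ^ 3 * norm (infsum (twist j d) (rough 0)) ^ 4 *
             norm (infsum (twist (2 * j) d) (rough 0))"
    by (rule twist_euler_ge_1[OF d(1)])
  also have "\<dots> \<le> (2 / d) ^ 3 * (K * d) ^ 4 * M"
    using d K M0 by (intro mult_mono power_mono twist_principal_bound K M) auto
  also have "\<dots> = A * d" using d by (simp add: A_def power_mult_distrib power_divide power4_eq_xxxx power3_eq_cube)
  also have "\<dots> < 1" using A0 by (simp add: d_def)
  finally show False by simp
qed

section \<open>Gauss sums and the quadratic character\<close>

lemma tau_nonzero:
  assumes "0 < j" "j < 2 * h"
  shows "tau j \<noteq> 0"
proof
  assume t0: "tau j = 0"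
  let ?T = "\<lambda>a. \<Sum>b<p. chi j (int b) * rt p ((p - 1) * b * a)"
  \<comment> \<open>A zero Gauss sum would annihilate the whole Fourier transform, contrary to
    inversion at 1.\<close>
  have T: "?T a = 0" if "a < p" for a
  proof (cases "a = 0")
    case True
    have "(\<Sum>b<p. chi j (int b)) = (\<Sum>a\<in>{0..<int p}. chi j a)"
      by (rule sum.reindex_bij_witness[of _ nat int]) auto
    then show ?thesis
      using True sum_nonprincipal_character[OF chi_character chi_nonprincipal[OF assms]] p_gt_2 by simp
  next
    case False
    then have "a \<in> gp ` {..<2 * h}"
      unfolding bij_betw_imp_surj_on[OF gp_bij] using that by simp
    then obtain i where i: "a = gp i" by blast
    show ?thesis unfolding i fourier_chi t0 by simp
  qed
  have "chi j (int 1) = (\<Sum>a<p. ?T a * rt p (1 * a)) / of_nat p"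
    using p_gt_2 by (intro character_fourier_inversion chi_character) auto
  also have "(\<Sum>a<p. ?T a * rt p (1 * a)) = 0"
    using T by (intro sum.neutral ballI) (simp only: lessThan_iff mult_zero_left)
  finally show False using chi_1 by simp
qed

text \<open>The cyclotomic polynomial \<open>1 + X + ... + X ^ (p - 1)\<close> evaluated at 1: it
  and the product of linear factors are monic of degree \<open>2 * h\<close> with the same
  \<open>2 * h\<close> roots.\<close>

lemma prod_one_minus_rt: "(\<Prod>i<2 * h. 1 - rt p (g ^ i)) = of_nat p"
proof -
  define A where "A = (\<lambda>i. rt p (g ^ i)) ` {..<2 * h}"
  define P :: "complex poly" where "P = (\<Prod>i<2 * h. [:- rt p (g ^ i), 1:])"
  define Q :: "complex poly" where "Q = (\<Sum>k<p. Polynomial.monom 1 k)"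
  have inj: "inj_on (\<lambda>i. rt p (g ^ i)) {..<2 * h}"
  proof (rule inj_onI)
    fix i i' assume i: "i \<in> {..<2 * h}" "i' \<in> {..<2 * h}" "rt p (g ^ i) = rt p (g ^ i')"
    have "rt p (g ^ (i' + h) + g ^ i) = rt p (g ^ (i' + h) + g ^ i')"
      by (simp only: rt_add i(3))
    also have "\<dots> = 1" unfolding rt_add rt_add_h_cnj
      using complex_norm_square[of "rt p (g ^ i')"] by (simp add: mult.commute)
    finally have "p dvd g ^ (i' + h) + g ^ i" using p_gt_2 by (simp add: rt_eq_1_iff)
    then have "p dvd gp (i' + h) + gp i" by (simp add: gp_def dvd_eq_mod_eq_0 mod_add_eq)
    then have "p dvd (p - gp i') + gp i" by (simp only: gp_add_h)
    then obtain c where c: "(p - gp i') + gp i = p * c" by blast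
    have "p * c > 0" "p * c < p * 2"
      using gp_less[of i'] gp_less[of i] gp_pos[of i'] unfolding c[symmetric] by linarith+
    then have "c = 1" by simp
    then have "gp i = gp i'" using c gp_less[of i'] by simp
    then show "i = i'" using i(1,2) by (rule inj_onD[OF bij_betw_imp_inj_on[OF gp_bij]])
  qed
  have cardA: "card A = 2 * h" unfolding A_def using inj by (simp add: card_image)
  have degP: "Polynomial.degree P = 2 * h" unfolding P_def by (subst degree_prod_eq_sum_degree) auto
  have lcP: "lead_coeff P = 1" unfolding P_def by (simp add: lead_coeff_prod)
  have degQ: "Polynomial.degree Q \<le> 2 * h" unfolding Q_def
    by (rule Polynomial.degree_le) (auto simp: coeff_sum p_minus_1[symmetric])
  have "P = Q"
  proof (rule poly_eqI_degree_lead_coeff[where n = "2 * h" and A = A])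
    have "Polynomial.coeff Q (2 * h) = 1" unfolding Q_def using p_gt_2 by (simp add: coeff_sum p_minus_1[symmetric])
    then show "Polynomial.coeff P (2 * h) = Polynomial.coeff Q (2 * h)" using lcP degP by simp
    fix z assume "z \<in> A"
    then obtain i where i: "i < 2 * h" "z = rt p (g ^ i)" by (auto simp: A_def)
    have "poly P z = 0" unfolding P_def i(2) poly_prod using i(1) by (intro prod_zero) auto
    moreover have "poly Q z = 0"
    proof -
      have "poly Q z = (\<Sum>k<p. rt p (k * g ^ i))"
        by (simp add: Q_def poly_sum poly_monom i(2) rt_power mult.commute)
      then show ?thesis using p_gt_2 g_power_not_dvd[of i] by (simp add: sum_rt)
    qed
    ultimately show "poly P z = poly Q z" by simp
  qed (simp_all add: cardA degP degQ)
  then have "poly P 1 = poly Q 1" by simp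
  then show ?thesis by (simp add: P_def Q_def poly_prod poly_sum poly_monom)
qed

lemma sum_lam: "(\<Sum>i<h. lam i) = ln (real p) / 2"
proof -
  have "ln (real p) = ln (norm (\<Prod>i<2 * h. 1 - rt p (g ^ i)))"
    unfolding prod_one_minus_rt by simp
  also have "\<dots> = (\<Sum>i<2 * h. lam i)"
    unfolding prod_norm[symmetric] lam_def using one_minus_rt_nonzero by (subst ln_prod) auto
  also have "\<dots> = 2 * (\<Sum>i<h. lam i)"
    unfolding sum_two_halves lam_add_h by (simp add: sum_distrib_left)
  finally show ?thesis by simp
qed

text \<open>For the quadratic character \<open>B h\<close> is an integer, congruent modulo 2 to the
  sum \<open>h * p\<close> of all residues, which is odd.\<close>

lemma B_h_nonzero:
  assumes "odd h"
  shows "B h \<noteq> 0"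
proof -
  have w: "winv h i = of_int ((-1) ^ i)" for i
  proof -
    have "winv h i = rt (2 * h) (h * ((2 * h - 1) * i))"
      unfolding winv_def by (simp only: mult_ac)
    moreover have "even ((2 * h - 1) * i) = even i" using h_pos by simp
    ultimately show ?thesis unfolding rt_h by (simp add: minus_one_power_iff)
  qed
  have "B h = of_int (\<Sum>i<2 * h. (-1) ^ i * int (gp i))"
    unfolding B_def w by simp
  moreover have "odd (\<Sum>i<2 * h. (-1) ^ i * int (gp i))"
  proof -
    have "even (\<Sum>i<2 * h. (-1) ^ i * int (gp i) + int (gp i))"
      by (rule dvd_sum) (auto simp: minus_one_power_iff)
    then have "even ((\<Sum>i<2 * h. (-1) ^ i * int (gp i)) + (\<Sum>i<2 * h. int (gp i)))"
      by (simp only: sum.distrib)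
    moreover have "(\<Sum>i<2 * h. int (gp i)) = int (h * p)"
    proof -
      have "gp i + gp (i + h) = p" for i using gp_add_h[of i] gp_less[of i] by simp
      then have "(\<Sum>i<2 * h. gp i) = h * p" unfolding sum_two_halves by simp
      then show ?thesis by (simp only: of_nat_sum[symmetric])
    qed
    ultimately show ?thesis using assms odd_p by simp
  qed
  ultimately show ?thesis by (metis even_zero of_int_eq_0_iff)
qed

text \<open>
  For even \<open>h\<close>, if \<open>Y h = 0\<close>, the product of \<open>1 - \<zeta>\<^sup>a\<close> over the residues \<open>a\<close> equals the one
  over the nonresidues, so it is rational; but its square is \<open>p\<close>.
\<close>

lemma Y_h_nonzero:
  assumes even_h: "even h"
  shows "Y h \<noteq> 0"
proof
  assume Y0: "Y h = 0"
  \<comment> \<open>The even powers of \<open>g\<close> are the quadratic residues, so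
    \<open>F g\<close> is the product over the nonresidues.\<close>
  define F where "F = (\<lambda>s. \<Prod>i<h. 1 - rt p (g ^ (2 * i) * s))"
  have F: "F \<in> cyclo p" unfolding F_def by (intro cyclo_prod cyclo_diff cyclo_1 cyclo_rt)
  have Fg: "F (g ^ m) = (\<Prod>i<h. 1 - rt p (g ^ (2 * i + m)))" for m
    by (simp add: F_def power_add)
  have step: "F (g ^ (m + 2)) = F (g ^ m)" for m
  proof -
    have per: "rt p (g ^ (2 * h + m)) = rt p (g ^ m)"
      unfolding rt_gp_conv[of "2 * h + m"] rt_gp_conv[of m] using gp_periodic[of m] by (simp add: add.commute)
    have "F (g ^ (m + 2)) * (1 - rt p (g ^ m)) = (\<Prod>i<Suc h. 1 - rt p (g ^ (2 * i + m)))"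
      unfolding Fg by (subst prod.lessThan_Suc_shift) (simp add: mult.commute)
    also have "\<dots> = F (g ^ m) * (1 - rt p (g ^ m))" unfolding Fg by (simp add: per)
    finally show ?thesis using one_minus_rt_nonzero[of m] by simp
  qed
  have ev: "F (g ^ (2 * m)) = F 1" for m
  proof (induction m)
    case (Suc m)
    then show ?case using step[of "2 * m"] by simp
  qed simp
  have od: "F (g ^ (2 * m + 1)) = F g" for m
  proof (induction m)
    case (Suc m)
    then show ?case using step[of "2 * m + 1"] by simp
  qed simp
  \<comment> \<open>Here \<open>even h\<close> enters: -1 is a residue, so complex conjugation only
    permutes the factors.\<close>
  have cnjF: "cnj (F (g ^ m)) = F (g ^ m)" for m
  proof -
    have "cnj (F (g ^ m)) = (\<Prod>i<h. 1 - rt p (g ^ (2 * i + m + h)))"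
      unfolding Fg rt_add_h_cnj by simp
    also have "\<dots> = F (g ^ (m + h))" unfolding Fg by (simp only: add.assoc)
    also have "F (g ^ (m + h)) = F (g ^ m)"
    proof -
      obtain c where c: "h = 2 * c" using even_h by blast
      have "F (g ^ (m + 2 * c)) = F (g ^ m)" for c
      proof (induction c)
        case (Suc c)
        then show ?case using step[of "m + 2 * c"] by simp
      qed simp
      then show ?thesis unfolding c .
    qed
    finally show ?thesis .
  qed
  have norm_eq: "ln (norm (F (g ^ m))) = (\<Sum>i<h. lam (2 * i + m))" for m
    unfolding Fg prod_norm[symmetric] lam_def using one_minus_rt_nonzero by (subst ln_prod) auto
  have nz: "F (g ^ m) \<noteq> 0" for m unfolding Fg using one_minus_rt_nonzero by simp
  have split: "(\<Sum>i<2 * n. f i) = (\<Sum>i<n. f (2 * i) + f (2 * i + 1))" for f :: "nat \<Rightarrow> real" and n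
    by (induction n) (simp_all add: add.assoc)
  have splitp: "(\<Prod>i<2 * n. f i) = (\<Prod>i<n. f (2 * i) * f (2 * i + 1))" for f :: "nat \<Rightarrow> complex" and n
    by (induction n) (simp_all add: mult.assoc)
  have w: "winv h i = of_real ((-1) ^ i)" for i
  proof -
    have "winv h i = rt (2 * h) (h * ((2 * h - 1) * i))"
      unfolding winv_def by (simp only: mult_ac)
    moreover have "even ((2 * h - 1) * i) = even i" using h_pos by simp
    ultimately show ?thesis unfolding rt_h by (simp add: minus_one_power_iff)
  qed
  have "of_real (\<Sum>i<h. (-1) ^ i * lam i) = Y h" unfolding Y_def w by simp
  then have "(\<Sum>i<h. (-1) ^ i * lam i) = 0" using Y0 by (simp only: of_real_eq_0_iff)
  then have "(\<Sum>i<2 * h. (-1) ^ i * lam i) = 0"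
    unfolding sum_two_halves using even_h by (simp only: lam_add_h power_add sum.distrib) simp
  then have "(\<Sum>i<h. lam (2 * i)) = (\<Sum>i<h. lam (2 * i + 1))"
    unfolding split by (simp add: sum_subtractf)
  then have "ln (norm (F (g ^ 0))) = ln (norm (F (g ^ 1)))" unfolding norm_eq by simp
  then have norms: "norm (F 1) = norm (F g)"
    using nz[of 0] nz[of 1] by simp
  obtain r where r: "F 1 = of_real r" using cnjF[of 0] by (metis complex_cnj_cancel_iff Reals_cnj_iff Reals_cases power_0)
  obtain r' where r': "F g = of_real r'" using cnjF[of 1] by (metis Reals_cnj_iff Reals_cases power_one_right)
  have prod: "F 1 * F g = of_nat p"
  proof -
    have "F 1 * F g = (\<Prod>i<h. (1 - rt p (g ^ (2 * i))) * (1 - rt p (g ^ (2 * i + 1))))"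
      using Fg[of 0] Fg[of 1] by (simp add: prod.distrib)
    then show ?thesis using prod_one_minus_rt by (simp only: splitp)
  qed
  then have rr: "r * r' = real p" unfolding r r' by (metis of_real_eq_iff of_real_mult of_real_of_nat_eq)
  have "\<bar>r\<bar> = \<bar>r'\<bar>" using norms unfolding r r' by simp
  moreover have "r * r' > 0" using rr p_gt_2 by simp
  ultimately have "r = r'" by (auto simp: abs_eq_iff zero_less_mult_iff)
  then have Fconst: "F (g ^ m) = of_real r" for m
  proof (cases "even m")
    case True
    then obtain c where "m = 2 * c" by blast
    then show ?thesis using ev r by simp
  next
    case False
    then obtain c where "m = 2 * c + 1" by (auto elim: oddE)
    then show ?thesis using od[of c] r' \<open>r = r'\<close> by simp
  qed
  \<comment> \<open>So far \<open>r\<close> is only real. \<open>F\<close> is constant on the units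
    and \<open>F 0 = 0\<close>, so summation over all residues makes \<open>r\<close>
    rational.\<close>
  have "(\<Sum>s<p. F s) = of_nat (2 * h) * of_real r"
  proof -
    have "{..<p} = insert 0 {1..<p}" using p_gt_2 by auto
    moreover have "F 0 = 0" using h_pos by (simp add: F_def)
    ultimately have "(\<Sum>s<p. F s) = (\<Sum>s\<in>{1..<p}. F s)" by simp
    also have "\<dots> = (\<Sum>i<2 * h. F (gp i))" by (rule sum.reindex_bij_betw[OF gp_bij, symmetric])
    also have "\<dots> = (\<Sum>i<2 * h. F (g ^ i))"
      using p_gt_2 by (intro sum.cong refl cyclo_cong[OF F]) (auto simp: gp_def cong_def)
    finally show ?thesis by (simp add: Fconst)
  qed
  then have "of_nat (2 * h) * of_real r \<in> (\<int> :: complex set)"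
    using cyclo_sum_residues[OF F] p_gt_2 by simp
  then obtain z :: int where z: "of_nat (2 * h) * of_real r = (of_int z :: complex)" by (rule Ints_cases)
  then have "of_real r = (of_int z / of_nat (2 * h) :: complex)"
    using h_pos by (simp add: field_simps)
  then have "F 1 \<in> \<rat>" unfolding r by (simp add: Rats_divide)
  then have "F 1 \<in> \<int>"
    using cyclo_ring_rational[OF cyclo_value_in_ring[OF F]] p_gt_2 by simp
  then obtain n :: int where "F 1 = of_int n" by (rule Ints_cases)
  then have "r = of_int n" unfolding r by (metis of_real_eq_iff of_real_of_int_eq)
  then have "real_of_int (n * n) = real_of_int (int p)" using rr \<open>r = r'\<close> by simp
  then have "n * n = int p" by (simp only: of_int_eq_iff)
  then have "int (nat \<bar>n\<bar> * nat \<bar>n\<bar>) = int p" by simp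
  then have "nat \<bar>n\<bar> * nat \<bar>n\<bar> = p" by (simp only: of_nat_eq_iff)
  then show False using prime_p prime_product[of "nat \<bar>n\<bar>" "nat \<bar>n\<bar>"] by auto
qed

theorem dirichlet_L_chi_nonzero:
  assumes "0 < j" "j < 2 * h"
  shows "dirichlet_L 1 (chi j) \<noteq> 0"
proof (cases "j = h")
  case False
  then show ?thesis using assms by (intro dirichlet_L_nonreal_nonzero)
next
  case True
  show ?thesis
  proof (cases "odd h")
    case odd: True
    then show ?thesis unfolding True
      using dirichlet_L_odd[OF odd] tau_nonzero[of h] B_h_nonzero h_pos p_gt_2 by simp
  next
    case False
    then show ?thesis unfolding True
      using dirichlet_L_even[of h] tau_nonzero[of h] Y_h_nonzero h_pos p_gt_2 by simp
  qed
qed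

end

section \<open>Odd characters\<close>

lemma common_denominator:
  fixes c :: "'i \<Rightarrow> rat"
  assumes "finite I"
  shows "\<exists>D :: int. D \<noteq> 0 \<and> (\<exists>d :: 'i \<Rightarrow> int. \<forall>i\<in>I. of_int D * c i = of_int (d i))"
  using assms
proof induction
  case empty
  then show ?case by (intro exI[of _ 1]) auto
next
  case (insert x I)
  then obtain D :: int and d :: "'i \<Rightarrow> int" where D: "D \<noteq> 0" "\<And>i. i \<in> I \<Longrightarrow> of_int D * c i = of_int (d i)"
    by blast
  obtain a b where ab: "quotient_of (c x) = (a, b)" by (cases "quotient_of (c x)")
  have b: "b > 0" "c x = of_int a / of_int b"
    using quotient_of_denom_pos[OF ab] quotient_of_div[OF ab] by auto
  define d' where "d' = (\<lambda>i. if i = x then D * a else b * d i)"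
  have "of_int (D * b) * c i = of_int (d' i)" if "i \<in> insert x I" for i
  proof (cases "i = x")
    case True
    then show ?thesis using b by (simp add: d'_def)
  next
    case False
    then have "of_int b * (of_int D * c i) = of_int b * (of_int (d i) :: rat)" using D(2) that by simp
    then show ?thesis using False by (simp add: d'_def mult_ac)
  qed
  moreover have "D * b \<noteq> 0" using D b by simp
  ultimately show ?case by blast
qed

context odd_prime_primroot
begin

text \<open>The argument \<open>s\<close> raises both kinds of roots of unity to the power
  \<open>s\<close>, while the integers \<open>gp i\<close> stay. At 1 this is the algebraic part of
  the L-value of an odd character.\<close>

definition G :: "nat \<Rightarrow> nat \<Rightarrow> complex" where
  "G j s = (\<Sum>i<2 * h. rt (2 * h) (j * i * s) * rt p ((p - 1) * g ^ i * s)) *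
           (\<Sum>i<2 * h. rt (2 * h) ((2 * h - 1) * j * i * s) * of_nat (gp i))"

lemma G_1: "G j 1 = tau j * B j"
  by (simp add: G_def tau_def B_def winv_def)

lemma G_cyclo:
  assumes "2 * h dvd N" "p dvd N" "N > 0"
  shows "G j \<in> cyclo N"
proof -
  have "(\<lambda>s. (\<Sum>i<2 * h. rt (2 * h) (j * i * s) * rt p ((p - 1) * g ^ i * s)) *
           (\<Sum>i<2 * h. rt (2 * h) ((2 * h - 1) * j * i * s) * of_nat (gp i))) \<in> cyclo N"
    by (intro cyclo_mult cyclo_sum cyclo_rt_dvd cyclo_of_nat assms)
  then show ?thesis unfolding G_def[abs_def] .
qed

text \<open>The Gauss sum is shifted by \<open>m\<close>; the second factor involves only roots of
  unity of order \<open>2 * h\<close> and is fixed.\<close>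

lemma G_conj_p:
  assumes "[s = 1] (mod 2 * h)" "[s = g ^ m] (mod p)"
  shows "G j s = winv j m * G j 1"
proof -
  have w: "rt (2 * h) (a * s) = rt (2 * h) a" for a
    using cong_scalar_left[OF assms(1), of a] h_pos by (intro rt_cong) auto
  have z: "rt p (a * s) = rt p (a * g ^ m)" for a
    using p_gt_2 by (intro rt_cong cong_scalar_left assms(2)) auto
  have "(\<Sum>i<2 * h. rt (2 * h) (j * i * s) * rt p ((p - 1) * g ^ i * s)) =
      (\<Sum>i<2 * h. winv j m * (rt (2 * h) (j * (i + m)) * rt p ((p - 1) * g ^ (i + m))))"
  proof (rule sum.cong[OF refl])
    fix i
    have "rt (2 * h) (j * i) = winv j m * rt (2 * h) (j * (i + m))"
      unfolding distrib_left[of j] rt_add using winv_mult[of j m] by (simp add: mult.left_commute)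
    then show "rt (2 * h) (j * i * s) * rt p ((p - 1) * g ^ i * s) =
       winv j m * (rt (2 * h) (j * (i + m)) * rt p ((p - 1) * g ^ (i + m)))"
      unfolding w z by (simp only: power_add mult.assoc)
  qed
  also have "\<dots> = winv j m * (\<Sum>i<2 * h. rt (2 * h) (j * (i + m)) * rt p ((p - 1) * g ^ (i + m)))"
    by (simp only: sum_distrib_left)
  also have "(\<Sum>i<2 * h. rt (2 * h) (j * (i + m)) * rt p ((p - 1) * g ^ (i + m))) = tau j"
    by (rule tau_shift)
  finally have "(\<Sum>i<2 * h. rt (2 * h) (j * i * s) * rt p ((p - 1) * g ^ i * s)) = winv j m * tau j" .
  moreover have "(\<Sum>i<2 * h. rt (2 * h) ((2 * h - 1) * j * i * s) * of_nat (gp i)) = B j"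
    unfolding w B_def winv_def ..
  ultimately have "G j s = winv j m * tau j * B j" by (simp only: G_def)
  then show ?thesis unfolding G_1 by (simp only: mult.assoc)
qed

text \<open>The complementary conjugation: it fixes the \<open>p\<close>-th roots of unity and turns
  \<open>chi j\<close> into its \<open>u\<close>-th power.\<close>

lemma G_conj_u:
  assumes "[s = 1] (mod p)" "[s = u] (mod 2 * h)"
  shows "G j s = G (j * u) 1"
proof -
  have w: "rt (2 * h) (a * s) = rt (2 * h) (a * u)" for a
    using h_pos by (intro rt_cong cong_scalar_left assms(2)) auto
  have z: "rt p (a * s) = rt p a" for a
    using cong_scalar_left[OF assms(1), of a] p_gt_2 by (intro rt_cong) auto
  show ?thesis unfolding G_def w z by (simp only: mult_1_right mult_1_left mult_ac)
qed

lemma G_cong: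
  assumes "[i = j] (mod 2 * h)"
  shows "G i 1 = G j 1"
proof -
  have "rt (2 * h) (i * a) = rt (2 * h) (j * a)" "rt (2 * h) ((2 * h - 1) * i * a) = rt (2 * h) ((2 * h - 1) * j * a)" for a
    using h_pos by (intro rt_cong cong_scalar_right cong_scalar_left assms; simp)+
  then show ?thesis unfolding G_def by (simp only: mult_1_right)
qed

lemma coprime_p_2h: "coprime p (2 * h)"
proof -
  have "coprime (2 * h + 1) (2 * h)"
    using coprime_Suc_left_nat[of "2 * h"] by (simp only: Suc_eq_plus1)
  then show ?thesis by (simp only: p_eq[symmetric])
qed

text \<open>The modulus \<open>M\<close> is left free because \<open>G_powers_differ\<close> has to
  fix more roots of unity than those of order \<open>2 * h\<close>.\<close>

lemma exists_conjugation:
  assumes "\<not> p dvd a" "coprime u M" "coprime p M"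
  shows "\<exists>s. [s = a] (mod p) \<and> [s = u] (mod M) \<and> coprime s p \<and> coprime s M"
proof -
  obtain s where s: "[s = a] (mod p)" "[s = u] (mod M)"
    using binary_chinese_remainder_nat[OF assms(3)] by blast
  have "coprime p a" using assms(1) prime_p by (simp add: prime_imp_coprime)
  then have "coprime a p" by (simp add: coprime_commute)
  then have "coprime s p" using cong_imp_coprime[OF cong_sym[OF s(1)]] by blast
  moreover have "coprime s M" using cong_imp_coprime[OF cong_sym[OF s(2)] assms(2)] .
  ultimately show ?thesis using s by blast
qed

lemma G_odd_nonzero:
  assumes "odd j" "j < 2 * h"
  shows "G j 1 \<noteq> 0"
proof -
  have "j > 0" using assms(1) by (cases j) auto
  then have "dirichlet_L 1 (chi j) \<noteq> 0" using assms(2) by (rule dirichlet_L_chi_nonzero)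
  then show ?thesis unfolding dirichlet_L_odd[OF assms] G_1 by auto
qed

text \<open>
  If the \<open>n\<close>-th powers agreed, then \<open>G l 1 = T * G (l + h) 1\<close> for a root of unity \<open>T\<close>.
  A conjugation that maps \<open>\<zeta>\<^sub>p\<close> to \<open>\<zeta>\<^sub>p\<^sup>g\<close> and fixes the roots of unity of order prime
  to \<open>p\<close> multiplies the quotient by \<open>-1\<close>, but it changes \<open>T\<close> only by a root of unity
  of odd order.
\<close>

lemma G_powers_differ:
  assumes n: "n > 0" and nz: "G (l + h) 1 \<noteq> 0"
  shows "G l 1 ^ n \<noteq> G (l + h) 1 ^ n"
proof
  assume eq: "G l 1 ^ n = G (l + h) 1 ^ n"
  define T where "T = G l 1 / G (l + h) 1"
  have Gl: "G l 1 = T * G (l + h) 1" using nz by (simp add: T_def)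
  have "T ^ n = 1" using eq nz by (simp add: T_def power_divide)
  then have "T \<in> (\<lambda>k. cis (2 * pi * real k / real n)) ` {..<n}"
    using bij_betw_imp_surj_on[OF Complex.bij_betw_roots_unity[OF n]] by (simp only:) simp
  then obtain t where t: "T = rt n t" by (auto simp: rt_def)
  have "n \<noteq> 0" "\<not> is_unit p" using n p_gt_2 by auto
  then obtain m where m: "n = p ^ multiplicity p n * m" "\<not> p dvd m"
    by (rule multiplicity_decompose')
  define e where "e = multiplicity p n"
  have ne: "n = m * p ^ e" using m(1) by (simp only: e_def mult.commute)
  have cop: "coprime p (2 * h * m)"
    using coprime_p_2h m(2) prime_p by (simp add: prime_imp_coprime)
  \<comment> \<open>\<open>s\<close> acts trivially on the part \<open>m\<close> of \<open>n\<close>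
    that is prime to \<open>p\<close>; it cannot be made to fix the part \<open>p ^ e\<close> as
    well, but that part is odd.\<close>
  obtain s where s: "[s = g] (mod p)" "[s = 1] (mod 2 * h * m)" "coprime s p" "coprime s (2 * h * m)"
    using exists_conjugation[of g 1 "2 * h * m"] g_power_not_dvd[of 1] cop by auto
  define N where "N = n * (p * (2 * h))"
  have N: "2 * h dvd N" "p dvd N" "n dvd N" "N > 0" using n p_gt_2 h_pos by (auto simp: N_def)
  have sN: "coprime s N" using s(3,4) by (simp add: N_def ne)
  have F: "(\<lambda>s. G l s - rt n (t * s) * G (l + h) s) \<in> cyclo N"
    by (intro cyclo_diff cyclo_mult cyclo_rt_dvd G_cyclo N)
  have "G l s - rt n (t * s) * G (l + h) s = 0"
    by (rule cyclo_conjugate_zero[OF F N(4) _ sN]) (simp only: mult_1_right Gl t diff_self)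
  moreover have s1: "[s = 1] (mod 2 * h)" using s(2) by (rule cong_modulus_mult_nat)
  moreover have sg: "[s = g ^ 1] (mod p)" using s(1) by simp
  ultimately have E: "winv l 1 * G l 1 = rt n (t * s) * (winv (l + h) 1 * G (l + h) 1)"
    by (simp only: G_conj_p eq_iff_diff_eq_0[symmetric])
  have W: "winv (l + h) 1 = - winv l 1"
  proof -
    have "(2 * h - 1) * (l + h) * 1 = (2 * h - 1) * l * 1 + h * (2 * h - 1)"
      unfolding mult_1_right distrib_left by (simp only: mult.commute)
    moreover have "odd (2 * h - 1)" using h_pos by simp
    ultimately show ?thesis unfolding winv_def by (simp only: rt_add rt_h) simp
  qed
  have "winv l 1 * G l 1 = winv l 1 * (- rt n (t * s) * G (l + h) 1)"
    unfolding E W by (simp only: mult_minus_left mult_minus_right mult.left_commute)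
  moreover have "winv l 1 \<noteq> 0" by (simp add: winv_def)
  ultimately have "G l 1 = - rt n (t * s) * G (l + h) 1" by (metis mult_left_cancel)
  then have "T * G (l + h) 1 = - (T ^ s) * G (l + h) 1" unfolding Gl t rt_power .
  then have T: "T = - (T ^ s)" using nz by (metis mult_right_cancel)
  have T0: "T \<noteq> 0" by (simp add: t)
  have "s > 0"
  proof (rule ccontr)
    assume "\<not> s > 0"
    then show False using s(3) p_gt_2 by simp
  qed
  then have "T ^ s = T * T ^ (s - 1)" by (cases s) auto
  then have T1: "T ^ (s - 1) = -1"
  proof -
    have "T * (T ^ (s - 1) + 1) = T ^ s + T"
      unfolding \<open>T ^ s = T * T ^ (s - 1)\<close> by (simp only: distrib_left mult_1_right)
    also have "\<dots> = 0" using T by (metis add.right_inverse add.commute)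
    finally have "T ^ (s - 1) + 1 = 0" using T0 by simp
    then show ?thesis by (simp only: eq_neg_iff_add_eq_0)
  qed
  \<comment> \<open>\<open>(s - 1) * p ^ e\<close> is a multiple of \<open>n\<close>, so
    \<open>T\<close> raised to it is 1, whereas \<open>T ^ (s - 1) = -1\<close> raised to the odd
    power \<open>p ^ e\<close> remains -1.\<close>
  have "2 * h * m dvd s - 1" using s(2) \<open>s > 0\<close>
    by (simp add: cong_iff_dvd_diff cong_altdef_nat)
  then obtain c where c: "s - 1 = 2 * h * m * c" by blast
  have "T ^ (n * (2 * h * c)) = 1" unfolding power_mult \<open>T ^ n = 1\<close> by simp
  moreover have "n * (2 * h * c) = (s - 1) * p ^ e" unfolding c ne by (simp only: mult_ac)
  ultimately have "(-1 :: complex) ^ (p ^ e) = 1" by (simp only: power_mult T1)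
  moreover have "odd (p ^ e)" using odd_p by simp
  ultimately show False by simp
qed

lemma G_powers_independent:
  fixes d :: "nat \<Rightarrow> int"
  assumes cond: "gcd k (p - 1) \<le> 2 \<or> ([p = 5] (mod 8) \<and> gcd k (p - 1) = 4)" and k: "k > 0"
    and rel: "(\<Sum>j | j < 2 * h \<and> odd j. of_int (d j) * G j 1 ^ k) = 0" and l: "l < 2 * h" "odd l"
  shows "d l = 0"
proof -
  define J where "J = {j. j < 2 * h \<and> odd j}"
  have finJ: "finite J" by (simp add: J_def)
  define N where "N = p * (2 * h)"
  have N: "2 * h dvd N" "p dvd N" "N > 0" using p_gt_2 h_pos by (auto simp: N_def)
  have step1: "(\<Sum>j\<in>J. of_int (d j) * (winv j m * G j 1) ^ k) = 0" for m
  proof -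
    obtain s where s: "[s = g ^ m] (mod p)" "[s = 1] (mod 2 * h)" "coprime s p" "coprime s (2 * h)"
      using exists_conjugation[OF g_power_not_dvd[of m] _ coprime_p_2h, of 1] by auto
    have F: "(\<lambda>s. \<Sum>j\<in>J. of_int (d j) * G j s ^ k) \<in> cyclo N"
      by (intro cyclo_sum cyclo_mult cyclo_int cyclo_power G_cyclo N)
    have sN: "coprime s N" unfolding N_def using s(3,4) by simp
    have "(\<Sum>j\<in>J. of_int (d j) * G j s ^ k) = 0"
      using cyclo_conjugate_zero[OF F N(3) _ sN] rel unfolding J_def by simp
    then show ?thesis unfolding G_conj_p[OF s(2,1)] .
  qed
  define S where "S = {j \<in> J. [j * k = l * k] (mod 2 * h)}"
  have step2: "(\<Sum>j\<in>S. of_int (d j) * G j 1 ^ k) = 0"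
  proof -
    \<comment> \<open>Weighting by the values of the \<open>k\<close>-th power of
      \<open>chi l\<close> and summing over \<open>m\<close> projects the relation to the characters
      with that \<open>k\<close>-th power.\<close>
    have "0 = (\<Sum>m<2 * h. rt (2 * h) (l * k * m) * (\<Sum>j\<in>J. of_int (d j) * (winv j m * G j 1) ^ k))"
      unfolding step1 by simp
    also have "\<dots> = (\<Sum>j\<in>J. of_int (d j) * G j 1 ^ k * (\<Sum>m<2 * h. rt (2 * h) (m * ((2 * h - 1) * (j * k) + l * k))))"
      unfolding sum_distrib_left
    proof (subst sum.swap, intro sum.cong refl)
      fix j m
      have "rt (2 * h) (m * ((2 * h - 1) * (j * k) + l * k)) = winv j m ^ k * rt (2 * h) (l * k * m)"
        unfolding winv_def rt_power rt_add[symmetric] by (simp only: distrib_left mult_ac)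
      then show "rt (2 * h) (l * k * m) * (of_int (d j) * (winv j m * G j 1) ^ k) =
         of_int (d j) * G j 1 ^ k * rt (2 * h) (m * ((2 * h - 1) * (j * k) + l * k))"
        by (simp only: power_mult_distrib mult_ac)
    qed
    also have "\<dots> = (\<Sum>j\<in>J. if [j * k = l * k] (mod 2 * h) then of_nat (2 * h) * (of_int (d j) * G j 1 ^ k) else 0)"
    proof (intro sum.cong refl)
      fix j
      have "2 * h dvd (2 * h - 1) * (j * k) + l * k \<longleftrightarrow>
          [(2 * h - 1) * (j * k) + l * k + j * k = 0 + j * k] (mod 2 * h)"
        by (simp only: cong_add_rcancel_nat cong_0_iff)
      also have "(2 * h - 1) * (j * k) + l * k + j * k = 2 * h * (j * k) + l * k"
        using h_pos by (cases h) (auto simp: algebra_simps)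
      also have "[2 * h * (j * k) + l * k = 0 + j * k] (mod 2 * h) \<longleftrightarrow> [j * k = l * k] (mod 2 * h)"
        by (auto simp: cong_def)
      finally show "of_int (d j) * G j 1 ^ k * (\<Sum>m<2 * h. rt (2 * h) (m * ((2 * h - 1) * (j * k) + l * k))) =
         (if [j * k = l * k] (mod 2 * h) then of_nat (2 * h) * (of_int (d j) * G j 1 ^ k) else 0)"
        using h_pos by (simp add: sum_rt)
    qed
    also have "\<dots> = (\<Sum>j\<in>S. of_nat (2 * h) * (of_int (d j) * G j 1 ^ k))"
      unfolding S_def using finJ by (intro sum.inter_filter[symmetric])
    also have "\<dots> = of_nat (2 * h) * (\<Sum>j\<in>S. of_int (d j) * G j 1 ^ k)"
      by (simp only: sum_distrib_left)
    finally show ?thesis using h_pos by simp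
  qed
  have lS: "l \<in> S" using l by (simp add: S_def J_def)
  have Gl: "G l 1 \<noteq> 0" using l by (intro G_odd_nonzero)
  have near: "[j = l] (mod h)" if "j \<in> S" for j
  proof -
    have oj: "odd j" and jk: "[j * k = l * k] (mod 2 * h)" using that by (auto simp: S_def J_def)
    define e where "e = gcd k (2 * h)"
    define x where "x = int j - int l"
    have "[int j * int k = int l * int k] (mod int (2 * h))"
      using jk unfolding cong_int_iff[symmetric] by simp
    then have "int (2 * h) dvd x * int k" unfolding x_def by (simp add: cong_iff_dvd_diff algebra_simps)
    \<comment> \<open>\<open>2 * h\<close> divides \<open>x * k\<close> and trivially
      \<open>x * (2 * h)\<close>, so \<open>k\<close> may be replaced by its gcd \<open>e\<close>
      with \<open>2 * h\<close>.\<close>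
    then have "int (2 * h) dvd gcd (x * int k) (x * int (2 * h))" by simp
    also have "gcd (x * int k) (x * int (2 * h)) = \<bar>x\<bar> * int e"
      unfolding e_def by (simp only: gcd_mult_distrib_int[symmetric] gcd_int_int_eq)
    finally have dv: "int (2 * h) dvd \<bar>x\<bar> * int e" .
    have evx: "even x" using oj l by (simp add: x_def)
    have "int h dvd x"
    proof -
      have "e > 0" using k by (simp add: e_def)
      have e': "e \<le> 2 \<or> ([p = 5] (mod 8) \<and> e = 4)" using cond unfolding e_def p_minus_1 .
      show ?thesis
      proof (cases "e \<le> 2")
        case True
        with \<open>e > 0\<close> consider "e = 1" | "e = 2" by linarith
        then show ?thesis
        proof cases
          case 1
          with dv have "int (2 * h) dvd x" by simp
          then show ?thesis by (metis dvd_mult_right of_nat_mult)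
        next
          case 2
          with dv have "2 * int h dvd 2 * \<bar>x\<bar>" by (simp add: mult.commute)
          then show ?thesis by simp
        qed
      next
        case False
        \<comment> \<open>Here \<open>h\<close> is twice an odd number \<open>h'\<close>. The gcd 4
          leaves only divisibility of \<open>x\<close> by \<open>h'\<close>, but \<open>x\<close> is
          even as a difference of odd exponents.\<close>
        with e' have e4: "e = 4" and p5: "[p = 5] (mod 8)" by auto
        from p5 have "p mod 8 = 5" by (simp add: cong_def)
        moreover have "x mod 4 = 2" if "y = 2 * x + 1" "y mod 8 = 5" for x y :: nat
          using that by presburger
        ultimately have "h mod 4 = 2" using p_eq by blast
        moreover have "\<exists>z. x = 2 * z \<and> odd z" if "x mod 4 = 2" for x :: nat
          using that by presburger
        ultimately obtain h' where h': "h = 2 * h'" "odd h'" by blast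
        from dv have "4 * int h' dvd 4 * \<bar>x\<bar>" unfolding e4 h'(1) by (simp add: mult.commute)
        then have "int h' dvd x" by simp
        moreover have "2 dvd x" using evx .
        moreover have "coprime 2 (int h')" using h'(2) by simp
        ultimately have "2 * int h' dvd x" by (simp only: divides_mult)
        then show ?thesis unfolding h'(1) by simp
      qed
    qed
    then show ?thesis unfolding x_def by (simp flip: cong_iff_dvd_diff cong_int_iff)
  qed
  \<comment> \<open>The exponent of \<open>chi l\<close> times the quadratic character, reduced
    below \<open>2 * h\<close>.\<close>
  define l' where "l' = (if l < h then l + h else l - h)"
  have l': "l' < 2 * h" "l' \<noteq> l" "[l' = l + h] (mod 2 * h)"
    using l h_pos by (auto simp: l'_def cong_def mod_if)
  have sub: "S \<subseteq> {l, l'}"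
  proof
    fix j assume j: "j \<in> S"
    then have "j < 2 * h" by (simp add: S_def J_def)
    moreover have "j mod h = l mod h" using near[OF j] by (simp add: cong_def)
    ultimately show "j \<in> {l, l'}" using l by (auto simp: l'_def mod_if not_less split: if_splits)
  qed
  show ?thesis
  proof (cases "l' \<in> S")
    case False
    then have "S = {l}" using sub lS by blast
    then show ?thesis using step2 Gl by simp
  next
    case True
    then have S: "S = {l, l'}" using sub lS by blast
    have ol': "odd l'" using True by (simp add: S_def J_def)
    have Gl': "G l' 1 \<noteq> 0" using l' ol' by (intro G_odd_nonzero)
    \<comment> \<open>\<open>l\<close> and \<open>l'\<close> are odd and differ by \<open>h\<close>.
      For even \<open>h\<close>, multiplication by the unit \<open>1 + h\<close> adds
      \<open>h\<close> to an odd exponent, so it exchanges the two.\<close>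
    have even_h: "even h" using ol' l by (auto simp: l'_def split: if_splits)
    have rel1: "of_int (d l) * G l 1 ^ k + of_int (d l') * G l' 1 ^ k = 0"
      using step2 l'(2) unfolding S by simp
    have cu: "coprime (1 + h) (2 * h)" using even_h by simp
    obtain s where s: "[s = 1] (mod p)" "[s = 1 + h] (mod 2 * h)" "coprime s p" "coprime s (2 * h)"
      using exists_conjugation[OF _ cu coprime_p_2h, of 1] p_gt_2 by auto
    have sN: "coprime s N" unfolding N_def using s(3,4) by simp
    have F: "(\<lambda>s. of_int (d l) * G l s ^ k + of_int (d l') * G l' s ^ k) \<in> cyclo N"
      by (intro cyclo_add cyclo_mult cyclo_int cyclo_power G_cyclo N)
    have "of_int (d l) * G l s ^ k + of_int (d l') * G l' s ^ k = 0"
      by (rule cyclo_conjugate_zero[OF F N(3) rel1 sN])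
    then have "of_int (d l) * G (l * (1 + h)) 1 ^ k + of_int (d l') * G (l' * (1 + h)) 1 ^ k = 0"
      unfolding G_conj_u[OF s(1,2)] .
    moreover have mul: "[i * (1 + h) = i + h] (mod 2 * h)" if "odd i" for i
    proof -
      from that obtain c where c: "i = 2 * c + 1" by (rule oddE)
      have "i * (1 + h) = i + h + 2 * h * c" by (simp add: c algebra_simps)
      then show ?thesis unfolding cong_def by (simp only: mod_mult_self2)
    qed
    moreover have "G (l * (1 + h)) 1 = G l' 1"
      by (rule G_cong, rule cong_trans[OF mul[OF l(2)] cong_sym[OF l'(3)]])
    moreover have "G (l' * (1 + h)) 1 = G l 1"
    proof (rule G_cong, rule cong_trans[OF mul[OF ol']])
      have "[l' + h = l + h + h] (mod 2 * h)" by (rule cong_add[OF l'(3) cong_refl])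
      also have "l + h + h = l + 2 * h" by simp
      finally show "[l' + h = l] (mod 2 * h)" by (simp add: cong_def)
    qed
    ultimately have rel2: "of_int (d l) * G l' 1 ^ k + of_int (d l') * G l 1 ^ k = 0" by simp
    \<comment> \<open>For the unknowns \<open>a\<close> and \<open>b\<close> the system is symmetric
      with determinant \<open>x ^ 2 - y ^ 2\<close>, a difference of \<open>2 * k\<close>-th
      powers.\<close>
    define x y a b where "x = G l 1 ^ k" and "y = G l' 1 ^ k" and "a = (of_int (d l) :: complex)" and "b = (of_int (d l') :: complex)"
    have r: "a * x + b * y = 0" "a * y + b * x = 0" using rel1 rel2 by (simp_all add: x_def y_def a_def b_def)
    have "a * (x\<^sup>2 - y\<^sup>2) = x * (a * x + b * y) - y * (a * y + b * x)"
      by (simp add: algebra_simps power2_eq_square)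
    then have ax: "a * (x\<^sup>2 - y\<^sup>2) = 0" using r by simp
    have "x\<^sup>2 \<noteq> y\<^sup>2"
    proof -
      have eqG: "G (l + h) 1 = G l' 1" by (rule G_cong[OF cong_sym[OF l'(3)]])
      have "G l 1 ^ (k * 2) \<noteq> G (l + h) 1 ^ (k * 2)"
        by (rule G_powers_differ) (simp add: k, use Gl' in \<open>simp only: eqG not_False_eq_True\<close>)
      then show ?thesis unfolding x_def y_def eqG power_mult .
    qed
    then have "a = 0" using ax by simp
    then show ?thesis by (simp add: a_def)
  qed
qed

text \<open>All L-values of odd characters share the factor \<open>v\<close>, so after denominators
  are cleared only the \<open>G j 1\<close> remain.\<close>

theorem odd_powers_independent:
  fixes c :: "nat \<Rightarrow> rat"
  assumes cond: "gcd k (p - 1) \<le> 2 \<or> ([p = 5] (mod 8) \<and> gcd k (p - 1) = 4)" and k: "k > 0"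
    and rel: "(\<Sum>j | j < 2 * h \<and> odd j. of_rat (c j) * dirichlet_L 1 (chi j) ^ k) = 0"
    and l: "l < 2 * h" "odd l"
  shows "c l = 0"
proof -
  define J where "J = {j. j < 2 * h \<and> odd j}"
  have "finite J" by (simp add: J_def)
  then obtain D :: int and d where D: "D \<noteq> 0" "\<And>j. j \<in> J \<Longrightarrow> of_int D * c j = of_int (d j)"
    using common_denominator[of J c] by blast
  define v where "v = - (\<i> * of_real pi) / (of_nat p)\<^sup>2"
  define u where "u = v ^ k"
  have u: "u \<noteq> 0" using p_gt_2 by (simp add: u_def v_def)
  have "of_int D * (of_rat (c j) * dirichlet_L 1 (chi j) ^ k) = u * (of_int (d j) * G j 1 ^ k)" if "j \<in> J" for j
  proof -
    have "(of_rat (of_int D * c j) :: complex) = of_int (d j)" using D(2)[OF that] by simp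
    then have E: "of_int D * of_rat (c j) = (of_int (d j) :: complex)" by (simp add: of_rat_mult)
    have L: "dirichlet_L 1 (chi j) = v * G j 1"
      unfolding G_1 v_def using that dirichlet_L_odd[of j] by (simp add: J_def)
    have "of_int D * (of_rat (c j) * dirichlet_L 1 (chi j) ^ k) = (of_int D * of_rat (c j)) * (v ^ k * G j 1 ^ k)"
      unfolding L by (simp only: power_mult_distrib mult.assoc)
    also have "\<dots> = u * (of_int (d j) * G j 1 ^ k)" unfolding E u_def by (simp only: mult.left_commute)
    finally show ?thesis .
  qed
  then have "u * (\<Sum>j\<in>J. of_int (d j) * G j 1 ^ k) = of_int D * (\<Sum>j\<in>J. of_rat (c j) * dirichlet_L 1 (chi j) ^ k)"
    unfolding sum_distrib_left by simp
  also have "\<dots> = 0" using rel by (simp add: J_def)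
  finally have "(\<Sum>j\<in>J. of_int (d j) * G j 1 ^ k) = 0" using u by simp
  then have "d l = 0" unfolding J_def using l by (intro G_powers_independent[OF cond k])
  then show ?thesis using D(1) D(2)[of l] l by (simp add: J_def)
qed

end

section \<open>A bound for the transcendence degree\<close>

text \<open>
  The field generated over \<open>\<rat>(\<zeta>\<^sub>N)\<close> by \<open>t\<close> and the \<open>x j\<close>, where \<open>t\<close> is tied to the \<open>x j\<close> by
  a Fermat type relation. Homogeneity of the relation keeps the total degree
  under reduction of the powers of \<open>t\<close>, so that monomials can be counted.
\<close>

locale fermat_relation =
  fixes N k :: nat and J :: "nat set" and x :: "nat \<Rightarrow> complex" and t :: complex
    and q :: "nat \<Rightarrow> nat \<Rightarrow> rat"
  assumes N: "N > 0" and k: "k > 0" and finJ: "finite J"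
    and relation: "t ^ k = (\<Sum>j\<in>J. (\<Sum>i<N. of_rat (q j i) * rt N i) * x j ^ k)"
begin

definition mon :: "nat \<Rightarrow> nat \<Rightarrow> (nat \<Rightarrow> nat) \<Rightarrow> complex" where
  "mon i a m = rt N i * t ^ a * (\<Prod>j\<in>J. x j ^ m j)"

text \<open>A filtration by total degree in \<open>t\<close> and the \<open>x j\<close>; roots of
  unity have degree 0.\<close>

definition U :: "nat \<Rightarrow> complex set" where
  "U D = rat_complex.span {mon i a m | i a m. a + sum m J \<le> D}"

lemma mon_mult: "mon i a m * mon i' a' m' = mon (i + i') (a + a') (\<lambda>j. m j + m' j)"
  by (simp add: mon_def rt_add power_add prod.distrib mult_ac)

lemma mon_in_U: "a + sum m J \<le> D \<Longrightarrow> mon i a m \<in> U D"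
  unfolding U_def by (rule rat_complex.span_base) blast

lemma U_mono: "D \<le> D' \<Longrightarrow> U D \<subseteq> U D'"
  unfolding U_def by (intro rat_complex.span_mono) (auto intro: order_trans)

lemma U_add: "u \<in> U D \<Longrightarrow> v \<in> U D \<Longrightarrow> u + v \<in> U D"
  unfolding U_def by (rule rat_complex.span_add)

lemma U_minus: "u \<in> U D \<Longrightarrow> - u \<in> U D"
  unfolding U_def by (rule rat_complex.span_neg)

lemma subspace_preimage_mult: "rat_complex.subspace W \<Longrightarrow> rat_complex.subspace {u. u * b \<in> W}"
  unfolding rat_complex.subspace_def by (auto simp: distrib_right mult.assoc)

lemma U_mult:
  assumes "u \<in> U D" "v \<in> U D'"
  shows "u * v \<in> U (D + D')"
proof -
  have sub: "rat_complex.subspace (U (D + D'))" unfolding U_def by (rule rat_complex.subspace_span)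
  have "u * mon i' a' m' \<in> U (D + D')" if "a' + sum m' J \<le> D'" for i' a' m'
  proof -
    have "U D \<subseteq> {u. u * mon i' a' m' \<in> U (D + D')}"
      unfolding U_def[of D]
    proof (rule rat_complex.span_minimal)
      show "rat_complex.subspace {u. u * mon i' a' m' \<in> U (D + D')}"
        by (rule subspace_preimage_mult[OF sub])
      show "{mon i a m | i a m. a + sum m J \<le> D} \<subseteq> {u. u * mon i' a' m' \<in> U (D + D')}"
      proof clarify
        fix i a m assume "a + sum m J \<le> D"
        then show "mon i a m * mon i' a' m' \<in> U (D + D')"
          unfolding mon_mult using that by (intro mon_in_U) (simp add: sum.distrib)
      qed
    qed
    then show ?thesis using assms(1) by blast
  qed
  then have "U D' \<subseteq> {v. v * u \<in> U (D + D')}"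
    unfolding U_def[of D']
    by (intro rat_complex.span_minimal subspace_preimage_mult[OF sub]) (auto simp: mult.commute)
  then show ?thesis using assms(2) by (auto simp: mult.commute)
qed

lemma one_in_U: "1 \<in> U D"
  using mon_in_U[of 0 "\<lambda>_. 0" D 0] by (simp add: mon_def)

lemma U_power: "u \<in> U D \<Longrightarrow> u ^ n \<in> U (n * D)"
  by (induction n) (auto simp: one_in_U intro: U_mult)

lemma U_prod: "finite S \<Longrightarrow> (\<And>s. s \<in> S \<Longrightarrow> f s \<in> U D) \<Longrightarrow> (\<Prod>s\<in>S. f s) \<in> U (card S * D)"
  by (induction S rule: finite_induct) (auto simp: one_in_U intro: U_mult)

text \<open>The exponent of \<open>t\<close> stays below \<open>k\<close>, so the number of these
  monomials grows only like \<open>D ^ card J\<close>. Bounding each exponent of the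
  \<open>x j\<close> separately is coarser than the total degree but easy to count.\<close>

definition red :: "nat \<Rightarrow> complex set" where
  "red D = (\<lambda>(i, a, m). mon i a m) ` ({..<N} \<times> {..<k} \<times> (J \<rightarrow>\<^sub>E {..D}))"

lemma finite_red: "finite (red D)"
  unfolding red_def using finJ by (intro finite_imageI finite_cartesian_product finite_PiE) auto

lemma card_red: "card (red D) \<le> N * k * (D + 1) ^ card J"
proof -
  have "card (red D) \<le> card ({..<N} \<times> {..<k} \<times> (J \<rightarrow>\<^sub>E {..D}))"
    unfolding red_def using finJ by (intro card_image_le finite_cartesian_product finite_PiE) auto
  then show ?thesis using finJ by (simp add: card_cartesian_product card_PiE mult.assoc)
qed

text \<open>The relation trades \<open>t ^ k\<close> for \<open>k\<close>-th powers of the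
  \<open>x j\<close>: the exponent of \<open>t\<close> falls and the total degree is kept, so no
  exponent of an \<open>x j\<close> can exceed \<open>D\<close>.\<close>

lemma mon_in_span_red:
  assumes "a + sum m J \<le> D"
  shows "mon i a m \<in> rat_complex.span (red D)"
  using assms
proof (induction a arbitrary: i m rule: less_induct)
  case (less a)
  show ?case
  proof (cases "a < k")
    case True
    define m' where "m' = restrict m J"
    have "m j \<le> D" if "j \<in> J" for j
      using member_le_sum[OF that, of m] finJ less.prems by simp
    then have "(i mod N, a, m') \<in> {..<N} \<times> {..<k} \<times> (J \<rightarrow>\<^sub>E {..D})"
      using N True by (auto simp: m'_def)
    then have "(\<lambda>(i, a, m). mon i a m) (i mod N, a, m') \<in> red D"
      unfolding red_def by (rule imageI)
    moreover have "mon (i mod N) a m' = mon i a m"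
      by (simp add: mon_def rt_mod[OF N] m'_def)
    ultimately show ?thesis by (simp add: rat_complex.span_base)
  next
    case False
    define up where "up = (\<lambda>j l. if l = j then m l + k else m l)"
    have produp: "x j ^ k * (\<Prod>l\<in>J. x l ^ m l) = (\<Prod>l\<in>J. x l ^ up j l)" if "j \<in> J" for j
    proof -
      have "(\<Prod>l\<in>J. x l ^ up j l) = (\<Prod>l\<in>J. (if l = j then x l ^ k else 1) * x l ^ m l)"
        by (intro prod.cong) (auto simp: up_def power_add)
      also have "\<dots> = x j ^ k * (\<Prod>l\<in>J. x l ^ m l)"
        using that finJ by (simp add: prod.distrib)
      finally show ?thesis by simp
    qed
    have "t ^ a = t ^ (a - k) * t ^ k" using False by (simp flip: power_add)
    then have "mon i a m = (\<Sum>j\<in>J. \<Sum>l<N. of_rat (q j l) * (rt N (i + l) * t ^ (a - k) * (x j ^ k * (\<Prod>l\<in>J. x l ^ m l))))"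
      unfolding mon_def relation by (simp add: rt_add sum_distrib_left sum_distrib_right mult_ac)
    also have "\<dots> = (\<Sum>j\<in>J. \<Sum>l<N. of_rat (q j l) * mon (i + l) (a - k) (up j))"
      by (intro sum.cong refl) (simp add: produp mon_def)
    also have "\<dots> \<in> rat_complex.span (red D)"
    proof (intro rat_complex.span_sum rat_complex.span_scale less.IH)
      fix j assume j: "j \<in> J"
      show "a - k < a" using False k by simp
      have "sum (up j) J = (\<Sum>l\<in>J. m l + (if l = j then k else 0))"
        by (intro sum.cong) (auto simp: up_def)
      also have "\<dots> = sum m J + k" using j finJ by (simp add: sum.distrib)
      finally show "a - k + sum (up j) J \<le> D" using less.prems False by simp
    qed
    finally show ?thesis .
  qed
qed

lemma U_subset_span_red: "U D \<subseteq> rat_complex.span (red D)"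
  unfolding U_def
  by (rule rat_complex.span_minimal) (auto intro: mon_in_span_red)

definition frac_field :: "complex set" where
  "frac_field = {a / b | a b. b \<noteq> 0 \<and> (\<exists>D. a \<in> U D \<and> b \<in> U D)}"

lemma frac_fieldI:
  assumes "a \<in> U D" "b \<in> U D'" "b \<noteq> 0"
  shows "a / b \<in> frac_field"
proof -
  have "a \<in> U (max D D')" "b \<in> U (max D D')"
    using assms U_mono[of D "max D D'"] U_mono[of D' "max D D'"] by auto
  then show ?thesis unfolding frac_field_def using assms(3) by blast
qed

lemma U_in_frac_field: "u \<in> U D \<Longrightarrow> u \<in> frac_field"
  using frac_fieldI[OF _ one_in_U, of u D] by simp

lemma frac_field_subfield: "complex_subfield frac_field"
  unfolding complex_subfield_def
proof (intro conjI ballI)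
  have "0 \<in> U 0" unfolding U_def by (rule rat_complex.span_zero)
  then show "0 \<in> frac_field" by (rule U_in_frac_field)
  show "1 \<in> frac_field" by (rule U_in_frac_field[OF one_in_U])
next
  fix u v assume "u \<in> frac_field" "v \<in> frac_field"
  then obtain a b D c d E where u: "u = a / b" "b \<noteq> 0" "a \<in> U D" "b \<in> U D"
    and v: "v = c / d" "d \<noteq> 0" "c \<in> U E" "d \<in> U E" unfolding frac_field_def by blast
  have bd: "b * d \<in> U (D + E)" "b * d \<noteq> 0" using u v by (auto intro: U_mult)
  have "a * d + b * c \<in> U (D + E)" using u v by (intro U_add U_mult)
  from frac_fieldI[OF this bd] show "u + v \<in> frac_field"
    using u(2) v(2) by (simp add: u(1) v(1) add_frac_eq mult.commute)
  have "a * c \<in> U (D + E)" using u v by (intro U_mult)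
  from frac_fieldI[OF this bd] show "u * v \<in> frac_field" by (simp add: u(1) v(1))
next
  fix u assume "u \<in> frac_field"
  then obtain a b D where u: "u = a / b" "b \<noteq> 0" "a \<in> U D" "b \<in> U D" unfolding frac_field_def by blast
  show "- u \<in> frac_field" using frac_fieldI[OF U_minus[OF u(3)] u(4,2)] by (simp add: u(1))
  show "inverse u \<in> frac_field"
  proof (cases "a = 0")
    case True
    have "0 \<in> U 0" unfolding U_def by (rule rat_complex.span_zero)
    then show ?thesis using True u(1) by (simp add: U_in_frac_field)
  next
    case False
    then show ?thesis using frac_fieldI[OF u(4,3)] by (simp add: u(1))
  qed
qed

lemma frac_field_add: "u \<in> frac_field \<Longrightarrow> v \<in> frac_field \<Longrightarrow> u + v \<in> frac_field"
  and frac_field_mult: "u \<in> frac_field \<Longrightarrow> v \<in> frac_field \<Longrightarrow> u * v \<in> frac_field"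
  and frac_field_minus: "u \<in> frac_field \<Longrightarrow> - u \<in> frac_field"
  and frac_field_inverse: "u \<in> frac_field \<Longrightarrow> inverse u \<in> frac_field"
  and frac_field_0: "0 \<in> frac_field" and frac_field_1: "1 \<in> frac_field"
  using frac_field_subfield unfolding complex_subfield_def by blast+

lemma frac_field_divide: "u \<in> frac_field \<Longrightarrow> v \<in> frac_field \<Longrightarrow> u / v \<in> frac_field"
  unfolding divide_inverse by (intro frac_field_mult frac_field_inverse)

lemma frac_field_sum: "(\<And>i. i \<in> I \<Longrightarrow> f i \<in> frac_field) \<Longrightarrow> (\<Sum>i\<in>I. f i) \<in> frac_field"
  by (induction I rule: infinite_finite_induct) (auto intro: frac_field_add frac_field_0)

lemma frac_field_of_nat: "of_nat n \<in> frac_field"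
  by (induction n) (auto intro: frac_field_add frac_field_0 frac_field_1)

lemma frac_field_rt: "rt N i \<in> frac_field"
  using U_in_frac_field[OF mon_in_U[of 0 "\<lambda>_. 0" 0 i]] by (simp add: mon_def)

lemma frac_field_t: "t \<in> frac_field"
  using U_in_frac_field[OF mon_in_U[of 1 "\<lambda>_. 0" 1 0]] by (simp add: mon_def)

lemma frac_field_x:
  assumes "j \<in> J"
  shows "x j \<in> frac_field"
proof -
  have "mon 0 0 (\<lambda>l. if l = j then 1 else 0) = (\<Prod>l\<in>J. if l = j then x l else 1)"
    unfolding mon_def by (simp add: if_distrib[of "\<lambda>e. _ ^ e"] cong: if_cong)
  also have "\<dots> = x j" using assms finJ by simp
  finally have "mon 0 0 (\<lambda>l. if l = j then 1 else 0) = x j" .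
  moreover have "0 + sum (\<lambda>l. if l = j then 1 else 0) J \<le> (1 :: nat)"
    using assms finJ by simp
  ultimately show ?thesis using U_in_frac_field[OF mon_in_U] by metis
qed

text \<open>The denominator is kept in the same \<open>U e\<close> as the numerators, so that its
  powers can later pad products to a uniform degree.\<close>

lemma common_denominator_U:
  assumes "finite S" "S \<subseteq> frac_field"
  shows "\<exists>e b. b \<noteq> 0 \<and> b \<in> U e \<and> (\<forall>s\<in>S. s * b \<in> U e)"
  using assms
proof induction
  case empty
  show ?case using one_in_U[of 0] by (intro exI[of _ 0] exI[of _ 1]) auto
next
  case (insert s S)
  then obtain e b where b: "b \<noteq> 0" "b \<in> U e" "\<And>s. s \<in> S \<Longrightarrow> s * b \<in> U e" by blast
  obtain c d D where s: "s = c / d" "d \<noteq> 0" "c \<in> U D" "d \<in> U D"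
    using insert.prems unfolding frac_field_def by blast
  have "s' * (b * d) \<in> U (e + D)" if "s' \<in> insert s S" for s'
  proof (cases "s' = s")
    case True
    then have eq: "s' * (b * d) = b * c" using s by simp
    show ?thesis unfolding eq by (rule U_mult[OF b(2) s(3)])
  next
    case False
    then have "s' * b \<in> U e" using that b(3) by blast
    from U_mult[OF this s(4)] show ?thesis by (simp add: mult.assoc)
  qed
  moreover have "b * d \<in> U (e + D)" "b * d \<noteq> 0" using U_mult[OF b(2) s(4)] b s by auto
  ultimately show ?case by blast
qed

end

lemma finite_nonzero_if:
  assumes "finite A"
  shows "finite {s. (if s \<in> A then f s else 0) \<noteq> 0}"
proof (rule finite_subset[OF _ assms], rule subsetI)
  fix s assume "s \<in> {s. (if s \<in> A then f s else 0) \<noteq> 0}"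
  then show "s \<in> A" by (cases "s \<in> A") auto
qed

text \<open>The passage from polynomials in named variables to the linear algebra on which the
  dimension count rests.\<close>

lemma alg_indep_monomials:
  assumes fin: "finite S" and ind: "alg_indep_over_rat S"
  shows "lin_indep_over_rat (\<lambda>m. \<Prod>s\<in>S. s ^ m s) (S \<rightarrow>\<^sub>E {..D})"
proof -
  let ?E = "S \<rightarrow>\<^sub>E {..D::nat}" and ?M = "\<lambda>m. \<Prod>s\<in>S. s ^ m s"
  have finE: "finite ?E" using fin by (intro finite_PiE) auto
  define \<mu> :: "(complex \<Rightarrow> nat) \<Rightarrow> (complex \<Rightarrow>\<^sub>0 nat)" where
    "\<mu> m = Abs_poly_mapping (\<lambda>s. if s \<in> S then m s else 0)" for m
  have lookup\<mu>: "Poly_Mapping.lookup (\<mu> m) s = (if s \<in> S then m s else 0)" for m s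
    unfolding \<mu>_def by (subst lookup_Abs_poly_mapping[OF finite_nonzero_if[OF fin]]) (rule refl)
  have keys\<mu>: "Poly_Mapping.keys (\<mu> m) \<subseteq> S" for m
    by (rule subsetI) (simp add: in_keys_iff lookup\<mu> split: if_splits)
  have inj\<mu>: "inj_on \<mu> ?E"
  proof (rule inj_onI)
    fix m m' assume m: "m \<in> ?E" "m' \<in> ?E" "\<mu> m = \<mu> m'"
    have "m s = m' s" if "s \<in> S" for s
      using lookup\<mu>[of m s] lookup\<mu>[of m' s] m(3) that by simp
    then show "m = m'" using m(1,2) by (intro PiE_ext)
  qed
  have ev\<mu>: "(\<Prod>s\<in>Poly_Mapping.keys (\<mu> m). s ^ Poly_Mapping.lookup (\<mu> m) s) = ?M m" for m
  proof -
    have "(\<Prod>s\<in>Poly_Mapping.keys (\<mu> m). s ^ Poly_Mapping.lookup (\<mu> m) s) = (\<Prod>s\<in>S. s ^ Poly_Mapping.lookup (\<mu> m) s)"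
      using fin keys\<mu>[of m] by (intro prod.mono_neutral_left) (auto simp: in_keys_iff)
    then show ?thesis by (simp add: lookup\<mu>)
  qed
  have "\<forall>m\<in>?E. c m = 0" if rel: "(\<Sum>m\<in>?E. of_rat (c m) * ?M m) = 0" for c :: "(complex \<Rightarrow> nat) \<Rightarrow> rat"
  proof -
    define P :: "(complex \<Rightarrow>\<^sub>0 nat) \<Rightarrow>\<^sub>0 rat" where
      "P = Abs_poly_mapping (\<lambda>\<nu>. if \<nu> \<in> \<mu> ` ?E then c (the_inv_into ?E \<mu> \<nu>) else 0)"
    have lookupP: "Poly_Mapping.lookup P \<nu> = (if \<nu> \<in> \<mu> ` ?E then c (the_inv_into ?E \<mu> \<nu>) else 0)" for \<nu>
      unfolding P_def by (subst lookup_Abs_poly_mapping[OF finite_nonzero_if[OF finite_imageI[OF finE]]]) (rule refl)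
    have lookupP\<mu>: "Poly_Mapping.lookup P (\<mu> m) = c m" if "m \<in> ?E" for m
      using that by (simp add: lookupP the_inv_into_f_f[OF inj\<mu>])
    have keysP: "Poly_Mapping.keys P \<subseteq> \<mu> ` ?E"
      by (rule subsetI) (simp add: in_keys_iff lookupP split: if_splits)
    have "eval_at_names P = (\<Sum>\<nu>\<in>\<mu> ` ?E. of_rat (Poly_Mapping.lookup P \<nu>) *
        (\<Prod>s\<in>Poly_Mapping.keys \<nu>. s ^ Poly_Mapping.lookup \<nu> s))"
      unfolding eval_at_names_def using finE keysP
      by (intro sum.mono_neutral_left finite_imageI) (auto simp: in_keys_iff)
    also have "\<dots> = (\<Sum>m\<in>?E. of_rat (c m) * ?M m)"
      by (subst sum.reindex[OF inj\<mu>]) (simp add: ev\<mu> lookupP\<mu>)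
    finally have "eval_at_names P = 0" using rel by simp
    moreover have "\<forall>\<nu>\<in>Poly_Mapping.keys P. Poly_Mapping.keys \<nu> \<subseteq> S"
      using keysP keys\<mu> by blast
    ultimately have "P = 0" using ind unfolding alg_indep_over_rat_def by blast
    then show ?thesis using lookupP\<mu> by (metis lookup_zero)
  qed
  then show ?thesis unfolding lin_indep_over_rat_finite[OF finE] by blast
qed

context fermat_relation
begin

text \<open>Exponents up to \<open>D\<close> give \<open>(D + 1) ^ card S\<close> independent
  monomials. After denominators are cleared they lie in a space whose dimension is of order
  \<open>D ^ card J\<close>, too small for large \<open>D\<close> if \<open>S\<close> is larger than
  \<open>J\<close>.\<close>

lemma alg_indep_card_le:
  assumes fin: "finite S" and sub: "S \<subseteq> frac_field" and ind: "alg_indep_over_rat S"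
  shows "card S \<le> card J"
proof (rule ccontr)
  assume "\<not> card S \<le> card J"
  then have less: "card J < card S" by simp
  obtain e b where b: "b \<noteq> 0" "b \<in> U e" "\<And>s. s \<in> S \<Longrightarrow> s * b \<in> U e"
    using common_denominator_U[OF fin sub] by blast
  define n where "n = card S"
  have main: "(D + 1) ^ n \<le> N * k * (n * (D * e) + 1) ^ card J" for D
  proof -
    let ?E = "S \<rightarrow>\<^sub>E {..D}"
    \<comment> \<open>Each \<open>s\<close> receives \<open>D\<close> copies of \<open>b\<close>:
      \<open>m s\<close> of them clear its denominators, the others pad the degree.\<close>
    define M where "M = (\<lambda>m. b ^ (D * n) * (\<Prod>s\<in>S. s ^ m s))"
    have finE: "finite ?E" using fin by (intro finite_PiE) auto
    have "lin_indep_over_rat M ?E"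
      unfolding lin_indep_over_rat_finite[OF finE]
    proof (intro allI impI)
      fix c :: "(complex \<Rightarrow> nat) \<Rightarrow> rat" assume "(\<Sum>m\<in>?E. of_rat (c m) * M m) = 0"
      then have "b ^ (D * n) * (\<Sum>m\<in>?E. of_rat (c m) * (\<Prod>s\<in>S. s ^ m s)) = 0"
        unfolding M_def sum_distrib_left by (simp only: mult.left_commute)
      then have "(\<Sum>m\<in>?E. of_rat (c m) * (\<Prod>s\<in>S. s ^ m s)) = 0" using b(1) by simp
      then show "\<forall>m\<in>?E. c m = 0"
        using alg_indep_monomials[OF fin ind, of D] unfolding lin_indep_over_rat_finite[OF finE] by blast
    qed
    then have inj: "inj_on M ?E" and indep: "rat_complex.independent (M ` ?E)"
      by (auto simp: lin_indep_over_rat_def)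
    have "M ` ?E \<subseteq> U (n * (D * e))"
    proof clarify
      fix m assume m: "m \<in> ?E"
      have "M m = (\<Prod>s\<in>S. (s * b) ^ m s * b ^ (D - m s))"
      proof -
        have "b ^ (D * n) = (\<Prod>s\<in>S. b ^ D)" by (simp add: n_def power_mult)
        then have "M m = (\<Prod>s\<in>S. b ^ D * s ^ m s)" by (simp add: M_def prod.distrib)
        also have "\<dots> = (\<Prod>s\<in>S. (s * b) ^ m s * b ^ (D - m s))"
        proof (rule prod.cong[OF refl])
          fix s assume "s \<in> S"
          then have "m s \<le> D" using m by auto
          then have "b ^ D = b ^ m s * b ^ (D - m s)" by (simp flip: power_add)
          then show "b ^ D * s ^ m s = (s * b) ^ m s * b ^ (D - m s)"
            by (simp only: power_mult_distrib mult_ac)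
        qed
        finally show ?thesis .
      qed
      also have "\<dots> \<in> U (card S * (D * e))"
      proof (rule U_prod[OF fin])
        fix s assume s: "s \<in> S"
        then have "m s \<le> D" using m by auto
        then have "m s * e + (D - m s) * e = D * e" by (simp flip: distrib_right)
        then show "(s * b) ^ m s * b ^ (D - m s) \<in> U (D * e)"
          using U_mult[OF U_power[OF b(3)[OF s], of "m s"] U_power[OF b(2), of "D - m s"]] by simp
      qed
      finally show "M m \<in> U (n * (D * e))" by (simp add: n_def)
    qed
    then have "M ` ?E \<subseteq> rat_complex.span (red (n * (D * e)))" using U_subset_span_red by blast
    then have "card (M ` ?E) \<le> card (red (n * (D * e)))"
      using rat_complex.independent_span_bound[OF finite_red indep] by blast
    also have "card (M ` ?E) = (D + 1) ^ n"
      using fin by (simp add: card_image[OF inj] card_PiE n_def)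
    finally show ?thesis using card_red[of "n * (D * e)"] by (rule order_trans)
  qed
  \<comment> \<open>Chosen so that the constant in the bound is \<open>D\<close> itself, which is
    less than \<open>D + 1\<close>.\<close>
  define D where "D = N * k * (n * e + 1) ^ card J"
  have "n * (D * e) + 1 \<le> (n * e + 1) * (D + 1)" by (simp add: algebra_simps)
  then have "(D + 1) ^ n \<le> N * k * ((n * e + 1) * (D + 1)) ^ card J"
    using main[of D] by (meson order_trans mult_le_mono2 power_mono zero_le)
  also have "\<dots> = N * k * (n * e + 1) ^ card J * (D + 1) ^ card J"
    by (simp only: power_mult_distrib mult.assoc)
  also have "\<dots> = D * (D + 1) ^ card J" by (simp only: D_def)
  also have "\<dots> < (D + 1) * (D + 1) ^ card J" by simp
  also have "\<dots> = (D + 1) ^ (Suc (card J))" by simp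
  also have "\<dots> \<le> (D + 1) ^ n" using less by (intro power_increasing) (auto simp: n_def)
  finally show False by simp
qed

theorem trdeg_rat_adjoin_le:
  assumes "A \<subseteq> frac_field"
  shows "trdeg_over_rat (rat_adjoin A) \<le> enat (card J)"
proof -
  have "rat_adjoin A \<subseteq> frac_field"
    unfolding rat_adjoin_def using assms frac_field_subfield by (rule hull_minimal)
  then show ?thesis
    unfolding trdeg_over_rat_def by (intro SUP_least) (auto intro: alg_indep_card_le)
qed

end

section \<open>Even characters under Schanuel's conjecture\<close>

lemma dft_injective:
  fixes a :: "nat \<Rightarrow> complex"
  assumes N: "N > 0" and zero: "\<And>r. r < N \<Longrightarrow> (\<Sum>i<N. a i * rt N (r * i)) = 0" and l: "l < N"
  shows "a l = 0"
proof -
  have "0 = (\<Sum>r<N. rt N (r * ((N - 1) * l)) * (\<Sum>i<N. a i * rt N (r * i)))"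
    by (simp add: zero)
  also have "\<dots> = (\<Sum>i<N. a i * (\<Sum>r<N. rt N (r * (i + (N - 1) * l))))"
    unfolding sum_distrib_left
    by (subst sum.swap, intro sum.cong refl) (simp only: distrib_left rt_add mult_ac)
  also have "\<dots> = (\<Sum>i<N. if i = l then of_nat N * a l else 0)"
  proof (intro sum.cong refl)
    fix i assume i: "i \<in> {..<N}"
    have "N dvd i + (N - 1) * l \<longleftrightarrow> [i + (N - 1) * l + l = 0 + l] (mod N)"
      by (simp only: cong_add_rcancel_nat cong_0_iff)
    also have "i + (N - 1) * l + l = i + N * l" using N by (cases N) auto
    also have "[i + N * l = 0 + l] (mod N) \<longleftrightarrow> i = l" using i l by (simp add: cong_def)
    finally show "a i * (\<Sum>r<N. rt N (r * (i + (N - 1) * l))) = (if i = l then of_nat N * a l else 0)"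
      using N by (simp add: sum_rt)
  qed
  also have "\<dots> = of_nat N * a l" using l by simp
  finally show ?thesis using N by simp
qed

text \<open>The cyclotomic field in the form that \<open>fermat_relation\<close> demands of its
  coefficients.\<close>

definition cyclo_rat :: "nat \<Rightarrow> complex \<Rightarrow> bool" where
  "cyclo_rat N y \<longleftrightarrow> (\<exists>q :: nat \<Rightarrow> rat. y = (\<Sum>i<N. of_rat (q i) * rt N i))"

lemma cyclo_rat_add:
  assumes "cyclo_rat N y" "cyclo_rat N z"
  shows "cyclo_rat N (y + z)"
proof -
  obtain q r :: "nat \<Rightarrow> rat" where "y = (\<Sum>i<N. of_rat (q i) * rt N i)" "z = (\<Sum>i<N. of_rat (r i) * rt N i)"
    using assms unfolding cyclo_rat_def by blast
  then show ?thesis unfolding cyclo_rat_def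
    by (intro exI[of _ "\<lambda>i. q i + r i"]) (simp add: of_rat_add sum.distrib distrib_right)
qed

lemma cyclo_rat_scale:
  assumes "cyclo_rat N y"
  shows "cyclo_rat N (of_rat c * y)"
proof -
  obtain q :: "nat \<Rightarrow> rat" where "y = (\<Sum>i<N. of_rat (q i) * rt N i)"
    using assms unfolding cyclo_rat_def by blast
  then show ?thesis unfolding cyclo_rat_def
    by (intro exI[of _ "\<lambda>i. c * q i"]) (simp only: of_rat_mult sum_distrib_left mult.assoc)
qed

lemma cyclo_rat_0: "cyclo_rat N 0"
  unfolding cyclo_rat_def by (intro exI[of _ "\<lambda>i. 0"]) simp

lemma cyclo_rat_sum: "(\<And>i. i \<in> I \<Longrightarrow> cyclo_rat N (f i)) \<Longrightarrow> cyclo_rat N (\<Sum>i\<in>I. f i)"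
  by (induction I rule: infinite_finite_induct) (auto intro: cyclo_rat_add cyclo_rat_0)

lemma cyclo_rat_of_ring:
  assumes "y \<in> cyclo_ring N" "N > 0"
  shows "cyclo_rat N y"
proof -
  obtain c :: "nat \<Rightarrow> int" where "y = (\<Sum>i<N. of_int (c i) * rt N i)"
    using cyclo_ring_coords[OF assms] by blast
  then show ?thesis unfolding cyclo_rat_def by (intro exI[of _ "\<lambda>i. of_int (c i)"]) simp
qed

lemma cyclo_rat_of_rat: "N > 0 \<Longrightarrow> cyclo_rat N (of_rat c)"
  using cyclo_rat_scale[OF cyclo_rat_of_ring[OF cyclo_ring_closed(1)[of 1 N]], of c] by simp

context odd_prime_primroot
begin

lemma winv_shift: "winv j m = rt (2 * h) (j * i) * winv j (m + i)"
proof -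
  have "winv j (m + i) = winv j m * winv j i"
    unfolding winv_def distrib_left by (rule rt_add)
  then have "rt (2 * h) (j * i) * winv j (m + i) = winv j m * (winv j i * rt (2 * h) (j * i))"
    by (simp only: mult_ac)
  then show ?thesis unfolding winv_mult by simp
qed

text \<open>At \<open>r = 0\<close> there is no L-value to appeal to; there the logarithms add up to
  \<open>ln p / 2\<close>.\<close>

lemma Y_even_nonzero:
  assumes "r < h"
  shows "Y (2 * r) \<noteq> 0"
proof (cases "r = 0")
  case True
  have "Y 0 = of_real (\<Sum>i<h. lam i)" by (simp add: Y_def winv_def)
  then have "Y 0 = of_real (ln (real p) / 2)" by (simp only: sum_lam)
  moreover have "ln (real p) > 0" using p_gt_2 by simp
  ultimately have "Y 0 \<noteq> 0" by (simp only: of_real_eq_0_iff)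
  then show ?thesis using True by simp
next
  case False
  then have "dirichlet_L 1 (chi (2 * r)) \<noteq> 0" using assms by (intro dirichlet_L_chi_nonzero) auto
  then show ?thesis using dirichlet_L_even[of "2 * r"] False assms by auto
qed

lemma rt_2h_even: "rt (2 * h) (2 * r * i) = rt h (r * i)"
  using rt_scale[of 2 h "r * i"] by (simp only: mult.assoc)

text \<open>Doubling \<open>lam i\<close> makes its exponential a product of two conjugate
  cyclotomic numbers; hence the factor 2 in \<open>logs\<close>.\<close>

lemma exp_lam:
  "(1 - rt p (g ^ i)) * (1 - rt p (g ^ (i + h))) = of_real (exp (2 * lam i))"
proof -
  have "(1 - rt p (g ^ i)) * (1 - rt p (g ^ (i + h))) = (1 - rt p (g ^ i)) * cnj (1 - rt p (g ^ i))"
    by (simp add: rt_add_h_cnj)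
  also have "\<dots> = of_real ((norm (1 - rt p (g ^ i)))\<^sup>2)"
    using complex_norm_square[of "1 - rt p (g ^ i)"] by simp
  also have "(norm (1 - rt p (g ^ i)))\<^sup>2 = exp (2 * lam i)"
    unfolding lam_def using one_minus_rt_nonzero[of i] by (simp add: exp_double)
  finally show ?thesis .
qed

text \<open>
  A multiplicative relation between the cyclotomic numbers is Galois invariant, so
  the Fourier transform decomposes it along the \<open>Y j\<close>, which are nonzero.
\<close>

lemma lam_independent:
  fixes b :: "nat \<Rightarrow> int"
  assumes rel: "(\<Sum>i<h. of_int (b i) * lam i) = 0" and l: "l < h"
  shows "b l = 0"
proof -
  define E where "E = (\<lambda>i s. (1 - rt p (g ^ i * s)) * (1 - rt p (g ^ (i + h) * s)))"
  \<comment> \<open>Positive and negative exponents go to opposite sides, since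
    \<open>cyclo p\<close> provides no inverses.\<close>
  define F where "F = (\<lambda>s. (\<Prod>i<h. E i s ^ nat (b i)) - (\<Prod>i<h. E i s ^ nat (- b i)))"
  have E: "E i (g ^ m) = of_real (exp (2 * lam (i + m)))" for i m
    using exp_lam[of "i + m"] by (simp add: E_def power_add mult_ac)
  have prodE: "(\<Prod>i<h. E i (g ^ m) ^ n i) = of_real (exp (\<Sum>i<h. real (n i) * (2 * lam (i + m))))" for m n
    by (simp add: E exp_sum exp_of_nat_mult)
  have F0_iff: "F (g ^ m) = 0 \<longleftrightarrow> (\<Sum>i<h. of_int (b i) * lam (i + m)) = 0" for m
  proof -
    have "F (g ^ m) = 0 \<longleftrightarrow> (\<Sum>i<h. real (nat (b i)) * (2 * lam (i + m))) = (\<Sum>i<h. real (nat (- b i)) * (2 * lam (i + m)))"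
      unfolding F_def prodE by (simp only: right_minus_eq of_real_eq_iff exp_inj_iff)
    also have "\<dots> \<longleftrightarrow> (\<Sum>i<h. real (nat (b i)) * (2 * lam (i + m)) - real (nat (- b i)) * (2 * lam (i + m))) = 0"
      by (simp only: sum_subtractf right_minus_eq)
    also have "(\<Sum>i<h. real (nat (b i)) * (2 * lam (i + m)) - real (nat (- b i)) * (2 * lam (i + m))) =
        (\<Sum>i<h. 2 * (of_int (b i) * lam (i + m)))"
    proof (rule sum.cong[OF refl])
      fix i
      have "real (nat (b i)) - real (nat (- b i)) = of_int (b i)" by (cases "b i \<ge> 0") auto
      then show "real (nat (b i)) * (2 * lam (i + m)) - real (nat (- b i)) * (2 * lam (i + m)) = 2 * (of_int (b i) * lam (i + m))"
        unfolding left_diff_distrib[symmetric] by (simp only: mult.left_commute)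
    qed
    also have "\<dots> = 2 * (\<Sum>i<h. of_int (b i) * lam (i + m))" by (simp only: sum_distrib_left)
    finally show ?thesis by simp
  qed
  have F: "F \<in> cyclo p"
    unfolding F_def E_def by (intro cyclo_diff cyclo_prod cyclo_power cyclo_mult cyclo_1 cyclo_rt)
  have F1: "F 1 = 0" using F0_iff[of 0] rel by simp
  have conj_rel: "(\<Sum>i<h. of_int (b i) * lam (i + m)) = 0" for m
  proof -
    have "coprime p (g ^ m)" using coprime_g by simp
    then have "coprime (g ^ m) p" by (rule coprime_commute[THEN iffD1])
    then have "F (g ^ m) = 0" using p_gt_2 by (intro cyclo_conjugate_zero[OF F _ F1]) auto
    then show ?thesis using F0_iff by blast
  qed
  \<comment> \<open>The shifted relations are a cyclic correlation of \<open>b\<close> with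
    \<open>lam\<close>; the Fourier transform turns it into the transform of \<open>b\<close> times
    \<open>Y (2 * r)\<close>.\<close>
  have "(\<Sum>i<h. of_int (b i) * rt h (r * i)) = (0 :: complex)" if r: "r < h" for r
  proof -
    let ?y = "\<lambda>m. winv (2 * r) m * of_real (lam m)"
    have shift: "(\<Sum>m<h. ?y (m + i)) = Y (2 * r)" for i
      unfolding Y_def by (rule sum_shift_periodic) (simp add: winv_add_h lam_add_h)
    have "0 = (\<Sum>m<h. winv (2 * r) m * of_real (\<Sum>i<h. of_int (b i) * lam (i + m)))"
      unfolding conj_rel by simp
    also have "\<dots> = (\<Sum>i<h. \<Sum>m<h. winv (2 * r) m * (of_int (b i) * of_real (lam (m + i))))"
      by (subst sum.swap) (simp add: sum_distrib_left add.commute)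
    also have "\<dots> = (\<Sum>i<h. of_int (b i) * rt h (r * i) * (\<Sum>m<h. ?y (m + i)))"
      unfolding sum_distrib_left
    proof (intro sum.cong refl)
      fix i m
      show "winv (2 * r) m * (of_int (b i) * of_real (lam (m + i))) = of_int (b i) * rt h (r * i) * ?y (m + i)"
        unfolding winv_shift[of "2 * r" m i] rt_2h_even by (simp only: mult_ac)
    qed
    also have "\<dots> = (\<Sum>i<h. of_int (b i) * rt h (r * i)) * Y (2 * r)"
      unfolding shift by (simp only: sum_distrib_right)
    finally show ?thesis using Y_even_nonzero[OF r] by simp
  qed
  then have "(of_int (b l) :: complex) = 0" by (rule dft_injective[OF h_pos _ l])
  then show ?thesis by simp
qed

text \<open>Inversion of the transform that defines \<open>Y\<close>; even exponents suffice because
  \<open>lam\<close> has period \<open>h\<close>. It puts the logarithms into the field generated by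
  the \<open>Y (2 * r)\<close> and roots of unity.\<close>

lemma lam_from_Y:
  assumes "l < h"
  shows "of_real (lam l) = (\<Sum>r<h. rt (2 * h) (2 * r * l) * Y (2 * r)) / of_nat h"
proof -
  have "(\<Sum>r<h. rt (2 * h) (2 * r * l) * Y (2 * r)) = (\<Sum>i<h. of_real (lam i) * (\<Sum>r<h. rt h (r * (l + (2 * h - 1) * i))))"
    unfolding Y_def sum_distrib_left
  proof (subst sum.swap, intro sum.cong refl)
    fix i r
    have "winv (2 * r) i = rt h (r * ((2 * h - 1) * i))"
      using rt_2h_even[of r "(2 * h - 1) * i"] unfolding winv_def by (simp only: mult_ac)
    then show "rt (2 * h) (2 * r * l) * (winv (2 * r) i * of_real (lam i)) =
       of_real (lam i) * rt h (r * (l + (2 * h - 1) * i))"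
      unfolding rt_2h_even by (simp only: distrib_left rt_add mult_ac)
  qed
  also have "\<dots> = (\<Sum>i<h. if i = l then of_nat h * of_real (lam l) else 0)"
  proof (intro sum.cong refl)
    fix i assume i: "i \<in> {..<h}"
    have "h dvd l + (2 * h - 1) * i \<longleftrightarrow> [l + (2 * h - 1) * i + i = 0 + i] (mod h)"
      by (simp only: cong_add_rcancel_nat cong_0_iff)
    also have "l + (2 * h - 1) * i + i = l + h * (2 * i)" using h_pos by (cases h) (auto simp: algebra_simps)
    also have "[l + h * (2 * i) = 0 + i] (mod h) \<longleftrightarrow> i = l" using i assms by (auto simp: cong_def)
    finally show "of_real (lam i) * (\<Sum>r<h. rt h (r * (l + (2 * h - 1) * i))) =
        (if i = l then of_nat h * of_real (lam l) else (0 :: complex))"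
      using h_pos by (simp add: sum_rt)
  qed
  also have "\<dots> = of_nat h * of_real (lam l)" using assms by simp
  finally show ?thesis using h_pos by simp
qed

text \<open>The numbers fed to Schanuel's conjecture, indexed from 1. Their exponentials are all
  algebraic: \<open>exp_lam\<close> covers the first \<open>h\<close>, and the last one gives
  -1.\<close>

definition logs :: "nat \<Rightarrow> complex" where
  "logs n = (if n \<le> h then of_real (2 * lam (n - 1)) else \<i> * of_real pi)"

lemma logs_independent: "lin_indep_over_rat logs {1..h + 1}"
proof -
  have "\<forall>n\<in>{1..h + 1}. c n = 0" if rel: "(\<Sum>n\<in>{1..h + 1}. of_rat (c n) * logs n) = 0" for c :: "nat \<Rightarrow> rat"
  proof -
    have cr: "(of_rat q :: complex) = of_real (of_rat q)" for q
      by (cases q) (simp add: of_rat_rat)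
    have "(\<Sum>n\<in>{1..h + 1}. of_rat (c n) * logs n) = (\<Sum>n\<in>{1..h}. of_rat (c n) * logs n) + of_rat (c (h + 1)) * logs (h + 1)"
      by simp
    also have "(\<Sum>n\<in>{1..h}. of_rat (c n) * logs n) = (\<Sum>i<h. of_rat (c (i + 1)) * logs (i + 1))"
      by (rule sum.reindex_bij_witness[of _ "\<lambda>i. i + 1" "\<lambda>n. n - 1"]) auto
    also have "\<dots> = of_real (\<Sum>i<h. of_rat (c (i + 1)) * (2 * lam i))"
      by (simp add: logs_def cr)
    finally have eq: "of_real (\<Sum>i<h. of_rat (c (i + 1)) * (2 * lam i)) + \<i> * of_real (of_rat (c (h + 1)) * pi) = 0"
      using rel by (simp add: logs_def cr mult_ac)
    from arg_cong[OF eq, of Im] have "of_rat (c (h + 1)) * pi = 0" by simp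
    then have last: "c (h + 1) = 0" by simp
    obtain D :: int and d :: "nat \<Rightarrow> int" where D: "D \<noteq> 0" "\<And>i. i < h \<Longrightarrow> of_int D * c (i + 1) = of_int (d i)"
      using common_denominator[of "{..<h}" "\<lambda>i. c (i + 1)"] by auto
    from arg_cong[OF eq, of Re] have re: "(\<Sum>i<h. of_rat (c (i + 1)) * (2 * lam i)) = 0" by simp
    have "(\<Sum>i<h. of_int (d i) * lam i) = of_int D / 2 * (\<Sum>i<h. of_rat (c (i + 1)) * (2 * lam i))"
      unfolding sum_distrib_left
    proof (intro sum.cong refl)
      fix i assume "i \<in> {..<h}"
      then have "of_rat (of_int D * c (i + 1)) = (of_int (d i) :: real)" using D(2)[of i] by simp
      then show "of_int (d i) * lam i = of_int D / 2 * (of_rat (c (i + 1)) * (2 * lam i))"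
        by (simp add: of_rat_mult mult.assoc[symmetric])
    qed
    then have "(\<Sum>i<h. of_int (d i) * lam i) = 0" using re by simp
    then have "d i = 0" if "i < h" for i using that by (rule lam_independent)
    then have cz: "c (i + 1) = 0" if "i < h" for i using D(1) D(2)[OF that] that by simp
    show ?thesis
    proof
      fix n assume "n \<in> {1..h + 1}"
      then show "c n = 0" using cz[of "n - 1"] last by (cases "n = h + 1") auto
    qed
  qed
  then show ?thesis by (simp add: lin_indep_over_rat_finite)
qed

text \<open>Over a cyclotomic field, \<open>Y 0\<close>, pi times i and the \<open>h - 1\<close>
  even L-values generate all \<open>logs\<close>. The relation makes \<open>L l\<close> algebraic
  over the others, so the transcendence degree is at most \<open>h\<close>, one less than Schanuel's
  conjecture requires.\<close>

lemma even_coefficient_zero: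
  fixes c :: "nat \<Rightarrow> rat"
  assumes schanuel: schanuel_conjecture and k: "k > 0"
    and rel: "(\<Sum>j\<in>{0<..<2 * h}. of_rat (c j) * dirichlet_L 1 (chi j) ^ k) = 0"
    and l: "0 < l" "l < 2 * h" "even l"
  shows "c l = 0"
proof (rule ccontr)
  assume cl: "c l \<noteq> 0"
  define L where "L j = dirichlet_L 1 (chi j)" for j
  define N where "N = p * (2 * h)"
  have N: "2 * h dvd N" "p dvd N" "N > 0" using p_gt_2 h_pos by (auto simp: N_def)
  define Ev where "Ev = {j \<in> {0<..<2 * h}. even j \<and> j \<noteq> l}"
  define Od where "Od = {j \<in> {0<..<2 * h}. odd j}"
  \<comment> \<open>0 and 1 are free labels, as \<open>Ev\<close> contains only positive even
    numbers: 0 carries \<open>Y 0\<close>, and 1 carries pi times i, to which the odd L-values are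
    proportional.\<close>
  define J where "J = insert 0 (insert 1 Ev)"
  define x where "x = (\<lambda>j. if j = 0 then Y 0 else if j = 1 then \<i> * of_real pi else L j)"
  define v where "v = (- 1 / of_nat p ^ 2 :: rat)"
  \<comment> \<open>All odd terms merge into the coefficient of the \<open>k\<close>-th power of pi
    times i. The generator \<open>Y 0\<close> does not occur in the relation and gets coefficient
    0.\<close>
  define C where "C = (\<lambda>j. if j = 0 then 0 else if j = 1 then of_rat (- 1 / c l) * (\<Sum>j\<in>Od. of_rat (c j * v ^ k) * G j 1 ^ k)
     else of_rat (- 1 / c l) * of_rat (c j) :: complex)"
  have fin: "finite Ev" "finite Od" by (auto simp: Ev_def Od_def)
  have disj: "1 \<notin> Ev" "0 \<notin> Ev" "l \<notin> Ev" "l \<notin> Od" "Ev \<inter> Od = {}"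
    using l by (auto simp: Ev_def Od_def)
  have Lodd: "L j = \<i> * of_real pi * (of_rat v * G j 1)" if "j \<in> Od" for j
    using that dirichlet_L_odd[of j] unfolding G_1
    by (simp add: Od_def L_def v_def of_rat_divide of_rat_minus of_rat_power)
  have split: "{0<..<2 * h} = insert l (Ev \<union> Od)" using l by (auto simp: Ev_def Od_def)
  have "0 = of_rat (c l) * L l ^ k + (\<Sum>j\<in>Ev. of_rat (c j) * L j ^ k) + (\<Sum>j\<in>Od. of_rat (c j) * L j ^ k)"
    using rel disj fin unfolding split L_def[symmetric] by (simp add: sum.union_disjoint add.assoc)
  also have "(\<Sum>j\<in>Od. of_rat (c j) * L j ^ k) = (\<i> * of_real pi) ^ k * (\<Sum>j\<in>Od. of_rat (c j * v ^ k) * G j 1 ^ k)"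
    unfolding sum_distrib_left
    by (intro sum.cong refl) (simp add: Lodd power_mult_distrib of_rat_mult of_rat_power mult_ac)
  finally have rel': "of_rat (c l) * L l ^ k = - (\<Sum>j\<in>Ev. of_rat (c j) * L j ^ k)
      - (\<i> * of_real pi) ^ k * (\<Sum>j\<in>Od. of_rat (c j * v ^ k) * G j 1 ^ k)"
    by (simp add: algebra_simps eq_neg_iff_add_eq_0)
  have xEv: "x j = L j" "C j = of_rat (- 1 / c l) * of_rat (c j)" if "j \<in> Ev" for j
    using that disj by (auto simp: x_def C_def)
  have one: "of_rat (1 / c l) * of_rat (c l) = (1 :: complex)"
    using cl by (simp flip: of_rat_mult)
  have relation: "L l ^ k = (\<Sum>j\<in>J. C j * x j ^ k)"
  proof -
    have "L l ^ k = of_rat (1 / c l) * (of_rat (c l) * L l ^ k)"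
      unfolding mult.assoc[symmetric] one by simp
    also have "\<dots> = of_rat (- 1 / c l) * (\<Sum>j\<in>Ev. of_rat (c j) * L j ^ k)
        + of_rat (- 1 / c l) * ((\<i> * of_real pi) ^ k * (\<Sum>j\<in>Od. of_rat (c j * v ^ k) * G j 1 ^ k))"
      unfolding rel' by (simp add: of_rat_minus right_diff_distrib)
    also have "of_rat (- 1 / c l) * (\<Sum>j\<in>Ev. of_rat (c j) * L j ^ k) = (\<Sum>j\<in>Ev. C j * x j ^ k)"
      unfolding sum_distrib_left by (intro sum.cong refl) (simp add: xEv mult.assoc)
    also have "of_rat (- 1 / c l) * ((\<i> * of_real pi) ^ k * (\<Sum>j\<in>Od. of_rat (c j * v ^ k) * G j 1 ^ k)) = C 1 * x 1 ^ k"
      unfolding C_def x_def by (simp add: mult_ac)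
    also have "(\<Sum>j\<in>Ev. C j * x j ^ k) + C 1 * x 1 ^ k = (\<Sum>j\<in>J. C j * x j ^ k)"
      unfolding J_def using fin disj by (simp add: C_def add.commute)
    finally show ?thesis .
  qed
  have "cyclo_rat N (C j)" for j
  proof -
    have G: "cyclo_rat N (G i 1 ^ k)" for i
      by (rule cyclo_rat_of_ring[OF cyclo_value_in_ring[OF cyclo_power[OF G_cyclo[OF N]]] N(3)])
    have "cyclo_rat N (of_rat (- 1 / c l) * (\<Sum>j\<in>Od. of_rat (c j * v ^ k) * G j 1 ^ k))"
      by (intro cyclo_rat_scale cyclo_rat_sum G)
    moreover have "cyclo_rat N (of_rat (- 1 / c l) * of_rat (c j))"
      by (intro cyclo_rat_scale cyclo_rat_of_rat N)
    ultimately show ?thesis unfolding C_def using cyclo_rat_0[of N] by presburger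
  qed
  then obtain q :: "nat \<Rightarrow> nat \<Rightarrow> rat" where q: "\<And>j. C j = (\<Sum>i<N. of_rat (q j i) * rt N i)"
    unfolding cyclo_rat_def by metis
  interpret K: fermat_relation N k J x "L l" q
    by unfold_locales (use N k relation fin in \<open>auto simp: q J_def\<close>)
  have cardJ: "card J = h"
  proof -
    \<comment> \<open>There are \<open>h - 1\<close> positive even exponents; \<open>l\<close> is
      given up and two generators are added, which leaves \<open>h\<close>.\<close>
    have "insert l Ev = (\<lambda>r. 2 * r) ` {0<..<h}"
    proof (intro equalityI subsetI)
      fix j assume "j \<in> insert l Ev"
      then have "even j" "0 < j" "j < 2 * h" using l by (auto simp: Ev_def)
      then show "j \<in> (\<lambda>r. 2 * r) ` {0<..<h}" by (auto elim!: evenE)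
    qed (auto simp: Ev_def)
    then have "card (insert l Ev) = h - 1" by (simp add: card_image inj_on_def)
    then have "Suc (card Ev) = h - 1" using fin disj by simp
    then show ?thesis unfolding J_def using fin disj by simp
  qed
  have fr: "rt (2 * h) a \<in> K.frac_field" "rt p a \<in> K.frac_field" for a
    using K.frac_field_rt[of "p * a"] K.frac_field_rt[of "2 * h * a"] rt_scale[of p "2 * h" a] rt_scale[of "2 * h" p a]
      p_gt_2 h_pos by (simp_all add: N_def mult.commute)
  have fL: "L j \<in> K.frac_field" if "0 < j" "j < 2 * h" "even j" for j
  proof (cases "j = l")
    case True
    then show ?thesis using K.frac_field_t by simp
  next
    case False
    then have "j \<in> Ev" using that by (simp add: Ev_def)
    then show ?thesis using K.frac_field_x[of j] xEv by (simp add: J_def)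
  qed
  have ftau: "tau j \<in> K.frac_field" for j
    unfolding tau_def by (intro K.frac_field_sum K.frac_field_mult fr)
  have fY: "Y (2 * r) \<in> K.frac_field" if "r < h" for r
  proof (cases "r = 0")
    case True
    then show ?thesis using K.frac_field_x[of 0] by (simp add: J_def x_def)
  next
    case False
    have "tau (2 * r) \<noteq> 0" using False that by (intro tau_nonzero) auto
    then have "Y (2 * r) = - (of_nat p * L (2 * r) / (of_nat 2 * tau (2 * r)))"
      using dirichlet_L_even[of "2 * r"] False that p_gt_2 by (simp add: L_def)
    moreover have "L (2 * r) \<in> K.frac_field" using False that by (intro fL) auto
    ultimately show ?thesis
      by (simp only:) (intro K.frac_field_minus K.frac_field_divide K.frac_field_mult K.frac_field_of_nat ftau)
  qed
  have flam: "of_real (lam i) \<in> K.frac_field" if "i < h" for i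
    unfolding lam_from_Y[OF that]
    by (intro K.frac_field_divide K.frac_field_sum K.frac_field_mult K.frac_field_of_nat fr fY) simp
  have flogs: "logs n \<in> K.frac_field" if "n \<in> {1..h + 1}" for n
  proof (cases "n \<le> h")
    case True
    then have "of_nat 2 * of_real (lam (n - 1)) \<in> K.frac_field"
      using that by (intro K.frac_field_mult K.frac_field_of_nat flam) auto
    then show ?thesis using True by (simp add: logs_def)
  next
    case False
    then show ?thesis using K.frac_field_x[of 1] by (simp add: J_def x_def logs_def)
  qed
  have fexp: "exp (logs n) \<in> K.frac_field" for n
  proof (cases "n \<le> h")
    case True
    have "exp (logs n) = of_real (exp (2 * lam (n - 1)))"
      using True by (simp only: logs_def if_True exp_of_real)
    also have "\<dots> = (1 + - rt p (g ^ (n - 1))) * (1 + - rt p (g ^ (n - 1 + h)))"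
      using exp_lam[of "n - 1"] by simp
    also have "\<dots> \<in> K.frac_field"
      by (intro K.frac_field_mult K.frac_field_add K.frac_field_minus K.frac_field_1 fr)
    finally show ?thesis .
  next
    case False
    then have "exp (logs n) = - 1" by (simp add: logs_def mult.commute)
    then show ?thesis using K.frac_field_minus[OF K.frac_field_1] by simp
  qed
  have "trdeg_over_rat (rat_adjoin (logs ` {1..h + 1} \<union> (\<lambda>i. exp (logs i)) ` {1..h + 1})) \<ge> enat (h + 1)"
    using schanuel logs_independent unfolding schanuel_conjecture_def by blast
  moreover have "trdeg_over_rat (rat_adjoin (logs ` {1..h + 1} \<union> (\<lambda>i. exp (logs i)) ` {1..h + 1})) \<le> enat (card J)"
    using flogs fexp by (intro K.trdeg_rat_adjoin_le) auto
  ultimately have "enat (h + 1) \<le> enat h" unfolding cardJ by (rule order_trans)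
  then show False by simp
qed

lemma lin_indep_chi_image:
  assumes "A \<subseteq> {..<2 * h}"
    and indep: "\<And>c. (\<Sum>j\<in>A. of_rat (c j) * f (chi j)) = 0 \<Longrightarrow> \<forall>j\<in>A. c j = 0"
  shows "lin_indep_over_rat f (chi ` A)"
proof -
  have fin: "finite A" using assms(1) finite_subset by blast
  have inj: "inj_on chi A" using chi_inj assms(1) by (rule inj_on_subset)
  have "\<forall>\<psi>\<in>chi ` A. c \<psi> = 0" if "(\<Sum>\<psi>\<in>chi ` A. of_rat (c \<psi>) * f \<psi>) = 0" for c
    using indep[of "\<lambda>j. c (chi j)"] that by (simp add: sum.reindex[OF inj])
  then show ?thesis unfolding lin_indep_over_rat_finite[OF finite_imageI[OF fin]] by blast
qed

end

theorem theorem2: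
  fixes k p :: nat
  assumes "k \<ge> 1"
    and "prime p" and "odd p"
    and "gcd k (p - 1) \<le> 2 \<or> ([p = 5] (mod 8) \<and> gcd k (p - 1) = 4)"
  shows "lin_indep_over_rat (\<lambda>\<psi>. dirichlet_L 1 \<psi> ^ k)
           {\<psi> \<in> dirichlet_characters p. odd_character \<psi>} \<and>
         (schanuel_conjecture \<longrightarrow>
           lin_indep_over_rat (\<lambda>\<psi>. dirichlet_L 1 \<psi> ^ k)
             {\<psi> \<in> dirichlet_characters p. \<psi> \<noteq> principal_character p})"
proof -
  obtain g where "residue_primroot p g"
    using prime_primitive_root_exists[of p] assms(2) prime_gt_1_nat by blast
  then interpret odd_prime_primroot p g using assms(2,3) by unfold_locales
  have k: "k > 0" using assms(1) by simp
  have odds: "{\<psi> \<in> dirichlet_characters p. odd_character \<psi>} = chi ` {j. j < 2 * h \<and> odd j}"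
    unfolding dirichlet_characters_eq using odd_chi by auto
  have nonprincipal: "{\<psi> \<in> dirichlet_characters p. \<psi> \<noteq> principal_character p} = chi ` {0<..<2 * h}"
  proof -
    have eq: "chi j \<noteq> principal_character p \<longleftrightarrow> 0 < j" if "j < 2 * h" for j
      using that chi_nonprincipal[of j] chi_0 by (cases "j = 0") auto
    have "{j \<in> {..<2 * h}. chi j \<noteq> principal_character p} = {0<..<2 * h}"
    proof (rule Set.set_eqI)
      fix j
      show "j \<in> {j \<in> {..<2 * h}. chi j \<noteq> principal_character p} \<longleftrightarrow> j \<in> {0<..<2 * h}"
        using eq[of j] by (cases "j < 2 * h") auto
    qed
    then show ?thesis unfolding dirichlet_characters_eq Compr_image_eq by (rule arg_cong)
  qed
  show ?thesis
    unfolding odds nonprincipal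
  proof (intro conjI impI lin_indep_chi_image ballI)
    fix c :: "nat \<Rightarrow> rat" and j
    assume "(\<Sum>j | j < 2 * h \<and> odd j. of_rat (c j) * dirichlet_L 1 (chi j) ^ k) = 0"
      and "j \<in> {j. j < 2 * h \<and> odd j}"
    then show "c j = 0" using odd_powers_independent[OF assms(4) k] by blast
  next
    fix c :: "nat \<Rightarrow> rat" and j
    assume schanuel: schanuel_conjecture
      and rel: "(\<Sum>j\<in>{0<..<2 * h}. of_rat (c j) * dirichlet_L 1 (chi j) ^ k) = 0"
      and j: "j \<in> {0<..<2 * h}"
    have evens: "c i = 0" if "i \<in> {0<..<2 * h}" "even i" for i
      using that by (intro even_coefficient_zero[OF schanuel k rel]) auto
    \<comment> \<open>With the even coefficients gone, the relation is one between odd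
      characters.\<close>
    have "(\<Sum>j | j < 2 * h \<and> odd j. of_rat (c j) * dirichlet_L 1 (chi j) ^ k) =
        (\<Sum>j\<in>{0<..<2 * h}. of_rat (c j) * dirichlet_L 1 (chi j) ^ k)"
      using evens by (intro sum.mono_neutral_left) (auto simp: odd_pos)
    then have "(\<Sum>j | j < 2 * h \<and> odd j. of_rat (c j) * dirichlet_L 1 (chi j) ^ k) = 0"
      using rel by simp
    then show "c j = 0"
      using j evens[of j] odd_powers_independent[OF assms(4) k, of c j] by auto
  qed auto
qed

end
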